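(* Let $\alpha\in(1,2)$, $\beta=\alpha/2$, and let $u$ be the solution attached to the data $a_0,a_1,f$ as in the context, with $g(x,t)=t^{1-\alpha}f(x)$. Suppose $a_0\in H^2(\Omega)\cap H_0^1(\Omega)$, $a_1\in L^2(\Omega)$ and $t^{\alpha-1}g(\cdot,t)=f\in L^2(\Omega)$. Then the following hold on the graded mesh $t_k=T(k/N)^r$, with a constant $C$ independent of $n$ and $N$. (i) If $r=\frac{4-\alpha}{2-\alpha}$, the $L1$ scheme for the $(u,v)$-system, with numerical solution $(U^n,V^n)$, satisfies $\max_{1\le n\le N}\|u(t_n)-U^n\|_{L^2(\Omega)}\le CN^{-(2-\alpha/2)}$. (ii) If $r=\max\{\frac{4-\alpha}{\alpha},2\}$, the $L1$ scheme for the $(u,z)$-system, with numerical solution $(U^n,Z^n)$, satisfies $\max_{1\le n\le N}\|u(t_n)-U^n\|_{L^2(\Omega)}\le CN^{-(2-\alpha/2)}$.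
   Context: Setting: $\Omega=(0,L)$, $T>0$, $\Delta=\partial_{xx}$ with homogeneous Dirichlet conditions; $\{\lambda_k,\varphi_k\}_{k\ge1}$ are the Dirichlet eigenpairs of $-\Delta$ on $\Omega$, with $\{\varphi_k\}$ orthonormal in $L^2(\Omega)$. Put $\omega_\mu(t)=t^{\mu-1}/\Gamma(\mu)$ and $E_{\alpha,\nu}(y)=\sum_{k\ge0}y^k/\Gamma(\alpha k+\nu)$. For $0<\delta<1$ the Caputo derivative is $\partial_t^\delta\psi(t)=\int_0^t\omega_{1-\delta}(t-s)\psi'(s)\,ds$, and for $1<\delta<2$ it is $\partial_t^\delta\psi(t)=\int_0^t\omega_{2-\delta}(t-s)\psi''(s)\,ds$. Problem: $\partial_t^\alpha u-u_{xx}=g$ in $\Omega\times(0,T)$, $u(x,0)=a_0(x)$, $\partial_tu(x,0)=a_1(x)$, $u=0$ on $\partial\Omega\times(0,T)$, with $g(x,t)=t^{1-\alpha}f(x)$. Its solution is $$u(x,t)=\sum_{n\ge1}E_{\alpha,1}(-\lambda_nt^\alpha)(a_0,\varphi_n)\varphi_n(x)+\sum_{n\ge1}tE_{\alpha,2}(-\lambda_nt^\alpha)\big((a_1,\varphi_n)+\Gamma(2-\alpha)(f,\varphi_n)\big)\varphi_n(x).$$ The $(u,v)$-system is $\partial_t^\beta v-u_{xx}=a_1\omega_{2-\alpha}(t)+g$, $v=\partial_t^\beta u$, $u(0)=a_0$, $v(0)=0$, $u=v=0$ on $\partial\Omega$. The $(u,z)$-system is $\partial_t^\beta z-u_{xx}=0$,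 $z=\partial_t^\beta u-[a_1+\Gamma(2-\alpha)f]\omega_{2-\alpha/2}(t)$, $u(0)=a_0$, $z(0)=0$, $u=z=0$ on $\partial\Omega$. (With data of this low regularity, equations and boundary conditions for $v,z$ are understood weakly, i.e. through the expansions in $\{\varphi_k\}$.) $L1$ formula on $t_k=T(k/N)^r$, $0\le k\le N$, with $\tau_k=t_k-t_{k-1}$ and $\nabla_\tau w^k=w^k-w^{k-1}$: $(\bar\partial_t^\beta w)^n=\sum_{k=1}^nA^{(n)}_{n-k}\nabla_\tau w^k$, where $A^{(n)}_{n-k}=\frac1{\tau_k}\int_{t_{k-1}}^{t_k}\omega_{1-\beta}(t_n-s)\,ds$. $L1$ scheme (time semi-discrete) for the $(u,v)$-system: for $1\le n\le N$, $(\bar\partial_t^\beta V)^n-\Delta U^n=a_1\omega_{2-\alpha}(t_n)+t_n^{1-\alpha}f$ and $V^n=(\bar\partial_t^\beta U)^n$, with $U^0=a_0$, $V^0=0$ and $U^n=V^n=0$ on $\partial\Omega$. $L1$ scheme for the $(u,z)$-system: for $1\le n\le N$, $(\bar\partial_t^\beta Z)^n-\Delta U^n=0$ and $Z^n=(\bar\partial_t^\beta U)^n-[a_1+\Gamma(2-\alpha)f]\omega_{2-\beta}(t_n)$, with $U^0=a_0$, $Z^0=0$ and $U^n=Z^n=0$ on $\partial\Omega$. *)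

theory Defs
  imports "HOL-Analysis.Analysis"
begin

section \<open>Function spaces on \<open>(0, L)\<close>\<close>

text \<open>
  Elements of \<open>L\<^sup>2(0, L)\<close> are represented by functions on the whole real line whose values outside
  \<open>(0, L)\<close> are irrelevant; equality in \<open>L\<^sup>2(0, L)\<close> is equality almost everywhere on \<open>(0, L)\<close>.
\<close>

definition L2_space :: "real \<Rightarrow> (real \<Rightarrow> real) set" where
  "L2_space L = {w. w \<in> borel_measurable (lebesgue_on {0<..<L}) \<and>
                    integrable (lebesgue_on {0<..<L}) (\<lambda>x. (w x)\<^sup>2)}"

definition L2_inner :: "real \<Rightarrow> (real \<Rightarrow> real) \<Rightarrow> (real \<Rightarrow> real) \<Rightarrow> real" where
  "L2_inner L v w = (\<integral>x. v x * w x \<partial>lebesgue_on {0<..<L})"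

definition L2_norm :: "real \<Rightarrow> (real \<Rightarrow> real) \<Rightarrow> real" where
  "L2_norm L w = sqrt (L2_inner L w w)"

definition L2_eq :: "real \<Rightarrow> (real \<Rightarrow> real) \<Rightarrow> (real \<Rightarrow> real) \<Rightarrow> bool" where
  "L2_eq L v w \<longleftrightarrow> (AE x in lebesgue_on {0<..<L}. v x = w x)"

text \<open>
  Convergence in \<open>L\<^sup>2(0, L)\<close> of a series indexed from \<open>1\<close>. Membership of the limit is required because
  the Bochner integral of a non-integrable function is \<open>0\<close>.
\<close>

definition L2_sums :: "real \<Rightarrow> (nat \<Rightarrow> real \<Rightarrow> real) \<Rightarrow> (real \<Rightarrow> real) \<Rightarrow> bool" where
  "L2_sums L w s \<longleftrightarrow> (\<forall>n\<ge>1. w n \<in> L2_space L) \<and> s \<in> L2_space L \<and>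
     (\<lambda>M. L2_norm L (\<lambda>x. (\<Sum>n=1..M. w n x) - s x)) \<longlonglongrightarrow> 0"

text \<open>\<open>C\<^sub>c\<^sup>\<infinity>(0, L)\<close>, extended by zero to the real line.\<close>

definition test_fun :: "real \<Rightarrow> (real \<Rightarrow> real) \<Rightarrow> bool" where
  "test_fun L \<psi> \<longleftrightarrow> (\<forall>n x. ((deriv ^^ n) \<psi>) differentiable (at x)) \<and>
     (\<exists>a b. 0 < a \<and> b < L \<and> (\<forall>x. x \<notin> {a..b} \<longrightarrow> \<psi> x = 0))"

definition weak_deriv :: "real \<Rightarrow> (real \<Rightarrow> real) \<Rightarrow> (real \<Rightarrow> real) \<Rightarrow> bool" where
  "weak_deriv L w dw \<longleftrightarrow>
     (\<forall>\<psi>. test_fun L \<psi> \<longrightarrow> L2_inner L w (deriv \<psi>) = - L2_inner L dw \<psi>)"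

definition H2_space :: "real \<Rightarrow> (real \<Rightarrow> real) set" where
  "H2_space L = {w \<in> L2_space L. \<exists>dw \<in> L2_space L. \<exists>ddw \<in> L2_space L.
                   weak_deriv L w dw \<and> weak_deriv L dw ddw}"

text \<open>\<open>H\<^sub>0\<^sup>1(0, L)\<close> is the closure of the test functions in the \<open>H\<^sup>1\<close>-norm.\<close>

definition H10_space :: "real \<Rightarrow> (real \<Rightarrow> real) set" where
  "H10_space L = {w \<in> L2_space L. \<exists>dw \<in> L2_space L. weak_deriv L w dw \<and>
     (\<forall>e>0. \<exists>\<psi>. test_fun L \<psi> \<and> L2_norm L (\<lambda>x. w x - \<psi> x) < e \<and>
                L2_norm L (\<lambda>x. dw x - deriv \<psi> x) < e)}"

section \<open>Dirichlet eigenpairs\<close>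

definition dirichlet_eigenpair :: "real \<Rightarrow> real \<Rightarrow> (real \<Rightarrow> real) \<Rightarrow> bool" where
  "dirichlet_eigenpair L \<mu> \<psi> \<longleftrightarrow>
     (\<exists>x\<in>{0..L}. \<psi> x \<noteq> 0) \<and> \<psi> 0 = 0 \<and> \<psi> L = 0 \<and>
     (\<exists>d\<psi>. \<forall>x\<in>{0..L}. (\<psi> has_real_derivative d\<psi> x) (at x within {0..L}) \<and>
                      (d\<psi> has_real_derivative - \<mu> * \<psi> x) (at x within {0..L}))"

text \<open>
  An \<open>L\<^sup>2\<close>-orthonormal enumeration, indexed from \<open>1\<close>, of all Dirichlet eigenpairs. Since the
  eigenvalues on an interval are simple, listing every eigenvalue lists every eigenfunction up to a
  scalar factor.
\<close>

definition dirichlet_eigenpairs :: "real \<Rightarrow> (nat \<Rightarrow> real) \<Rightarrow> (nat \<Rightarrow> real \<Rightarrow> real) \<Rightarrow> bool" where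
  "dirichlet_eigenpairs L lam \<phi> \<longleftrightarrow>
     (\<forall>k\<ge>1. dirichlet_eigenpair L (lam k) (\<phi> k)) \<and>
     (\<forall>j\<ge>1. \<forall>k\<ge>1. L2_inner L (\<phi> j) (\<phi> k) = (if j = k then 1 else 0)) \<and>
     (\<forall>\<mu> \<psi>. dirichlet_eigenpair L \<mu> \<psi> \<longrightarrow> (\<exists>k\<ge>1. lam k = \<mu>))"

section \<open>The solution of the fractional wave problem\<close>

definition omega :: "real \<Rightarrow> real \<Rightarrow> real" where
  "omega \<mu> t = t powr (\<mu> - 1) / Gamma \<mu>"

definition mittag_leffler :: "real \<Rightarrow> real \<Rightarrow> real \<Rightarrow> real" where
  "mittag_leffler \<alpha> \<nu> y = (\<Sum>k. y ^ k / Gamma (\<alpha> * real k + \<nu>))"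

text \<open>
  The series solution of \<open>\<partial>\<^sub>t\<^sup>\<alpha> u - u\<^sub>x\<^sub>x = t\<^bsup>1-\<alpha>\<^esup> f\<close>, \<open>u(0) = a0\<close>, \<open>\<partial>\<^sub>t u(0) = a1\<close>, with homogeneous
  Dirichlet conditions; \<open>u t\<close> is the function \<open>x \<mapsto> u(x, t)\<close> and both series converge in \<open>L\<^sup>2(0, L)\<close>.
\<close>

definition wave_solution ::
  "real \<Rightarrow> real \<Rightarrow> (nat \<Rightarrow> real) \<Rightarrow> (nat \<Rightarrow> real \<Rightarrow> real) \<Rightarrow> real \<Rightarrow>
   (real \<Rightarrow> real) \<Rightarrow> (real \<Rightarrow> real) \<Rightarrow> (real \<Rightarrow> real) \<Rightarrow> (real \<Rightarrow> real \<Rightarrow> real) \<Rightarrow> bool" where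
  "wave_solution L T lam \<phi> \<alpha> a0 a1 f u \<longleftrightarrow>
     (\<forall>t\<in>{0..T}. u t \<in> L2_space L \<and> (\<exists>p q.
        L2_sums L (\<lambda>n x. mittag_leffler \<alpha> 1 (- lam n * t powr \<alpha>) * L2_inner L a0 (\<phi> n) * \<phi> n x) p \<and>
        L2_sums L (\<lambda>n x. t * mittag_leffler \<alpha> 2 (- lam n * t powr \<alpha>) *
          (L2_inner L a1 (\<phi> n) + Gamma (2 - \<alpha>) * L2_inner L f (\<phi> n)) * \<phi> n x) q \<and>
        L2_eq L (u t) (\<lambda>x. p x + q x)))"

section \<open>The L1 schemes\<close>

definition mesh :: "real \<Rightarrow> real \<Rightarrow> nat \<Rightarrow> nat \<Rightarrow> real" where
  "mesh T r N k = T * (real k / real N) powr r"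

text \<open>\<open>L1_coeff \<beta> t n k\<close> is \<open>A\<^sup>(\<^sup>n\<^sup>)\<^sub>n\<^sub>-\<^sub>k\<close>: the second index is \<open>k\<close>, not \<open>n - k\<close>.\<close>

definition L1_coeff :: "real \<Rightarrow> (nat \<Rightarrow> real) \<Rightarrow> nat \<Rightarrow> nat \<Rightarrow> real" where
  "L1_coeff \<beta> t n k =
     1 / (t k - t (k - 1)) * integral {t (k - 1)..t k} (\<lambda>s. omega (1 - \<beta>) (t n - s))"

definition L1_deriv :: "real \<Rightarrow> (nat \<Rightarrow> real) \<Rightarrow> (nat \<Rightarrow> real \<Rightarrow> real) \<Rightarrow> nat \<Rightarrow> real \<Rightarrow> real" where
  "L1_deriv \<beta> t w n x = (\<Sum>k=1..n. L1_coeff \<beta> t n k * (w k x - w (k - 1) x))"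

text \<open>
  \<open>weak_eq L lam \<phi> p w h\<close> is the equation \<open>p - \<Delta> w = h\<close> with the Dirichlet Laplacian \<open>\<Delta>\<close>, understood
  through the expansions in the eigenfunctions, where \<open>-\<Delta>\<close> acts as multiplication by \<open>lam\<close>.
\<close>

definition weak_eq :: "real \<Rightarrow> (nat \<Rightarrow> real) \<Rightarrow> (nat \<Rightarrow> real \<Rightarrow> real) \<Rightarrow>
   (real \<Rightarrow> real) \<Rightarrow> (real \<Rightarrow> real) \<Rightarrow> (real \<Rightarrow> real) \<Rightarrow> bool" where
  "weak_eq L lam \<phi> p w h \<longleftrightarrow>
     (\<forall>k\<ge>1. L2_inner L p (\<phi> k) + lam k * L2_inner L w (\<phi> k) = L2_inner L h (\<phi> k))"

text \<open>
  In both schemes \<open>\<beta> = \<alpha> / 2\<close>. The boundary condition on \<open>U\<close> is membership in \<open>H\<^sub>0\<^sup>1(0, L)\<close>; those on the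
  second component are weak, that component being a general element of \<open>L\<^sup>2(0, L)\<close> (the datum
  \<open>a1 + \<Gamma>(2-\<alpha>) f\<close> entering \<open>Z\<close> has no boundary values).
\<close>

definition uv_scheme :: "real \<Rightarrow> (nat \<Rightarrow> real) \<Rightarrow> (nat \<Rightarrow> real \<Rightarrow> real) \<Rightarrow> real \<Rightarrow>
   (real \<Rightarrow> real) \<Rightarrow> (real \<Rightarrow> real) \<Rightarrow> (real \<Rightarrow> real) \<Rightarrow> (nat \<Rightarrow> real) \<Rightarrow> nat \<Rightarrow>
   (nat \<Rightarrow> real \<Rightarrow> real) \<Rightarrow> (nat \<Rightarrow> real \<Rightarrow> real) \<Rightarrow> bool" where
  "uv_scheme L lam \<phi> \<alpha> a0 a1 f t N U V \<longleftrightarrow>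
     (\<forall>n\<le>N. U n \<in> L2_space L \<and> V n \<in> L2_space L) \<and>
     L2_eq L (U 0) a0 \<and> L2_eq L (V 0) (\<lambda>x. 0) \<and>
     (\<forall>n\<in>{1..N}. U n \<in> H10_space L \<and>
        weak_eq L lam \<phi> (L1_deriv (\<alpha> / 2) t V n) (U n)
          (\<lambda>x. a1 x * omega (2 - \<alpha>) (t n) + t n powr (1 - \<alpha>) * f x) \<and>
        L2_eq L (V n) (L1_deriv (\<alpha> / 2) t U n))"

definition uz_scheme :: "real \<Rightarrow> (nat \<Rightarrow> real) \<Rightarrow> (nat \<Rightarrow> real \<Rightarrow> real) \<Rightarrow> real \<Rightarrow>
   (real \<Rightarrow> real) \<Rightarrow> (real \<Rightarrow> real) \<Rightarrow> (real \<Rightarrow> real) \<Rightarrow> (nat \<Rightarrow> real) \<Rightarrow> nat \<Rightarrow>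
   (nat \<Rightarrow> real \<Rightarrow> real) \<Rightarrow> (nat \<Rightarrow> real \<Rightarrow> real) \<Rightarrow> bool" where
  "uz_scheme L lam \<phi> \<alpha> a0 a1 f t N U Z \<longleftrightarrow>
     (\<forall>n\<le>N. U n \<in> L2_space L \<and> Z n \<in> L2_space L) \<and>
     L2_eq L (U 0) a0 \<and> L2_eq L (Z 0) (\<lambda>x. 0) \<and>
     (\<forall>n\<in>{1..N}. U n \<in> H10_space L \<and>
        weak_eq L lam \<phi> (L1_deriv (\<alpha> / 2) t Z n) (U n) (\<lambda>x. 0) \<and>
        L2_eq L (Z n) (\<lambda>x. L1_deriv (\<alpha> / 2) t U n x -
          (a1 x + Gamma (2 - \<alpha>) * f x) * omega (2 - \<alpha> / 2) (t n)))"

end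

theory Submission
  imports Defs "HOL-Complex_Analysis.Complex_Analysis" "HOL-Real_Asymp.Real_Asymp"
begin

text \<open>
Write \<open>\<beta> = \<alpha> / 2\<close>. In the orthonormal system of Dirichlet eigenfunctions the problem and both schemes
decouple into scalar ones. For the eigenvalue \<open>\<lambda>\<close>, let \<open>a\<close> and \<open>b\<close> be the coefficients of \<open>a0\<close> and of
\<open>a1 + \<Gamma>(2 - \<alpha>) f\<close>. Then the exact solution is
\<open>u(t) = a E\<^sub>\<alpha>\<^sub>,\<^sub>1(-\<lambda> t\<^sup>\<alpha>) + b t E\<^sub>\<alpha>\<^sub>,\<^sub>2(-\<lambda> t\<^sup>\<alpha>)\<close>. The heart of the proof is a scalar estimate that is uniform
in \<open>\<lambda>\<close>: the error is at most \<open>C (\<lambda> \<bar>a\<bar> + \<bar>b\<bar>) N powr (\<beta> - 2)\<close> (\<open>uv_mode_error\<close>, \<open>uz_mode_error\<close>). It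
is summed over the modes by Bessel's inequality. The numbers \<open>b\<close> are the coefficients of an \<open>L\<^sup>2\<close>
function, and so are the numbers \<open>\<lambda> a\<close>, because \<open>-\<lambda> a\<close> is a coefficient of the second derivative of
\<open>a0\<close> (\<open>H2_H10_sine_coefficient\<close>). Turning a bound on coefficients into a bound on the \<open>L\<^sup>2\<close> norm needs
that the error lies in the closed span of the eigenfunctions. The series \<open>u(t)\<close> does so by
construction, the discrete solution because it is in \<open>H\<^sub>0\<^sup>1\<close> and the sines are complete there
(\<open>H10_in_closed_span\<close>).

The scalar estimate has three ingredients.

\<^item> Stability (\<open>L1_stability\<close>, \<open>L1_system_error\<close>). Let \<open>D\<close> be the L1 operator. The errors combine to one
  complex sequence \<open>W = (v - V) + \<i> sqrt \<lambda> (u - U)\<close> with \<open>D W = \<i> sqrt \<lambda> W + F\<close>, where \<open>F\<close> is made of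
  the truncation errors. The weights of \<open>D\<close> are positive and increase towards the current time level,
  and \<open>\<i> sqrt \<lambda>\<close> is purely imaginary. Hence \<open>\<bar>W\<bar> \<le> S\<close> as soon as \<open>\<bar>F\<^sub>n\<bar> \<le> S A\<close> with \<open>A\<close> the weight of the
  first cell. As \<open>A \<ge> \<omega>\<^bsub>1-\<beta>\<^esub>(t\<^sub>n)\<close>, a truncation error of size \<open>\<rho> t\<^sub>n powr -\<beta>\<close> costs only a multiple of
  \<open>\<rho>\<close>, independently of \<open>\<lambda>\<close>.

\<^item> Truncation (\<open>L1_truncation\<close>). If \<open>\<bar>w'(t)\<bar> \<le> M t powr (\<sigma> - 1)\<close> and \<open>\<bar>w''(t)\<bar> \<le> M t powr (\<sigma> - 2)\<close>, then
  on a mesh with \<open>r \<sigma> \<ge> 2 - \<beta>\<close> the truncation error is at most \<open>C M N powr (\<beta> - 2) t\<^sub>n powr -\<beta>\<close>.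

\<^item> Regularity. All derivatives that occur are powers of \<open>t\<close> times Mittag-Leffler functions at the
  negative argument \<open>-\<lambda> t\<^sup>\<alpha>\<close>, and \<open>\<bar>E\<^sub>\<alpha>\<^sub>,\<^sub>\<nu>(-y)\<bar> \<le> C / (1 + y)\<close> for \<open>1 < \<alpha> < 2\<close> (\<open>mittag_leffler_bound\<close>). This
  gives \<open>\<sigma> = 1\<close> for \<open>u\<close>, \<open>\<sigma> = 1 - \<beta>\<close> for \<open>v\<close> and \<open>\<sigma> = \<beta>\<close> for \<open>z\<close>. The grading exponents of the two parts
  are what \<open>r \<sigma> \<ge> 2 - \<beta>\<close> asks for \<open>v\<close> and \<open>z\<close> respectively, \<open>(2 - \<beta>) / (1 - \<beta>)\<close> and \<open>(2 - \<beta>) / \<beta>\<close>; the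
  lower bound \<open>2\<close> in the second one covers \<open>u\<close>. Subtracting the singular term of \<open>v\<close> to form \<open>z\<close> is
  what improves the exponent.
\<close>

section \<open>Primitives of double exponentials on strips\<close>

lemma power_div_fact_le_exp:
  fixes y :: real
  assumes "y \<ge> 0"
  shows "y ^ m / fact m \<le> exp y"
proof -
  have "(\<Sum>n\<in>{m}. y ^ n /\<^sub>R fact n) \<le> (\<Sum>n. y ^ n /\<^sub>R fact n)"
    using assms by (intro sum_le_suminf summable_exp_generic) auto
  then show ?thesis by (simp add: exp_def divide_inverse mult.commute)
qed

lemma horizontal_derivative:
  assumes "(G has_field_derivative D) (at (Complex x \<eta>))"
  shows "((\<lambda>x. G (Complex x \<eta>)) has_vector_derivative D) (at x)"
proof -
  have "((\<lambda>x. of_real x + \<i> * of_real \<eta>) has_vector_derivative 1) (at x)"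
    using has_vector_derivative_add[OF has_vector_derivative_of_real[of "\<lambda>x. x" 1 "at x"]
        has_vector_derivative_const[of "\<i> * of_real \<eta>" "at x"]] by simp
  then have 1: "((\<lambda>x. Complex x \<eta>) has_vector_derivative 1) (at x)"
    by (simp add: Complex_eq)
  show ?thesis
    using field_vector_diff_chain_at[OF 1, of G D] assms by (auto simp: o_def)
qed

text \<open>
Provides an integrable majorant on the horizontal parts of the contours below: in the variable
\<open>w = ln s\<close> the factor \<open>e\<^sup>s\<close> decays doubly exponentially along a ray in the left half plane.
\<close>

lemma double_exp_decay:
  fixes \<kappa> \<delta> :: real
  assumes "\<delta> > 0"
  obtains C where "C > 0" "\<And>x. x \<ge> 0 \<Longrightarrow> exp (- (\<delta> * exp x)) * exp (\<kappa> * x) \<le> C * exp (- x)"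
proof -
  obtain m :: nat where m: "\<kappa> + 1 \<le> real m" using real_arch_simple by blast
  define C where "C = fact m / \<delta> ^ m"
  show ?thesis
  proof
    show "C > 0" using assms by (simp add: C_def)
    fix x :: real assume x: "x \<ge> 0"
    have "(\<delta> * exp x) ^ m / fact m \<le> exp (\<delta> * exp x)"
      using assms by (intro power_div_fact_le_exp) auto
    then have 1: "exp x ^ m \<le> C * exp (\<delta> * exp x)"
      using assms by (simp add: C_def field_simps power_mult_distrib)
    have "exp (\<kappa> * x) * exp x \<le> exp x ^ m"
      using m x mult_right_mono[of "\<kappa> + 1" "real m" x]
      by (simp add: exp_of_nat_mult[symmetric] exp_add[symmetric] algebra_simps)
    also note 1
    finally show "exp (- (\<delta> * exp x)) * exp (\<kappa> * x) \<le> C * exp (- x)"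
      by (simp add: exp_minus field_simps)
  qed
qed

lemma vertical_increment_bound:
  assumes "a \<le> b"
    and G: "\<And>\<eta>. a \<le> \<eta> \<Longrightarrow> \<eta> \<le> b \<Longrightarrow> (G has_field_derivative F (Complex R \<eta>)) (at (Complex R \<eta>))"
    and bd: "\<And>\<eta>. a \<le> \<eta> \<Longrightarrow> \<eta> \<le> b \<Longrightarrow> norm (F (Complex R \<eta>)) \<le> M"
  shows "norm (G (Complex R b) - G (Complex R a)) \<le> M * (b - a)"
proof -
  have "norm (G (Complex R b) - G (Complex R a)) \<le> M * norm (Complex R b - Complex R a)"
  proof (rule field_differentiable_bound[where S = "closed_segment (Complex R a) (Complex R b)"])
    fix z assume "z \<in> closed_segment (Complex R a) (Complex R b)"
    then obtain s where s: "0 \<le> s" "s \<le> 1" "z = (1 - s) *\<^sub>R Complex R a + s *\<^sub>R Complex R b"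
      by (auto simp: in_segment)
    have z: "z = Complex R ((1 - s) * a + s * b)" using s by (auto simp: complex_eq_iff algebra_simps)
    have "(1 - s) * a + s * b \<le> b" "a \<le> (1 - s) * a + s * b"
      using s \<open>a \<le> b\<close> convex_bound_le[of a b b "1 - s" s] mult_left_mono[of a b s]
      by (auto simp: algebra_simps)
    then show "(G has_field_derivative F z) (at z within closed_segment (Complex R a) (Complex R b))"
      and "norm (F z) \<le> M"
      unfolding z by (auto intro: bd G has_field_derivative_at_within)
  qed auto
  moreover have "Complex R b - Complex R a = \<i> * of_real (b - a)" by (simp add: complex_eq_iff)
  ultimately show ?thesis using \<open>a \<le> b\<close> by (simp add: norm_mult del: of_real_diff)
qed

text \<open>
In the variable \<open>w = ln s\<close> a Hankel contour (in along a ray at angle \<open>-\<theta>\<close>, along a circular arc, out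
along the ray at angle \<open>\<theta>\<close>) becomes three sides of a half strip, and an integrand that is holomorphic
on a convex strip has a primitive \<open>G\<close> there. The contour integral, cut off at \<open>Re w = R\<close>, is then the
increment of \<open>G\<close> across the strip, whatever the position \<open>c\<close> of the arc. It is estimated along the
three sides by the mean value inequality, with the decay of \<open>e\<^sup>s\<close> on the horizontal sides
because \<open>cos \<theta> < 0\<close>. The constant \<open>B\<close> does not depend on the integrand, so that it is uniform
in all parameters hidden in \<open>F\<close>.
\<close>

lemma strip_primitive_increment_bound:
  fixes c \<theta> \<kappa> :: real
  assumes c: "c \<ge> 0" and \<theta>: "pi / 2 < \<theta>" "\<theta> \<le> pi"
  shows "\<exists>B>0. \<forall>K F G R. 0 \<le> K \<longrightarrow> c \<le> R \<longrightarrow>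
      (\<forall>w. \<bar>Im w\<bar> \<le> \<theta> \<longrightarrow> (G has_field_derivative F w) (at w)) \<longrightarrow>
      (\<forall>w. \<bar>Im w\<bar> \<le> \<theta> \<longrightarrow> c \<le> Re w \<longrightarrow> norm (F w) \<le> K * (norm (exp (exp w)) * exp (\<kappa> * Re w))) \<longrightarrow>
      norm (G (Complex R \<theta>) - G (Complex R (- \<theta>))) \<le> K * B"
proof -
  have cos: "cos \<theta> < 0" using \<theta> using cos_monotone_0_pi[of "pi/2" \<theta>] by auto
  obtain C where C: "C > 0" "\<And>x. x \<ge> 0 \<Longrightarrow> exp (- (- cos \<theta> * exp x)) * exp (\<kappa> * x) \<le> C * exp (- x)"
    using double_exp_decay[of "- cos \<theta>" \<kappa>] cos by auto
  define D where "D = exp (exp c) * exp (\<kappa> * c)"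
  define B where "B = 2 * C + D * (2 * \<theta>)"
  have D: "D > 0" by (simp add: D_def)
  show ?thesis
  proof (intro exI[of _ B] conjI allI impI)
    show "B > 0" using C(1) D \<theta> pi_gt_zero by (simp add: B_def add_pos_pos)
    fix K R :: real and F G :: "complex \<Rightarrow> complex"
    assume K: "K \<ge> 0" and R: "R \<ge> c"
      and "\<forall>w. \<bar>Im w\<bar> \<le> \<theta> \<longrightarrow> (G has_field_derivative F w) (at w)"
      and "\<forall>w. \<bar>Im w\<bar> \<le> \<theta> \<longrightarrow> c \<le> Re w \<longrightarrow> norm (F w) \<le> K * (norm (exp (exp w)) * exp (\<kappa> * Re w))"
    then have G: "\<And>w. \<bar>Im w\<bar> \<le> \<theta> \<Longrightarrow> (G has_field_derivative F w) (at w)"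
      and F: "\<And>w. \<bar>Im w\<bar> \<le> \<theta> \<Longrightarrow> Re w \<ge> c \<Longrightarrow> norm (F w) \<le> K * (norm (exp (exp w)) * exp (\<kappa> * Re w))"
      by blast+
    have vd: "((\<lambda>x. G (Complex x \<eta>)) has_vector_derivative F (Complex x \<eta>)) (at x)"
      if "\<eta> = \<theta> \<or> \<eta> = - \<theta>" for x \<eta>
      using G[of "Complex x \<eta>"] that \<theta> pi_gt_zero by (intro horizontal_derivative) auto
    have hor: "norm (G (Complex R \<eta>) - G (Complex c \<eta>)) \<le> K * C" if \<eta>: "\<eta> = \<theta> \<or> \<eta> = - \<theta>" for \<eta>
    proof (cases "R = c")
      case True then show ?thesis using K C by simp
    next
      case False
      then have "c < R" using R by simp
      then have "norm (G (Complex R \<eta>) - G (Complex c \<eta>)) \<le> - K * C * exp (- R) - (- K * C * exp (- c))"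
      proof (rule differentiable_bound_general[where f = "\<lambda>x. G (Complex x \<eta>)" and \<phi> = "\<lambda>x. - K * C * exp (- x)"
            and f' = "\<lambda>x. F (Complex x \<eta>)" and \<phi>' = "\<lambda>x. K * C * exp (- x)"])
        show "continuous_on {c..R} (\<lambda>x. G (Complex x \<eta>))"
          by (intro continuous_at_imp_continuous_on ballI has_vector_derivative_continuous[OF vd[OF \<eta>]])
        show "continuous_on {c..R} (\<lambda>x. - K * C * exp (- x))" by (intro continuous_intros)
        fix x assume x: "c < x" "x < R"
        show "((\<lambda>x. G (Complex x \<eta>)) has_vector_derivative F (Complex x \<eta>)) (at x)" by (rule vd[OF \<eta>])
        show "((\<lambda>x. - K * C * exp (- x)) has_vector_derivative K * C * exp (- x)) (at x)"
          by (auto intro!: derivative_eq_intros simp flip: has_real_derivative_iff_has_vector_derivative)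
        have "norm (F (Complex x \<eta>)) \<le> K * (norm (exp (exp (Complex x \<eta>))) * exp (\<kappa> * x))"
          using F[of "Complex x \<eta>"] x \<eta> \<theta> pi_gt_zero by auto
        also have "norm (exp (exp (Complex x \<eta>))) * exp (\<kappa> * x) \<le> C * exp (- x)"
          using C(2)[of x] x c \<eta> by (auto simp: Re_exp mult.commute)
        finally show "norm (F (Complex x \<eta>)) \<le> K * C * exp (- x)"
          using K by (simp add: mult_left_mono mult.assoc)
      qed
      also have "\<dots> \<le> K * C * exp (- c)" using K C by simp
      also have "\<dots> \<le> K * C" using K C c by (simp add: mult_left_le)
      finally show ?thesis .
    qed
    have ver: "norm (G (Complex c \<theta>) - G (Complex c (- \<theta>))) \<le> K * D * (\<theta> - (- \<theta>))"
    proof (rule vertical_increment_bound)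
      fix \<eta> assume \<eta>: "- \<theta> \<le> \<eta>" "\<eta> \<le> \<theta>"
      show "(G has_field_derivative F (Complex c \<eta>)) (at (Complex c \<eta>))" using \<eta> by (intro G) auto
      have "norm (F (Complex c \<eta>)) \<le> K * (norm (exp (exp (Complex c \<eta>))) * exp (\<kappa> * c))"
        using F[of "Complex c \<eta>"] \<eta> by auto
      also have "norm (exp (exp (Complex c \<eta>))) \<le> exp (exp c)"
        using mult_left_mono[of "cos \<eta>" 1 "exp c"] by (simp add: Re_exp)
      finally show "norm (F (Complex c \<eta>)) \<le> K * D" using K by (simp add: D_def mult_left_mono)
    qed (use \<theta> pi_gt_zero in auto)
    then have ver': "norm (G (Complex c \<theta>) - G (Complex c (- \<theta>))) \<le> K * D * (2 * \<theta>)" by simp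
    have "G (Complex R \<theta>) - G (Complex R (- \<theta>)) =
        (G (Complex R \<theta>) - G (Complex c \<theta>)) + (G (Complex c \<theta>) - G (Complex c (- \<theta>)))
        - (G (Complex R (- \<theta>)) - G (Complex c (- \<theta>)))" by simp
    also have "norm \<dots> \<le> norm (G (Complex R \<theta>) - G (Complex c \<theta>)) + norm (G (Complex c \<theta>) - G (Complex c (- \<theta>)))
        + norm (G (Complex R (- \<theta>)) - G (Complex c (- \<theta>)))"
      by (intro order_trans[OF norm_triangle_ineq4] add_right_mono norm_triangle_ineq)
    also have "\<dots> \<le> K * C + K * D * (2 * \<theta>) + K * C" using hor[of \<theta>] hor[of "- \<theta>"] ver' by linarith
    finally show "norm (G (Complex R \<theta>) - G (Complex R (- \<theta>))) \<le> K * B" by (simp add: B_def algebra_simps)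
  qed
qed

section \<open>Hankel's formula for the reciprocal Gamma function\<close>

text \<open>
The integrand \<open>e\<^sup>s s powr -x\<close> of Hankel's formula, in the variable \<open>w = ln s\<close> and with \<open>ds = e\<^sup>w dw\<close>.
\<close>

definition hankel_integrand :: "real \<Rightarrow> complex \<Rightarrow> complex" where
  "hankel_integrand x w = exp (exp w) * exp (of_real (1 - x) * w)"

lemma norm_hankel_integrand:
  "norm (hankel_integrand x w) = norm (exp (exp w)) * exp ((1 - x) * Re w)"
  by (simp add: hankel_integrand_def norm_mult norm_exp_eq_Re[of "_ * w"])

definition hankel_primitive :: "real \<Rightarrow> (complex \<Rightarrow> complex) \<Rightarrow> bool" where
  "hankel_primitive x G \<longleftrightarrow> (\<forall>w. (G has_field_derivative hankel_integrand x w) (at w))"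

lemma hankel_primitive_exists: obtains G where "hankel_primitive x G"
proof -
  have "hankel_integrand x holomorphic_on UNIV"
    unfolding hankel_integrand_def by (intro holomorphic_intros)
  then obtain G where "\<And>w. w \<in> UNIV \<Longrightarrow> (G has_field_derivative hankel_integrand x w) (at w within UNIV)"
    using holomorphic_convex_primitive'[of UNIV "hankel_integrand x"] by auto
  then show ?thesis using that by (auto simp: hankel_primitive_def)
qed

text \<open>
Identifies an increment across the strip that turns out to be constant by its limit where the strip
shrinks to \<open>s = 0\<close>.
\<close>

lemma eq_limit_at_bot_of_zero_derivative:
  fixes D :: "real \<Rightarrow> complex"
  assumes "\<And>u. (D has_vector_derivative 0) (at u)" and "(D \<longlongrightarrow> d) at_bot"
  shows "D u = d"
proof -
  obtain e where e: "\<And>x. D x = e"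
    using has_vector_derivative_zero_constant[of UNIV D] assms(1) by auto
  then have "D = (\<lambda>_. e)" by auto
  then have "d = e" using assms(2) tendsto_unique[OF trivial_limit_at_bot_linorder tendsto_const assms(2)[unfolded \<open>D = _\<close>]] by auto
  then show ?thesis using e by simp
qed


text \<open>
On the lines \<open>Im w = \<plusminus>\<pi>\<close>, that is on the two sides of the negative axis, \<open>e\<^sup>s\<close> is \<open>exp(-e\<^sup>u)\<close> and the power
contributes the phases \<open>exp(\<plusminus>\<i>\<pi>(1-x))\<close>. The increment is therefore \<open>2\<i> sin(\<pi>(1-x))\<close> times an incomplete
Gamma integral for \<open>\<Gamma>(1-x)\<close>, and the reflection formula applies. Negative \<open>x\<close> makes the
integrand continuous at \<open>0\<close>.
\<close>

lemma hankel_increment_neg: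
  assumes x: "x < 0" and G: "hankel_primitive x G"
  shows "((\<lambda>R. G (Complex R pi) - G (Complex R (- pi))) \<longlongrightarrow> 2 * pi * \<i> * rGamma (of_real x)) at_top"
proof -
  define g where "g t = t powr (- x) / exp t" for t :: real
  define P where "P u = integral {0..exp u} g" for u
  define s where "s = 2 * \<i> * of_real (sin (pi * (1 - x)))"
  have cont: "continuous_on {0..b} g" for b
    unfolding g_def using x by (intro continuous_intros continuous_on_powr') auto
  have P': "(P has_vector_derivative exp ((1 - x) * u) * exp (- exp u)) (at u)" for u
  proof -
    have "((\<lambda>b. integral {0..b} g) has_real_derivative g (exp u)) (at (exp u) within {0..exp u + 1})"
      by (rule integral_has_real_derivative[OF cont]) auto
    then have "((\<lambda>b. integral {0..b} g) has_real_derivative g (exp u)) (at (exp u))"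
      by (subst (asm) at_within_interior) auto
    then have "((\<lambda>u. integral {0..exp u} g) has_real_derivative g (exp u) * exp u) (at u)"
      by (rule DERIV_chain2) (auto intro!: derivative_eq_intros)
    moreover have "g (exp u) * exp u = exp ((1 - x) * u) * exp (- exp u)"
    proof -
      have "exp ((1 - x) * u) = exp (- x * u) * exp u" by (simp add: exp_add[symmetric] algebra_simps)
      then show ?thesis by (simp add: g_def powr_def exp_minus[of "exp u"] divide_inverse)
    qed
    ultimately show ?thesis
      unfolding P_def by (simp add: has_real_derivative_iff_has_vector_derivative)
  qed
  have P_bot: "(P \<longlongrightarrow> 0) at_bot"
  proof (rule Lim_null_comparison)
    show "\<forall>\<^sub>F u in at_bot. norm (P u) \<le> exp u * exp (- x * u)"
    proof (rule always_eventually, rule allI)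
      fix u :: real
      have "norm (P u) \<le> exp u powr (- x) * (exp u - 0)"
        unfolding P_def
      proof (rule integral_bound[OF _ cont])
        fix t assume t: "t \<in> {0..exp u}"
        have "t powr (- x) \<le> exp u powr (- x)" using t x by (intro powr_mono2) auto
        moreover have "g t \<le> t powr (- x)" using t mult_right_mono[of 1 "exp t" "t powr (- x)"] by (simp add: g_def field_simps)
        ultimately show "norm (g t) \<le> exp u powr (- x)" by (simp add: g_def)
      qed auto
      then show "norm (P u) \<le> exp u * exp (- x * u)" by (simp add: powr_def mult.commute)
    qed
    have "((\<lambda>u::real. exp ((1 - x) * u)) \<longlongrightarrow> 0) at_bot"
      using x by real_asymp
    then show "((\<lambda>u. exp u * exp (- x * u)) \<longlongrightarrow> 0) at_bot"
      by (simp add: exp_add[symmetric] algebra_simps)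
  qed
  have P_top: "(P \<longlongrightarrow> Gamma (1 - x)) at_top"
  proof -
    have 1: "(g has_integral Gamma (1 - x)) {0..}"
      using Gamma_integral_real[of "1 - x"] x by (simp add: g_def[abs_def])
    have "((\<lambda>b. integral {0..b} g) \<longlongrightarrow> Gamma (1 - x)) at_top"
    proof (rule tendsto_at_topI_sequentially)
      fix X :: "nat \<Rightarrow> real" assume X: "filterlim X at_top sequentially"
      have "(\<lambda>k. integral {0..} (\<lambda>t. if t \<in> {0..X k} then g t else 0)) \<longlonglongrightarrow> integral {0..} g"
      proof (rule dominated_convergence[where h = g])
        show "(\<lambda>t. if t \<in> {0..X k} then g t else 0) integrable_on {0..}" for k
          using integrable_continuous_interval[OF cont[of "X k"]]
          by (subst integrable_restrict_Int) (auto simp: Int_absorb2)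
        show "g integrable_on {0..}" using 1 by blast
        show "norm (if t \<in> {0..X k} then g t else 0) \<le> g t" for k t by (auto simp: g_def)
        show "(\<lambda>k. if t \<in> {0..X k} then g t else 0) \<longlonglongrightarrow> g t" if "t \<in> {0..}" for t
        proof (rule tendsto_eventually)
          have "\<forall>\<^sub>F k in sequentially. X k \<ge> t" using X by (simp add: filterlim_at_top)
          then show "\<forall>\<^sub>F k in sequentially. (if t \<in> {0..X k} then g t else 0) = g t"
            by eventually_elim (use that in auto)
        qed
      qed
      moreover have "integral {0..} (\<lambda>t. if t \<in> {0..X k} then g t else 0) = integral {0..X k} g" for k
        by (subst integral_restrict_Int) (auto simp: Int_absorb2)
      ultimately show "(\<lambda>k. integral {0..X k} g) \<longlonglongrightarrow> Gamma (1 - x)"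
        using integral_unique[OF 1] by simp
    qed
    then show ?thesis unfolding P_def
      by (rule filterlim_compose) (rule exp_at_top)
  qed
  define D where "D u = G (Complex u pi) - G (Complex u (- pi)) - s * of_real (P u)" for u
  have G': "(G has_field_derivative hankel_integrand x w) (at w)" for w
    using G by (simp add: hankel_primitive_def)
  have D': "(D has_vector_derivative 0) (at u)" for u
  proof -
    have e: "hankel_integrand x (Complex u pi) - hankel_integrand x (Complex u (- pi))
        = s * of_real (exp ((1 - x) * u) * exp (- exp u))"
    proof -
      have 1: "exp (Complex u pi) = of_real (- exp u)" "exp (Complex u (- pi)) = of_real (- exp u)"
        by (simp_all add: complex_eq_iff Re_exp Im_exp)
      have 2: "exp (of_real (1 - x) * Complex u pi) - exp (of_real (1 - x) * Complex u (- pi))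
         = s * of_real (exp ((1 - x) * u))"
        by (simp add: complex_eq_iff Re_exp Im_exp s_def right_diff_distrib left_diff_distrib cos_diff sin_diff mult.commute)
      have "hankel_integrand x (Complex u pi) - hankel_integrand x (Complex u (- pi))
        = exp (of_real (- exp u)) * (exp (of_real (1 - x) * Complex u pi) - exp (of_real (1 - x) * Complex u (- pi)))"
        by (simp only: hankel_integrand_def 1 right_diff_distrib)
      also have "\<dots> = s * of_real (exp ((1 - x) * u) * exp (- exp u))"
        unfolding 2 by (simp only: exp_of_real of_real_mult mult_ac)
      finally show ?thesis .
    qed
    have "(D has_vector_derivative (hankel_integrand x (Complex u pi) - hankel_integrand x (Complex u (- pi))
        - s * of_real (exp ((1 - x) * u) * exp (- exp u)))) (at u)"
      unfolding D_def
      by (intro has_vector_derivative_diff horizontal_derivative G' has_vector_derivative_mult_right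
          has_vector_derivative_of_real P'[unfolded has_real_derivative_iff_has_vector_derivative[symmetric]])
    then show ?thesis unfolding e by simp
  qed
  have "((\<lambda>u. G (Complex u pi) - G (Complex u (- pi))) \<longlongrightarrow> 0) at_bot"
  proof (rule Lim_null_comparison)
    show "\<forall>\<^sub>F u in at_bot. norm (G (Complex u pi) - G (Complex u (- pi)))
      \<le> exp (exp u) * exp ((1 - x) * u) * (pi - (- pi))"
    proof (rule always_eventually, rule allI, rule vertical_increment_bound[OF _ G'])
      fix u \<eta> :: real
      have "exp u * cos \<eta> \<le> exp u" by simp
      then show "norm (hankel_integrand x (Complex u \<eta>)) \<le> exp (exp u) * exp ((1 - x) * u)"
        by (simp add: norm_hankel_integrand Re_exp)
    qed (use pi_gt_zero in auto)
    show "((\<lambda>u. exp (exp u) * exp ((1 - x) * u) * (pi - (- pi))) \<longlongrightarrow> 0) at_bot"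
    proof -
      have "((\<lambda>u::real. exp ((1 - x) * u)) \<longlongrightarrow> 0) at_bot"
        using x by real_asymp
      then have "((\<lambda>u. exp (exp u) * exp ((1 - x) * u) * (pi - (- pi))) \<longlongrightarrow> exp 0 * 0 * (pi - (- pi))) at_bot"
        by (intro tendsto_mult tendsto_const tendsto_exp exp_at_bot)
      then show ?thesis by simp
    qed
  qed
  then have "(D \<longlongrightarrow> 0 - s * of_real 0) at_bot"
    unfolding D_def by (intro tendsto_intros P_bot)
  then have "D u = 0" for u
    using eq_limit_at_bot_of_zero_derivative[OF D'] by simp
  then have eq: "G (Complex u pi) - G (Complex u (- pi)) = s * of_real (P u)" for u
    by (simp add: D_def)
  have "Gamma (1 - x) > 0" using x by (intro Gamma_real_pos) auto
  then have nz: "Gamma (1 - x) \<noteq> 0" by simp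
  have "rGamma (complex_of_real x) * rGamma (complex_of_real (1 - x)) = of_real (sin (pi * x) / pi)"
  proof -
    have "sin (of_real pi * of_real x) = complex_of_real (sin (pi * x))" by (simp flip: sin_of_real)
    then show ?thesis using rGamma_reflection_complex[of "of_real x"] by simp
  qed
  then have "rGamma x * rGamma (1 - x) = sin (pi * x) / pi"
    by (simp only: rGamma_complex_of_real flip: of_real_mult) (simp only: of_real_eq_iff)
  moreover have inv1: "rGamma (1 - x) * Gamma (1 - x) = 1" using nz by (simp add: rGamma_inverse_Gamma)
  ultimately have "rGamma x * rGamma (1 - x) * Gamma (1 - x) = sin (pi * x) / pi * Gamma (1 - x)"
    by simp
  then have "rGamma x = sin (pi * x) / pi * Gamma (1 - x)"
    using inv1 by (simp only: mult.assoc mult_1_right)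
  moreover have "sin (pi * (1 - x)) = sin (pi * x)" by (simp add: algebra_simps sin_diff)
  ultimately have "s * of_real (Gamma (1 - x)) = 2 * pi * \<i> * rGamma (of_real x)"
    by (simp add: s_def rGamma_complex_of_real)
  moreover have "((\<lambda>u. s * of_real (P u)) \<longlongrightarrow> s * of_real (Gamma (1 - x))) at_top"
    by (intro tendsto_intros P_top)
  ultimately show ?thesis by (simp add: eq)
qed

text \<open>
The exceptional value: the recursion of \<open>hankel_increment_shift\<close> carries no information from \<open>x = 0\<close>
to \<open>x = 1\<close>, where the reciprocal Gamma function vanishes and the factor is \<open>0\<close>. Here the phases on
the two lines coincide, so the increment is constant, and near \<open>s = 0\<close> the integrand tends to \<open>1\<close>.
\<close>

lemma hankel_increment_one:
  assumes G: "hankel_primitive 1 G"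
  shows "G (Complex u pi) - G (Complex u (- pi)) = 2 * pi * \<i>"
proof -
  have G': "(G has_field_derivative exp (exp w)) (at w)" for w
    using G by (simp add: hankel_primitive_def hankel_integrand_def)
  show ?thesis
  proof (rule eq_limit_at_bot_of_zero_derivative[where D = "\<lambda>u. G (Complex u pi) - G (Complex u (- pi))"])
    fix u
    have "exp (Complex u pi) = exp (Complex u (- pi))" by (simp add: complex_eq_iff Re_exp Im_exp)
    then show "((\<lambda>u. G (Complex u pi) - G (Complex u (- pi))) has_vector_derivative 0) (at u)"
      using has_vector_derivative_diff[OF horizontal_derivative[OF G'[of "Complex u pi"]]
          horizontal_derivative[OF G'[of "Complex u (- pi)"]]] by simp
  next
    define H where "H w = G w - w" for w
    have H': "(H has_field_derivative exp (exp w) - 1) (at w)" for w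
      unfolding H_def by (auto intro!: derivative_eq_intros G')
    have "((\<lambda>u. H (Complex u pi) - H (Complex u (- pi))) \<longlongrightarrow> 0) at_bot"
    proof (rule Lim_null_comparison)
      show "\<forall>\<^sub>F u in at_bot. norm (H (Complex u pi) - H (Complex u (- pi)))
        \<le> exp u * exp (exp u) * (pi - (- pi))"
      proof (rule always_eventually, rule allI, rule vertical_increment_bound[OF _ H'])
        fix u \<eta> :: real
        show "norm (exp (exp (Complex u \<eta>)) - 1) \<le> exp u * exp (exp u)"
        proof -
          define z where "z = exp (Complex u \<eta>)"
          have nz: "norm z = exp u" by (simp add: z_def)
          have "norm (exp z - exp 0) \<le> exp (norm z) * norm (z - 0)"
          proof (rule field_differentiable_bound[where S = "cball 0 (norm z)"])
            fix y :: complex assume "y \<in> cball 0 (norm z)"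
            then have "Re y \<le> norm z" using complex_Re_le_cmod[of y] by (simp add: order_trans)
            then show "norm (exp y) \<le> exp (norm z)" by simp
          qed (auto intro: DERIV_subset[OF DERIV_exp])
          then show ?thesis by (simp add: nz mult.commute flip: z_def)
        qed
      qed (use pi_gt_zero in auto)
      show "((\<lambda>u::real. exp u * exp (exp u) * (pi - (- pi))) \<longlongrightarrow> 0) at_bot"
        by real_asymp
    qed
    then have "((\<lambda>u. H (Complex u pi) - H (Complex u (- pi)) + 2 * pi * \<i>) \<longlongrightarrow> 0 + 2 * pi * \<i>) at_bot"
      by (intro tendsto_intros)
    moreover have "H (Complex u pi) - H (Complex u (- pi)) + 2 * pi * \<i> = G (Complex u pi) - G (Complex u (- pi))" for u
      by (simp add: H_def complex_eq_iff)
    ultimately show "((\<lambda>u. G (Complex u pi) - G (Complex u (- pi))) \<longlongrightarrow> 2 * pi * \<i>) at_bot" by simp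
  qed
qed

text \<open>
Partial integration: the derivative of the integrand with exponent \<open>x + 1\<close> is the integrand with
exponent \<open>x\<close> minus \<open>x\<close> times itself, and its boundary values vanish in the limit. This reproduces the
functional equation of the Gamma function.
\<close>

lemma hankel_increment_shift:
  assumes x: "x \<noteq> 0" and G: "hankel_primitive (x + 1) G"
    and IH: "\<And>G. hankel_primitive x G \<Longrightarrow>
      ((\<lambda>R. G (Complex R pi) - G (Complex R (- pi))) \<longlongrightarrow> 2 * pi * \<i> * rGamma (of_real x)) at_top"
  shows "((\<lambda>R. G (Complex R pi) - G (Complex R (- pi))) \<longlongrightarrow> 2 * pi * \<i> * rGamma (of_real (x + 1))) at_top"
proof -
  define P where "P = hankel_integrand (x + 1)"
  have "hankel_primitive x (\<lambda>w. P w + of_real x * G w)"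
    unfolding hankel_primitive_def
  proof
    fix w
    have "(P has_field_derivative hankel_integrand x w - of_real x * P w) (at w)"
    proof -
      define E where "E = exp (of_real (- x) * w)"
      have "exp (of_real (1 - x) * w) = exp w * E"
        by (simp add: E_def exp_add[symmetric] algebra_simps)
      then have "hankel_integrand x w - of_real x * P w
          = exp w * exp (exp w) * E + of_real (- x) * E * exp (exp w)"
        by (simp add: hankel_integrand_def P_def E_def)
      moreover have "((\<lambda>w. exp (exp w) * exp (of_real (- x) * w)) has_field_derivative
          exp w * exp (exp w) * E + of_real (- x) * E * exp (exp w)) (at w)"
        unfolding E_def by (rule derivative_eq_intros refl | simp)+
      ultimately show ?thesis by (simp add: P_def hankel_integrand_def[abs_def])
    qed
    moreover have "(G has_field_derivative P w) (at w)" using G by (simp add: hankel_primitive_def P_def)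
    ultimately show "((\<lambda>w. P w + of_real x * G w) has_field_derivative hankel_integrand x w) (at w)"
      by (auto intro!: derivative_eq_intros)
  qed
  note 1 = IH[OF this]
  have 2: "((\<lambda>R. P (Complex R \<eta>)) \<longlongrightarrow> 0) at_top" if "\<eta> = pi \<or> \<eta> = - pi" for \<eta>
  proof (rule tendsto_norm_zero_cancel)
    have "norm (P (Complex R \<eta>)) = exp (- exp R) * exp (- x * R)" for R
      using that by (auto simp: P_def norm_hankel_integrand Re_exp)
    moreover have "((\<lambda>R. exp (- exp R) * exp (- x * R)) \<longlongrightarrow> 0) at_top" by real_asymp
    ultimately show "((\<lambda>R. norm (P (Complex R \<eta>))) \<longlongrightarrow> 0) at_top" by simp
  qed
  have eq: "((P (Complex R pi) + of_real x * G (Complex R pi) - (P (Complex R (- pi)) + of_real x * G (Complex R (- pi))))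
      - (P (Complex R pi) - P (Complex R (- pi)))) / of_real x = G (Complex R pi) - G (Complex R (- pi))" for R
    using x by (simp add: field_simps)
  have "((\<lambda>R. ((P (Complex R pi) + of_real x * G (Complex R pi) - (P (Complex R (- pi)) + of_real x * G (Complex R (- pi))))
      - (P (Complex R pi) - P (Complex R (- pi)))) / of_real x) \<longlongrightarrow> (2 * pi * \<i> * rGamma (of_real x) - (0 - 0)) / of_real x) at_top"
    using x by (intro tendsto_intros 1 2) auto
  moreover have "rGamma (complex_of_real x) / of_real x = rGamma (of_real (x + 1))"
    using rGamma_plus1[of "complex_of_real x"] x by (simp add: field_simps)
  ultimately show ?thesis unfolding eq by (simp flip: times_divide_eq_right)
qed

lemma hankel_increment_pi:
  assumes "hankel_primitive x G"
  shows "((\<lambda>R. G (Complex R pi) - G (Complex R (- pi))) \<longlongrightarrow> 2 * pi * \<i> * rGamma (of_real x)) at_top"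
proof -
  have "\<forall>x G. x < real n \<longrightarrow> hankel_primitive x G \<longrightarrow>
    ((\<lambda>R. G (Complex R pi) - G (Complex R (- pi))) \<longlongrightarrow> 2 * pi * \<i> * rGamma (of_real x)) at_top" for n
  proof (induction n)
    case 0 then show ?case using hankel_increment_neg by auto
  next
    case (Suc n)
    show ?case
    proof (intro allI impI)
      fix x G assume x: "x < real (Suc n)" and G: "hankel_primitive x G"
      show "((\<lambda>R. G (Complex R pi) - G (Complex R (- pi))) \<longlongrightarrow> 2 * pi * \<i> * rGamma (of_real x)) at_top"
      proof (cases "x = 1")
        case True
        then show ?thesis using hankel_increment_one[of G] G by simp
      next
        case False
        then show ?thesis using hankel_increment_shift[of "x - 1" G] Suc[rule_format, of "x - 1"] x G by (simp add: algebra_simps)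
      qed
    qed
  qed
  moreover obtain n where "x < real n" using reals_Archimedean2 by blast
  ultimately show ?thesis using assms by blast
qed

text \<open>
Hankel's formula \<open>1/\<Gamma>(x) = (1/2\<pi>\<i>) \<integral> e\<^sup>s s powr -x ds\<close> on any contour whose rays lie in the open left half
plane; turning the rays from the negative axis to the angle \<open>\<theta>\<close> changes the increment by a quantity
that decays doubly exponentially.
\<close>

theorem hankel_increment:
  assumes \<theta>: "pi / 2 < \<theta>" "\<theta> \<le> pi" and G: "hankel_primitive x G"
  shows "((\<lambda>R. G (Complex R \<theta>) - G (Complex R (- \<theta>))) \<longlongrightarrow> 2 * pi * \<i> * rGamma (of_real x)) at_top"
proof -
  have cos: "cos \<theta> < 0" using cos_monotone_0_pi[of "pi/2" \<theta>] \<theta> by auto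
  have G': "(G has_field_derivative hankel_integrand x w) (at w)" for w
    using G by (simp add: hankel_primitive_def)
  have lim: "((\<lambda>R. exp (exp R * cos \<theta>) * exp ((1 - x) * R) * (pi - \<theta>)) \<longlongrightarrow> 0) at_top"
    using cos by real_asymp
  have bd: "norm (hankel_integrand x (Complex R \<eta>)) \<le> exp (exp R * cos \<theta>) * exp ((1 - x) * R)"
    if "\<theta> \<le> \<bar>\<eta>\<bar>" "\<bar>\<eta>\<bar> \<le> pi" for R \<eta>
  proof -
    have "cos \<bar>\<eta>\<bar> \<le> cos \<theta>" using that \<theta> pi_gt_zero by (intro cos_monotone_0_pi_le) auto
    then have "exp R * cos \<eta> \<le> exp R * cos \<theta>" by simp
    then show ?thesis by (simp add: norm_hankel_integrand Re_exp)
  qed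
  have 1: "((\<lambda>R. G (Complex R pi) - G (Complex R \<theta>)) \<longlongrightarrow> 0) at_top"
    by (rule Lim_null_comparison[OF always_eventually lim], rule allI, rule vertical_increment_bound[OF _ G'])
      (use \<theta> pi_gt_zero in \<open>auto intro!: bd\<close>)
  have 2: "((\<lambda>R. G (Complex R (- \<theta>)) - G (Complex R (- pi))) \<longlongrightarrow> 0) at_top"
  proof (rule Lim_null_comparison[OF always_eventually lim], rule allI)
    fix R
    have "norm (G (Complex R (- \<theta>)) - G (Complex R (- pi)))
      \<le> exp (exp R * cos \<theta>) * exp ((1 - x) * R) * (- \<theta> - (- pi))"
      by (rule vertical_increment_bound[OF _ G']) (use \<theta> pi_gt_zero in \<open>auto intro!: bd\<close>)
    then show "norm (G (Complex R (- \<theta>)) - G (Complex R (- pi)))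
      \<le> exp (exp R * cos \<theta>) * exp ((1 - x) * R) * (pi - \<theta>)" by simp
  qed
  have "((\<lambda>R. (G (Complex R pi) - G (Complex R (- pi))) - (G (Complex R pi) - G (Complex R \<theta>))
     - (G (Complex R (- \<theta>)) - G (Complex R (- pi)))) \<longlongrightarrow> 2 * pi * \<i> * rGamma (of_real x) - 0 - 0) at_top"
    by (intro tendsto_diff hankel_increment_pi[OF G] 1 2)
  then show ?thesis by simp
qed

section \<open>Decay of Mittag-Leffler functions on the negative axis\<close>

text \<open>
Keep only the part of Euler's integral over \<open>t \<ge> M\<close>. The freedom in \<open>M\<close> shows that \<open>\<Gamma>\<close> grows faster
than every exponential, hence that the Mittag-Leffler series converges everywhere.
\<close>

lemma Gamma_lower_bound:
  fixes x M :: real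
  assumes "x \<ge> 1" "M > 0"
  shows "M powr (x - 1) * exp (- M) \<le> Gamma x"
proof (rule has_integral_le)
  have "((\<lambda>t. exp (- 1 * t)) has_integral exp (- 1 * M) / 1) {M..}"
    by (rule has_integral_exp_minus_to_infinity) auto
  then have "((\<lambda>t. M powr (x - 1) * exp (- t)) has_integral M powr (x - 1) * exp (- M)) {M..}"
    by (intro has_integral_mult_right) simp
  then show "((\<lambda>t. if t \<in> {M..} then M powr (x - 1) * exp (- t) else 0) has_integral M powr (x - 1) * exp (- M)) {0..}"
    using assms by (subst has_integral_restrict) auto
  show "((\<lambda>t. t powr (x - 1) / exp t) has_integral Gamma x) {0..}"
    using assms by (intro Gamma_integral_real) auto
  show "(if t \<in> {M..} then M powr (x - 1) * exp (- t) else 0) \<le> t powr (x - 1) / exp t" if "t \<in> {0..}" for t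
    using that assms by (auto simp: exp_minus divide_inverse intro!: powr_mono2 mult_right_mono)
qed

lemma mittag_leffler_coeff_summable:
  fixes \<alpha> \<nu> y :: real
  assumes "\<alpha> > 0"
  shows "summable (\<lambda>k. \<bar>rGamma (\<alpha> * real k + \<nu>)\<bar> * \<bar>y\<bar> ^ k)"
proof -
  \<comment> \<open>chosen such that consecutive terms shrink by the factor \<open>\<bar>y\<bar> / M powr \<alpha> \<le> 1/2\<close>\<close>
  define M where "M = (2 * \<bar>y\<bar> + 1) powr (1 / \<alpha>)"
  have M: "M > 0" "M powr \<alpha> = 2 * \<bar>y\<bar> + 1" using assms by (auto simp: M_def powr_powr)
  obtain k0 :: nat where k0: "(1 - \<nu>) / \<alpha> \<le> real k0" using real_arch_simple by blast
  have ge1: "\<alpha> * real k + \<nu> \<ge> 1" if "k \<ge> k0" for k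
  proof -
    have "(1 - \<nu>) / \<alpha> \<le> real k" using k0 that by linarith
    then show ?thesis using assms by (simp add: field_simps)
  qed
  show ?thesis
  proof (rule summable_comparison_test')
    show "summable (\<lambda>k. exp M * M powr (1 - \<nu>) * (1 / 2) ^ k)"
      by (intro summable_mult summable_geometric) auto
    fix k assume k: "k \<ge> k0"
    define x where "x = \<alpha> * real k + \<nu>"
    have x: "x \<ge> 1" using ge1[OF k] by (simp add: x_def)
    have G: "Gamma x > 0" using x by (intro Gamma_real_pos) auto
    have "rGamma x \<le> exp M * M powr (1 - x)"
      using Gamma_lower_bound[OF x M(1)] G M(1)
      by (simp add: rGamma_inverse_Gamma exp_minus powr_diff field_simps)
    also have "M powr (1 - x) = M powr (1 - \<nu>) * (1 / (M powr \<alpha>)) ^ k"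
      using M(1) by (simp add: x_def powr_diff powr_add powr_power power_one_over field_simps)
    finally have "\<bar>rGamma x\<bar> * \<bar>y\<bar> ^ k \<le> exp M * (M powr (1 - \<nu>) * (1 / (2 * \<bar>y\<bar> + 1)) ^ k) * \<bar>y\<bar> ^ k"
      using G by (intro mult_right_mono) (auto simp: rGamma_inverse_Gamma M(2))
    also have "\<dots> = exp M * M powr (1 - \<nu>) * (\<bar>y\<bar> / (2 * \<bar>y\<bar> + 1)) ^ k"
      by (simp add: power_divide)
    also have "\<dots> \<le> exp M * M powr (1 - \<nu>) * (1 / 2) ^ k"
      by (intro mult_left_mono power_mono) (auto simp: divide_simps)
    finally show "norm (\<bar>rGamma (\<alpha> * real k + \<nu>)\<bar> * \<bar>y\<bar> ^ k) \<le> exp M * M powr (1 - \<nu>) * (1 / 2) ^ k"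
      by (simp add: x_def abs_mult)
  qed
qed

lemma mittag_leffler_sums:
  assumes "\<alpha> > 0"
  shows "(\<lambda>k. rGamma (\<alpha> * real k + \<nu>) * y ^ k) sums mittag_leffler \<alpha> \<nu> y"
proof -
  have "summable (\<lambda>k. rGamma (\<alpha> * real k + \<nu>) * y ^ k)"
    by (rule summable_rabs_cancel)
      (use mittag_leffler_coeff_summable[OF assms, of \<nu> y] in \<open>simp add: abs_mult power_abs\<close>)
  then show ?thesis
    by (simp add: mittag_leffler_def rGamma_inverse_Gamma divide_inverse mult.commute summable_sums)
qed

text \<open>
The norm decreases when \<open>\<bar>\<psi>\<bar>\<close> grows to \<open>\<psi>0\<close>, and there the difference of the squares is
\<open>(1 - cos \<psi>0) (\<rho> - y)\<^sup>2 / 2\<close>.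
\<close>

lemma sector_distance_bound:
  fixes \<rho> y \<psi> \<psi>0 :: real
  assumes "\<rho> \<ge> 0" "y \<ge> 0" "\<bar>\<psi>\<bar> \<le> \<psi>0" "\<psi>0 \<le> pi"
  shows "cos (\<psi>0 / 2) * (\<rho> + y) \<le> norm (of_real \<rho> * cis \<psi> + of_real y)"
proof (rule power2_le_imp_le)
  have c: "cos \<psi>0 \<le> cos \<psi>" using assms cos_monotone_0_pi_le[of "\<bar>\<psi>\<bar>" \<psi>0] by simp
  have "(norm (of_real \<rho> * cis \<psi> + of_real y))\<^sup>2 = (\<rho> * cos \<psi> + y)\<^sup>2 + (\<rho> * sin \<psi>)\<^sup>2"
    by (simp add: cmod_power2)
  also have "\<dots> = \<rho>\<^sup>2 * ((cos \<psi>)\<^sup>2 + (sin \<psi>)\<^sup>2) + y\<^sup>2 + 2 * \<rho> * y * cos \<psi>"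
    by algebra
  also have "\<dots> = \<rho>\<^sup>2 + y\<^sup>2 + 2 * \<rho> * y * cos \<psi>" by simp
  also have "\<dots> \<ge> \<rho>\<^sup>2 + y\<^sup>2 + 2 * \<rho> * y * cos \<psi>0"
    using c assms by (simp add: mult_left_mono)
  finally have 1: "\<rho>\<^sup>2 + y\<^sup>2 + 2 * \<rho> * y * cos \<psi>0 \<le> (norm (of_real \<rho> * cis \<psi> + of_real y))\<^sup>2" .
  have "cos \<psi>0 = 2 * (cos (\<psi>0 / 2))\<^sup>2 - 1" using cos_double_cos[of "\<psi>0 / 2"] by simp
  then have 2: "(cos (\<psi>0 / 2))\<^sup>2 = (1 + cos \<psi>0) / 2" by simp
  have "\<rho>\<^sup>2 + y\<^sup>2 + 2 * \<rho> * y * cos \<psi>0 - (cos (\<psi>0 / 2) * (\<rho> + y))\<^sup>2 = (1 - cos \<psi>0) / 2 * (\<rho> - y)\<^sup>2"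
    unfolding power_mult_distrib 2 by (simp add: power2_eq_square field_simps)
  also have "\<dots> \<ge> 0" by simp
  finally show "(cos (\<psi>0 / 2) * (\<rho> + y))\<^sup>2 \<le> (norm (of_real \<rho> * cis \<psi> + of_real y))\<^sup>2"
    using 1 by simp
qed simp

lemma geometric_remainder:
  fixes q :: complex
  assumes "1 + q \<noteq> 0"
  shows "1 / (1 + q) - (\<Sum>k<K. (- q) ^ k) = (- q) ^ K / (1 + q)"
proof -
  have "(1 + q) * (\<Sum>k<K. (- q) ^ k) = 1 - (- q) ^ K"
    using one_diff_power_eq[of "- q" K] by simp
  then show ?thesis using assms by (simp add: field_simps)
qed

text \<open>
Inserting Hankel's formula into the series and summing the geometric series under the integral
represents \<open>E\<^sub>\<alpha>\<^sub>,\<^sub>\<nu>(-y)\<close> by the contour integral of \<open>e\<^sup>s s powr (\<alpha>-\<nu>) / (s\<^sup>\<alpha> + y)\<close>, first on a contour so far out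
that the series converges. The poles lie at the angles \<open>\<plusminus>\<pi>/\<alpha>\<close>, and \<open>\<pi>/2 < \<pi>/\<alpha>\<close> because \<open>\<alpha> < 2\<close>. So
there is room for rays at an angle \<open>\<theta>\<close> in between, with no pole to their right, and the arc can be
pulled in to radius \<open>1\<close>, where \<open>s\<^sup>\<alpha>\<close> stays in a sector and \<open>\<bar>s\<^sup>\<alpha> + y\<bar> \<ge> c (1 + y)\<close>. In terms of
primitives the same increment is bounded with \<open>c = 0\<close> (for the decay) and compared with the partial
sums with \<open>c\<close> large (for the representation).
\<close>

theorem mittag_leffler_bound:
  fixes \<alpha> \<nu> :: real
  assumes \<alpha>: "1 < \<alpha>" "\<alpha> < 2"
  obtains C where "C > 0" "\<And>y. y \<ge> 0 \<Longrightarrow> \<bar>mittag_leffler \<alpha> \<nu> (- y)\<bar> \<le> C / (1 + y)"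
proof -
  \<comment> \<open>any angle strictly between \<open>\<pi>/2\<close> and the argument of the poles would do\<close>
  define \<theta> where "\<theta> = (pi / 2 + pi / \<alpha>) / 2"
  have 1: "pi / 2 < pi / \<alpha>" and 2: "pi / \<alpha> < pi" using \<alpha> by (auto simp: divide_simps)
  have "2 * \<theta> = pi / 2 + pi / \<alpha>" by (simp add: \<theta>_def)
  then have \<theta>: "pi / 2 < \<theta>" "\<theta> < pi / \<alpha>" "\<theta> \<le> pi" "\<theta> > 0" "pi / \<alpha> < pi"
    using 1 2 pi_gt_zero by linarith+
  have \<alpha>\<theta>: "\<alpha> * \<theta> < pi" using \<theta>(2) \<alpha> by (simp add: field_simps)
  define S where "S = {w. \<bar>Im w\<bar> < pi / \<alpha>}"
  have S: "open S" "convex S"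
  proof -
    have S_eq: "S = {w. Im w < pi / \<alpha>} \<inter> {w. Im w > - (pi / \<alpha>)}" by (auto simp: S_def)
    show "open S" unfolding S_eq by (intro open_Int open_halfspace_Im_lt open_halfspace_Im_gt)
    show "convex S" unfolding S_eq by (intro convex_Int convex_halfspace_Im_lt convex_halfspace_Im_gt)
  qed
  define c0 where "c0 = cos (\<alpha> * \<theta> / 2)"
  have c0: "c0 > 0" unfolding c0_def using \<alpha>\<theta> \<theta> \<alpha> by (intro cos_gt_zero_pi) (auto intro: less_trans[of _ 0])
  have exp_polar: "exp (of_real \<alpha> * w) = of_real (exp (\<alpha> * Re w)) * cis (\<alpha> * Im w)" for w
    by (simp add: complex_eq_iff Re_exp Im_exp)
  have den_bound: "c0 * (exp (\<alpha> * Re w) + y) \<le> norm (exp (of_real \<alpha> * w) + of_real y)"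
    if "y \<ge> 0" "\<bar>Im w\<bar> \<le> \<theta>" for w y
    unfolding exp_polar c0_def
    by (rule sector_distance_bound) (use that \<alpha> \<alpha>\<theta> in \<open>auto simp: abs_mult\<close>)
  have den_nz: "exp (of_real \<alpha> * w) + of_real y \<noteq> 0" if "y \<ge> 0" "w \<in> S" for w y
  proof -
    define \<psi>0 where "\<psi>0 = \<bar>\<alpha> * Im w\<bar>"
    have "\<psi>0 < pi" using that \<alpha> by (simp add: S_def \<psi>0_def abs_mult field_simps)
    then have "cos (\<psi>0 / 2) * (exp (\<alpha> * Re w) + y) > 0"
      using that by (intro mult_pos_pos cos_gt_zero_pi add_pos_nonneg) (auto simp: \<psi>0_def intro: less_le_trans[of _ 0])
    moreover have "cos (\<psi>0 / 2) * (exp (\<alpha> * Re w) + y) \<le> norm (of_real (exp (\<alpha> * Re w)) * cis (\<alpha> * Im w) + of_real y)"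
      by (rule sector_distance_bound) (use that \<open>\<psi>0 < pi\<close> in \<open>auto simp: \<psi>0_def\<close>)
    ultimately show ?thesis unfolding exp_polar by auto
  qed
  obtain B where B: "B > 0" "\<forall>K F G R. 0 \<le> K \<longrightarrow> 0 \<le> R \<longrightarrow>
      (\<forall>w. \<bar>Im w\<bar> \<le> \<theta> \<longrightarrow> (G has_field_derivative F w) (at w)) \<longrightarrow>
      (\<forall>w. \<bar>Im w\<bar> \<le> \<theta> \<longrightarrow> 0 \<le> Re w \<longrightarrow> norm (F w) \<le> K * (norm (exp (exp w)) * exp ((1 - \<nu> + \<alpha>) * Re w))) \<longrightarrow>
      norm (G (Complex R \<theta>) - G (Complex R (- \<theta>))) \<le> K * B"
      using strip_primitive_increment_bound[OF order_refl \<theta>(1,3), of "(1 - \<nu> + \<alpha>)"] by (elim exE conjE) (rule that)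
  show ?thesis
  proof
    show "B / c0 / (2 * pi) > 0" using B c0 by simp
    fix y :: real assume y: "y \<ge> 0"
    define F where "F w = hankel_integrand \<nu> w * (exp (of_real \<alpha> * w) / (exp (of_real \<alpha> * w) + of_real y))" for w
    have "F holomorphic_on S"
      unfolding F_def hankel_integrand_def using den_nz[OF y] by (intro holomorphic_intros) auto
    then obtain G where G0: "\<And>w. w \<in> S \<Longrightarrow> (G has_field_derivative F w) (at w within S)"
      using holomorphic_convex_primitive'[OF S(2,1)] by blast
    have G: "(G has_field_derivative F w) (at w)" if "\<bar>Im w\<bar> \<le> \<theta>" for w
    proof -
      have "w \<in> S" using that \<theta> by (simp add: S_def)
      then show ?thesis using G0[of w] at_within_open[of w S] S(1) by simp
    qed
    define \<Delta> where "\<Delta> H R = H (Complex R \<theta>) - H (Complex R (- \<theta>))" for H :: "complex \<Rightarrow> complex" and R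
    have bound: "norm (\<Delta> G R) \<le> 1 / (c0 * (1 + y)) * B" if "R \<ge> 0" for R
      unfolding \<Delta>_def
    proof (rule B(2)[rule_format, OF _ that G])
      fix w assume w: "\<bar>Im w\<bar> \<le> \<theta>" "Re w \<ge> 0"
      have "c0 * (1 + y) \<le> c0 * (exp (\<alpha> * Re w) + y)"
        using c0 w \<alpha> by (intro mult_left_mono) auto
      also note den_bound[OF y w(1)]
      finally have "norm (exp (of_real \<alpha> * w) / (exp (of_real \<alpha> * w) + of_real y)) \<le> exp (\<alpha> * Re w) / (c0 * (1 + y))"
        using c0 y by (simp add: norm_divide norm_exp_eq_Re[of "_ * w"] frac_le)
      then have F_le: "norm (F w) \<le> norm (hankel_integrand \<nu> w) * (exp (\<alpha> * Re w) / (c0 * (1 + y)))"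
        unfolding F_def norm_mult by (rule mult_left_mono) simp
      show "norm (F w) \<le> 1 / (c0 * (1 + y)) * (norm (exp (exp w)) * exp ((1 - \<nu> + \<alpha>) * Re w))"
      proof -
        have e: "exp ((1 - \<nu> + \<alpha>) * Re w) = exp ((1 - \<nu>) * Re w) * exp (\<alpha> * Re w)"
          by (simp add: exp_add[symmetric] algebra_simps)
        show ?thesis using F_le unfolding norm_hankel_integrand e by (simp add: mult_ac)
      qed
    qed (use c0 y in auto)
    \<comment> \<open>to the right of \<open>c\<close> the ratio of the geometric series is at most \<open>1/2\<close>\<close>
    define c where "c = max 0 (ln (2 * y + 1) / \<alpha>)"
    have c: "c \<ge> 0" "exp (- (\<alpha> * c)) * y \<le> 1 / 2"
    proof -
      have "exp (\<alpha> * c) \<ge> exp (ln (2 * y + 1))"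
        using \<alpha> by (auto simp: c_def max_def field_simps split: if_splits)
      then have "exp (\<alpha> * c) \<ge> 2 * y" using y by simp
      then show "exp (- (\<alpha> * c)) * y \<le> 1 / 2" by (simp add: exp_minus field_simps)
    qed (simp add: c_def)
    obtain B' where B': "B' > 0" "\<forall>K F G R. 0 \<le> K \<longrightarrow> c \<le> R \<longrightarrow>
      (\<forall>w. \<bar>Im w\<bar> \<le> \<theta> \<longrightarrow> (G has_field_derivative F w) (at w)) \<longrightarrow>
      (\<forall>w. \<bar>Im w\<bar> \<le> \<theta> \<longrightarrow> c \<le> Re w \<longrightarrow> norm (F w) \<le> K * (norm (exp (exp w)) * exp ((1 - \<nu>) * Re w))) \<longrightarrow>
      norm (G (Complex R \<theta>) - G (Complex R (- \<theta>))) \<le> K * B'"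
      using strip_primitive_increment_bound[OF c(1) \<theta>(1,3), of "(1 - \<nu>)"] by (elim exE conjE) (rule that)
    have "\<forall>k. \<exists>G. hankel_primitive (\<alpha> * real k + \<nu>) G"
      by (meson hankel_primitive_exists)
    then obtain H where H: "\<And>k. hankel_primitive (\<alpha> * real k + \<nu>) (H k)"
      using choice[of "\<lambda>k G. hankel_primitive (\<alpha> * real k + \<nu>) G"] by auto
    have partial: "norm (\<Sum>k<K. (- y) ^ k * rGamma (\<alpha> * real k + \<nu>)) * (2 * pi)
        \<le> 1 / (c0 * (1 + y)) * B + 2 * (1 / 2) ^ K * B'" for K
    proof -
      define G' where "G' w = G w - (\<Sum>k<K. of_real ((- y) ^ k) * H k w)" for w
      define F' where "F' w = F w - (\<Sum>k<K. of_real ((- y) ^ k) * hankel_integrand (\<alpha> * real k + \<nu>) w)" for w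
      have der: "(G' has_field_derivative F' w) (at w)" if "\<bar>Im w\<bar> \<le> \<theta>" for w
        unfolding G'_def F'_def
        by (intro DERIV_diff DERIV_sum DERIV_cmult G[OF that]) (use H in \<open>auto simp: hankel_primitive_def\<close>)
      have bd: "norm (F' w) \<le> 2 * (1 / 2) ^ K * (norm (exp (exp w)) * exp ((1 - \<nu>) * Re w))"
        if w: "\<bar>Im w\<bar> \<le> \<theta>" "Re w \<ge> c" for w
      proof -
        define q where "q = of_real y * exp (- (of_real \<alpha> * w))"
        have nq: "norm q \<le> 1 / 2"
        proof -
          have "norm q = exp (- (\<alpha> * Re w)) * y" using y by (simp add: q_def norm_mult norm_exp_eq_Re[of "- _"])
          also have "\<dots> \<le> exp (- (\<alpha> * c)) * y" using w \<alpha> y by (intro mult_right_mono) auto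
          finally show ?thesis using c by linarith
        qed
        have n1q: "norm (1 + q) \<ge> 1 / 2"
          using nq norm_triangle_ineq4[of "1 + q" q] by simp
        then have q1: "1 + q \<noteq> 0" by auto
        have "exp (of_real \<alpha> * w) / (exp (of_real \<alpha> * w) + of_real y) = 1 / (1 + q)"
          using q1 by (simp add: q_def exp_minus field_simps)
        then have "F w = hankel_integrand \<nu> w * (1 / (1 + q))" by (simp add: F_def)
        moreover have "of_real ((- y) ^ k) * hankel_integrand (\<alpha> * real k + \<nu>) w = hankel_integrand \<nu> w * (- q) ^ k" for k
        proof -
          have "exp (of_real (1 - (\<alpha> * real k + \<nu>)) * w) = exp (of_real (1 - \<nu>) * w + of_nat k * (- (of_real \<alpha> * w)))"
            by (simp add: algebra_simps)
          also have "\<dots> = exp (of_real (1 - \<nu>) * w) * exp (- (of_real \<alpha> * w)) ^ k"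
            unfolding exp_add exp_of_nat_mult by simp
          finally have 1: "hankel_integrand (\<alpha> * real k + \<nu>) w = hankel_integrand \<nu> w * exp (- (of_real \<alpha> * w)) ^ k"
            by (simp only: hankel_integrand_def mult.assoc)
          have "- q = of_real (- y) * exp (- (of_real \<alpha> * w))" by (simp add: q_def)
          then have "(- q) ^ k = of_real ((- y) ^ k) * exp (- (of_real \<alpha> * w)) ^ k"
            by (simp only: power_mult_distrib of_real_power)
          then show ?thesis unfolding 1 by (simp only: mult_ac)
        qed
        ultimately have "F' w = hankel_integrand \<nu> w * (1 / (1 + q) - (\<Sum>k<K. (- q) ^ k))"
          by (simp add: F'_def right_diff_distrib sum_distrib_left)
        also have "\<dots> = hankel_integrand \<nu> w * ((- q) ^ K / (1 + q))"
          using geometric_remainder[OF q1] by simp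
        finally have "norm (F' w) = norm (hankel_integrand \<nu> w) * (norm q ^ K / norm (1 + q))"
          by (simp add: norm_mult norm_divide norm_power)
        also have "\<dots> \<le> norm (hankel_integrand \<nu> w) * ((1 / 2) ^ K / (1 / 2))"
          using nq n1q by (intro mult_left_mono frac_le power_mono) auto
        finally show ?thesis by (simp add: norm_hankel_integrand mult_ac)
      qed
      have fin: "norm (\<Sum>k<K. of_real ((- y) ^ k) * \<Delta> (H k) R) \<le> 1 / (c0 * (1 + y)) * B + 2 * (1 / 2) ^ K * B'"
        if R: "R \<ge> c" for R
      proof -
        have "norm (\<Delta> G' R) \<le> 2 * (1 / 2) ^ K * B'"
          unfolding \<Delta>_def by (rule B'(2)[rule_format, OF _ R der bd]) auto
        moreover have "(\<Sum>k<K. of_real ((- y) ^ k) * \<Delta> (H k) R) = \<Delta> G R - \<Delta> G' R"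
          by (simp add: \<Delta>_def G'_def right_diff_distrib sum_subtractf)
        ultimately show ?thesis
          using bound[of R] R c norm_triangle_ineq4[of "\<Delta> G R" "\<Delta> G' R"] by simp
      qed
      have lim: "((\<lambda>R. \<Sum>k<K. of_real ((- y) ^ k) * \<Delta> (H k) R) \<longlongrightarrow>
          (\<Sum>k<K. of_real ((- y) ^ k) * (2 * pi * \<i> * rGamma (of_real (\<alpha> * real k + \<nu>))))) at_top"
        unfolding \<Delta>_def by (intro tendsto_intros hankel_increment[OF \<theta>(1,3)] H)
      have "norm (\<Sum>k<K. of_real ((- y) ^ k) * (2 * pi * \<i> * rGamma (of_real (\<alpha> * real k + \<nu>))))
        \<le> 1 / (c0 * (1 + y)) * B + 2 * (1 / 2) ^ K * B'"
      proof (rule tendsto_upperbound[OF tendsto_norm[OF lim]])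
        show "\<forall>\<^sub>F R in at_top. norm (\<Sum>k<K. of_real ((- y) ^ k) * \<Delta> (H k) R)
          \<le> 1 / (c0 * (1 + y)) * B + 2 * (1 / 2) ^ K * B'"
          by (rule eventually_at_top_linorderI[of c]) (rule fin)
      qed simp
      also have "(\<Sum>k<K. of_real ((- y) ^ k) * (2 * pi * \<i> * rGamma (of_real (\<alpha> * real k + \<nu>))))
        = 2 * pi * \<i> * of_real (\<Sum>k<K. (- y) ^ k * rGamma (\<alpha> * real k + \<nu>))"
        by (simp add: sum_distrib_left rGamma_complex_of_real mult_ac del: of_real_add of_real_mult) (simp add: mult_ac)
      finally show ?thesis by (simp add: norm_mult mult_ac del: of_real_sum)
    qed
    have lim: "(\<lambda>K. \<Sum>k<K. (- y) ^ k * rGamma (\<alpha> * real k + \<nu>)) \<longlonglongrightarrow> mittag_leffler \<alpha> \<nu> (- y)"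
      using mittag_leffler_sums[of \<alpha> \<nu> "- y"] \<alpha> by (simp add: sums_def mult.commute)
    have "\<bar>mittag_leffler \<alpha> \<nu> (- y)\<bar> * (2 * pi) \<le> 1 / (c0 * (1 + y)) * B + 2 * 0 * B'"
    proof (rule LIMSEQ_le)
      show "(\<lambda>K. norm (\<Sum>k<K. (- y) ^ k * rGamma (\<alpha> * real k + \<nu>)) * (2 * pi)) \<longlonglongrightarrow> \<bar>mittag_leffler \<alpha> \<nu> (- y)\<bar> * (2 * pi)"
        unfolding real_norm_def by (intro tendsto_intros lim)
      show "(\<lambda>K. 1 / (c0 * (1 + y)) * B + 2 * (1 / 2) ^ K * B') \<longlonglongrightarrow> 1 / (c0 * (1 + y)) * B + 2 * 0 * B'"
        by (intro tendsto_intros LIMSEQ_realpow_zero) auto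
    qed (use partial in blast)
    then have "\<bar>mittag_leffler \<alpha> \<nu> (- y)\<bar> \<le> 1 / (c0 * (1 + y)) * B / (2 * pi)"
      by (subst pos_le_divide_eq) auto
    also have "\<dots> = B / c0 / (2 * pi) / (1 + y)" by simp
    finally show "\<bar>mittag_leffler \<alpha> \<nu> (- y)\<bar> \<le> B / c0 / (2 * pi) / (1 + y)" .
  qed
qed

section \<open>Graded meshes\<close>

lemma mesh_0 [simp]: "mesh T r N 0 = 0"
  by (simp add: mesh_def)

text \<open>
Everything follows from \<open>t\<^sub>k\<^sub>-\<^sub>1 = t\<^sub>k x\<^sup>r\<close> with \<open>x = 1 - 1/k\<close> and \<open>1 - x \<le> 1 - x\<^sup>r \<le> r (1 - x)\<close>.
\<close>

lemma mesh_facts: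
  fixes T r :: real
  assumes "T > 0" "r \<ge> 1" "N \<ge> 1" "k \<ge> 1"
  defines "t \<equiv> mesh T r N"
  shows mesh_pos: "0 < t k"
    and mesh_step_lower: "t k / real k \<le> t k - t (k - 1)"
    and mesh_step_upper: "t k - t (k - 1) \<le> r * t k / real k"
proof -
  define x where "x = (real k - 1) / real k"
  have x: "0 \<le> x" "x < 1" using \<open>k \<ge> 1\<close> by (auto simp: x_def divide_simps)
  show pos: "0 < t k" using assms by (simp add: t_def mesh_def)
  have rel: "t (k - 1) = t k * x powr r"
  proof -
    have "real (k - 1) / real N = real k / real N * x"
      using assms by (simp add: x_def of_nat_diff)
    then have "(real (k - 1) / real N) powr r = (real k / real N) powr r * x powr r"
      using x by (simp only: powr_mult)
    then show ?thesis by (simp add: t_def mesh_def)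
  qed
  have 1: "x powr r \<le> x"
    using x powr_mono'[of 1 r x] \<open>r \<ge> 1\<close> by (cases "x = 0") auto
  have 2: "1 - x powr r \<le> r * (1 - x)"
  proof (cases "x = 0")
    case True then show ?thesis using \<open>r \<ge> 1\<close> by simp
  next
    case False
    then have "x > 0" using x by simp
    have "\<exists>z. z > x \<and> z < 1 \<and> 1 powr r - x powr r = (1 - x) * (r * z powr (r - 1))"
      by (rule MVT2[OF \<open>x < 1\<close>]) (use \<open>x > 0\<close> in \<open>auto intro!: has_real_derivative_powr\<close>)
    then obtain z where z: "z > x" "z < 1" "1 - x powr r = (1 - x) * (r * z powr (r - 1))" by auto
    have "z powr (r - 1) \<le> 1" using z x \<open>r \<ge> 1\<close> by (intro powr_le1) auto
    then have "(1 - x) * (r * z powr (r - 1)) \<le> (1 - x) * (r * 1)"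
      using x \<open>r \<ge> 1\<close> by (intro mult_left_mono) auto
    then show ?thesis using z by (simp add: mult.commute)
  qed
  have e: "1 - x = 1 / real k" using \<open>k \<ge> 1\<close> by (simp add: x_def field_simps)
  have "t k * (1 - x) \<le> t k * (1 - x powr r)" using 1 pos by (intro mult_left_mono) auto
  then show "t k / real k \<le> t k - t (k - 1)" unfolding rel e by (simp add: algebra_simps)
  have "t k * (1 - x powr r) \<le> t k * (r * (1 - x))" using 2 pos by (intro mult_left_mono) auto
  then show "t k - t (k - 1) \<le> r * t k / real k" unfolding rel e by (simp add: algebra_simps)
qed

lemma mesh_strict_mono:
  assumes "T > 0" "r \<ge> 1" "N \<ge> 1" "j < k"
  shows "mesh T r N j < mesh T r N k"
  using assms by (auto simp: mesh_def intro!: mult_strict_left_mono powr_less_mono2 divide_strict_right_mono)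

lemma mesh_mono:
  assumes "T > 0" "r \<ge> 1" "N \<ge> 1" "j \<le> k"
  shows "mesh T r N j \<le> mesh T r N k"
  using mesh_strict_mono[OF assms(1-3), of j k] assms(4) by (cases "j = k") auto

lemma mesh_le: 
  assumes "T > 0" "r \<ge> 1" "N \<ge> 1" "k \<le> N"
  shows "mesh T r N k \<le> T"
  using mesh_mono[OF assms] assms(1,3) by (simp add: mesh_def)



section \<open>Fractional integration kernels\<close>

lemma omega_kernel_mono:
  assumes "0 < \<beta>" "\<beta> < 1" "s \<le> s'" "s' < t"
  shows "omega (1 - \<beta>) (t - s) \<le> omega (1 - \<beta>) (t - s')"
  using assms by (auto simp: omega_def intro!: divide_right_mono powr_mono2' less_imp_le[OF Gamma_real_pos])

lemma omega_nonneg: "\<mu> > 0 \<Longrightarrow> omega \<mu> t \<ge> 0"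
  by (simp add: omega_def less_imp_le[OF Gamma_real_pos])

lemma omega_kernel_has_integral:
  assumes "0 < \<beta>" "\<beta> < 1" "a \<le> b" "b \<le> t"
  shows "((\<lambda>s. omega (1 - \<beta>) (t - s)) has_integral (omega (2 - \<beta>) (t - a) - omega (2 - \<beta>) (t - b))) {a..b}"
proof -
  have G: "Gamma (2 - \<beta>) = (1 - \<beta>) * Gamma (1 - \<beta>)"
  proof -
    have "1 - \<beta> \<notin> \<int>\<^sub>\<le>\<^sub>0" using assms nonpos_Ints_nonpos[of "1 - \<beta>"] by auto
    from Gamma_plus1[OF this] show ?thesis by (simp add: algebra_simps)
  qed
  have "((\<lambda>s. omega (1 - \<beta>) (t - s)) has_integral ((- omega (2 - \<beta>) (t - b)) - (- omega (2 - \<beta>) (t - a)))) {a..b}"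
  proof (rule fundamental_theorem_of_calculus_interior)
    show "continuous_on {a..b} (\<lambda>s. - omega (2 - \<beta>) (t - s))"
    proof -
      have "Gamma (2 - \<beta>) > 0" using assms by (intro Gamma_real_pos) auto
      moreover have c: "continuous_on {a..b} (\<lambda>s. (t - s) powr (2 - \<beta> - 1))"
        by (rule continuous_on_powr') (use assms in \<open>auto intro!: continuous_intros\<close>)
      ultimately show ?thesis unfolding omega_def
        by (intro continuous_on_minus continuous_on_divide continuous_on_const c) auto
    qed
    fix s assume s: "s \<in> {a<..<b}"
    have "((\<lambda>s. - ((t - s) powr (1 - \<beta>) / Gamma (2 - \<beta>))) has_real_derivative (t - s) powr (- \<beta>) / Gamma (1 - \<beta>)) (at s)"
    proof -
      have "((\<lambda>s. (t - s) powr (1 - \<beta>)) has_real_derivative (1 - \<beta>) * (t - s) powr (1 - \<beta> - 1) * (0 - 1)) (at s)"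
        using s assms by (intro DERIV_chain2[OF has_real_derivative_powr] derivative_intros) auto
      from DERIV_minus[OF DERIV_cdivide[OF this, of "Gamma (2 - \<beta>)"]] show ?thesis
        using assms by (simp add: G)
    qed
    then show "((\<lambda>s. - omega (2 - \<beta>) (t - s)) has_vector_derivative omega (1 - \<beta>) (t - s)) (at s)"
      by (simp add: omega_def has_real_derivative_iff_has_vector_derivative)
  qed (use assms in auto)
  then show ?thesis by simp
qed

text \<open>
The semigroup property of fractional integration, which is Euler's Beta integral after scaling.
\<close>

lemma omega_convolution:
  assumes "\<mu> > 0" "\<nu> > 0" "t > 0"
  shows "((\<lambda>s. omega \<mu> (t - s) * omega \<nu> s) has_integral omega (\<mu> + \<nu>) t) {0..t}"
proof -
  have "((\<lambda>x. x powr (\<nu> - 1) * (1 - x) powr (\<mu> - 1)) has_integral Beta \<nu> \<mu>) {0..1}"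
    using assms by (intro has_integral_Beta_real) auto
  from has_integral_affinity'[OF this[folded cbox_interval], of "1 / t" 0]
  have "((\<lambda>s. (s / t) powr (\<nu> - 1) * (1 - s / t) powr (\<mu> - 1)) has_integral t * Beta \<nu> \<mu>) {0..t}"
    using assms by (simp add: divide_inverse mult.commute)
  from has_integral_mult_right[OF this, of "t powr (\<mu> + \<nu> - 2) / (Gamma \<mu> * Gamma \<nu>)"]
  have 1: "((\<lambda>s. t powr (\<mu> + \<nu> - 2) / (Gamma \<mu> * Gamma \<nu>) * ((s / t) powr (\<nu> - 1) * (1 - s / t) powr (\<mu> - 1)))
      has_integral t powr (\<mu> + \<nu> - 2) / (Gamma \<mu> * Gamma \<nu>) * (t * Beta \<nu> \<mu>)) {0..t}" .
  have G: "Gamma \<mu> > 0" "Gamma \<nu> > 0" using assms by (auto intro: Gamma_real_pos)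
  have "t powr (\<mu> + \<nu> - 2) * t = t powr (\<mu> + \<nu> - 1)"
    using assms powr_add[of t "\<mu> + \<nu> - 2" 1] by simp
  then have 2: "t powr (\<mu> + \<nu> - 2) / (Gamma \<mu> * Gamma \<nu>) * (t * Beta \<nu> \<mu>) = omega (\<mu> + \<nu>) t"
    using G by (simp add: omega_def Beta_def field_simps)
  have 3: "t powr (\<mu> + \<nu> - 2) / (Gamma \<mu> * Gamma \<nu>) * ((s / t) powr (\<nu> - 1) * (1 - s / t) powr (\<mu> - 1))
      = omega \<mu> (t - s) * omega \<nu> s" if s: "s \<in> {0..t}" for s
  proof -
    have "t powr (\<mu> + \<nu> - 2) = t powr (\<nu> - 1) * t powr (\<mu> - 1)"
      by (simp add: powr_add[symmetric] algebra_simps)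
    moreover have "t powr (\<nu> - 1) * (s / t) powr (\<nu> - 1) = s powr (\<nu> - 1)"
      using s assms by (simp add: powr_mult[symmetric])
    moreover have "t powr (\<mu> - 1) * (1 - s / t) powr (\<mu> - 1) = (t - s) powr (\<mu> - 1)"
    proof -
      have "t * (1 - s / t) = t - s" using assms by (simp add: field_simps)
      then show ?thesis using s assms by (simp add: powr_mult[symmetric])
    qed
    ultimately have "t powr (\<mu> + \<nu> - 2) * ((s / t) powr (\<nu> - 1) * (1 - s / t) powr (\<mu> - 1))
        = s powr (\<nu> - 1) * (t - s) powr (\<mu> - 1)" by (metis mult.assoc mult.left_commute)
    then show ?thesis by (simp add: omega_def)
  qed
  show ?thesis using has_integral_cong[THEN iffD1, OF 3 1[unfolded 2]] .
qed


section \<open>Stability of the L1 operator\<close>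

text \<open>
A weight of the L1 operator is a mean of the increasing kernel \<open>s \<mapsto> \<omega>\<^bsub>1-\<beta>\<^esub>(t\<^sub>n - s)\<close> over a cell. This and
the next lemma compare it with the values at the endpoints, which yields both monotonicity of the
weights and the lower bound for the first one.
\<close>

lemma L1_coeff_lower:
  assumes "0 < \<beta>" "\<beta> < 1" "strict_mono t" "1 \<le> k" "k \<le> n"
  shows "omega (1 - \<beta>) (t n - t (k - 1)) \<le> L1_coeff \<beta> t n k"
proof -
  have lt: "t (k - 1) < t k" "t k \<le> t n"
    using assms by (auto simp: strict_mono_less strict_mono_less_eq)
  let ?a = "t (k - 1)" and ?b = "t k" and ?f = "\<lambda>s. omega (1 - \<beta>) (t n - s)"
  have "(?f has_integral integral {?a..?b} ?f) {?a..?b}"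
    using omega_kernel_has_integral[OF assms(1,2) less_imp_le[OF lt(1)] lt(2)]
    by (simp only: has_integral_iff)
  then have 1: "(?f has_integral integral {?a..?b} ?f) {?a<..<?b}"
    by (simp only: has_integral_Icc_iff_Ioo)
  have "((\<lambda>s. ?f ?a) has_integral (?f ?a * (?b - ?a))) {?a<..<?b}"
    using has_integral_const_real[of "?f ?a" ?a ?b] lt by (simp add: has_integral_Icc_iff_Ioo mult.commute)
  from this 1 have "?f ?a * (?b - ?a) \<le> integral {?a..?b} ?f"
    by (rule has_integral_le) (use assms lt in \<open>auto intro!: omega_kernel_mono\<close>)
  then show ?thesis using lt by (simp add: L1_coeff_def field_simps)
qed

lemma L1_coeff_upper:
  assumes "0 < \<beta>" "\<beta> < 1" "strict_mono t" "1 \<le> k" "k < n"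
  shows "L1_coeff \<beta> t n k \<le> omega (1 - \<beta>) (t n - t k)"
proof -
  have lt: "t (k - 1) < t k" "t k < t n"
    using assms by (auto simp: strict_mono_less)
  let ?a = "t (k - 1)" and ?b = "t k" and ?f = "\<lambda>s. omega (1 - \<beta>) (t n - s)"
  have 1: "(?f has_integral integral {?a..?b} ?f) {?a..?b}"
    using omega_kernel_has_integral[OF assms(1,2) less_imp_le[OF lt(1)] less_imp_le[OF lt(2)]]
    by (simp add: has_integral_iff)
  have "((\<lambda>s. ?f ?b) has_integral (?f ?b * (?b - ?a))) {?a..?b}"
    using has_integral_const_real[of "?f ?b" ?a ?b] lt by (simp add: mult.commute)
  from 1 this have "integral {?a..?b} ?f \<le> ?f ?b * (?b - ?a)"
    by (rule has_integral_le) (use assms lt in \<open>auto intro!: omega_kernel_mono\<close>)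
  then show ?thesis using lt by (simp add: L1_coeff_def field_simps)
qed

lemma L1_coeff_pos:
  assumes "0 < \<beta>" "\<beta> < 1" "strict_mono t" "1 \<le> k" "k \<le> n"
  shows "0 < L1_coeff \<beta> t n k"
proof -
  have "t (k - 1) < t n" using assms by (auto simp: strict_mono_less)
  then have "0 < omega (1 - \<beta>) (t n - t (k - 1))"
    using assms by (auto simp: omega_def intro!: divide_pos_pos Gamma_real_pos)
  also note L1_coeff_lower[OF assms]
  finally show ?thesis .
qed

lemma L1_coeff_mono:
  assumes "0 < \<beta>" "\<beta> < 1" "strict_mono t" "1 \<le> k" "k < n"
  shows "L1_coeff \<beta> t n k \<le> L1_coeff \<beta> t n (Suc k)"
  using L1_coeff_upper[OF assms] L1_coeff_lower[OF assms(1-3), of "Suc k" n] assms by simp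

lemma sum_by_parts_increments:
  fixes A :: "nat \<Rightarrow> 'a::comm_ring_1"
  shows "(\<Sum>k=1..Suc n. A k * (W k - W (k - 1))) =
    A (Suc n) * W (Suc n) - (\<Sum>k=1..n. (A (Suc k) - A k) * W k) - A 1 * W 0"
  by (induction n) (auto simp: algebra_simps)

text \<open>
Summation by parts turns the equation into
\<open>(A\<^sub>n - \<i>\<mu>) W\<^sub>n = \<Sum>\<^sub>k (A\<^sub>k\<^sub>+\<^sub>1 - A\<^sub>k) W\<^sub>k + F\<^sub>n\<close> with nonnegative factors that telescope to \<open>A\<^sub>n - A\<^sub>1\<close>. If all
earlier \<open>W\<^sub>k\<close> are bounded by \<open>S\<close>, then so is \<open>W\<^sub>n\<close>, because \<open>\<bar>A\<^sub>n - \<i>\<mu>\<bar> \<ge> A\<^sub>n\<close> and the forcing fits into the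
gap \<open>S A\<^sub>1\<close>. The bound does not involve \<open>\<mu>\<close>.
\<close>

theorem L1_stability:
  fixes W F :: "nat \<Rightarrow> complex" and \<mu> S :: real
  assumes \<beta>: "0 < \<beta>" "\<beta> < 1" and t: "strict_mono t" and "S \<ge> 0" and W0: "W 0 = 0"
    and eq: "\<And>n. 1 \<le> n \<Longrightarrow> n \<le> N \<Longrightarrow>
      (\<Sum>k=1..n. of_real (L1_coeff \<beta> t n k) * (W k - W (k - 1))) = \<i> * of_real \<mu> * W n + F n"
    and F: "\<And>n. 1 \<le> n \<Longrightarrow> n \<le> N \<Longrightarrow> norm (F n) \<le> S * L1_coeff \<beta> t n 1"
  shows "n \<le> N \<Longrightarrow> norm (W n) \<le> S"
proof (induction n rule: less_induct)
  case (less n)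
  show ?case
  proof (cases n)
    case 0 then show ?thesis using W0 \<open>S \<ge> 0\<close> by simp
  next
    case (Suc m)
    define A where "A = L1_coeff \<beta> t n"
    have pos: "A n > 0" using L1_coeff_pos[OF \<beta> t, of n n] Suc by (simp add: A_def)
    have mono: "A k \<le> A (Suc k)" if "k \<in> {1..m}" for k
      using L1_coeff_mono[OF \<beta> t, of k n] that Suc by (simp add: A_def)
    have tele: "(\<Sum>k=1..m. A (Suc k) - A k) = A n - A 1"
      using sum_Suc_diff[of 1 m A] Suc by simp
    have "of_real (A n) * W n - (\<Sum>k=1..m. (of_real (A (Suc k)) - of_real (A k)) * W k) - of_real (A 1) * W 0
        = \<i> * of_real \<mu> * W n + F n"
      using eq[of n] less.prems Suc sum_by_parts_increments[of "\<lambda>k. of_real (A k)" W m] by (simp add: A_def)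
    then have main: "(of_real (A n) - \<i> * of_real \<mu>) * W n = (\<Sum>k=1..m. of_real (A (Suc k) - A k) * W k) + F n"
      using W0 by (simp add: algebra_simps)
    have "A n \<le> norm (of_real (A n) - \<i> * of_real \<mu>)"
      using complex_Re_le_cmod[of "of_real (A n) - \<i> * of_real \<mu>"] by simp
    then have "A n * norm (W n) \<le> norm (of_real (A n) - \<i> * of_real \<mu>) * norm (W n)"
      by (rule mult_right_mono) simp
    also have "\<dots> = norm ((\<Sum>k=1..m. of_real (A (Suc k) - A k) * W k) + F n)"
      by (simp only: norm_mult[symmetric] main)
    also have "\<dots> \<le> (\<Sum>k=1..m. norm (of_real (A (Suc k) - A k) * W k)) + norm (F n)"
      by (intro order_trans[OF norm_triangle_ineq] add_right_mono norm_sum)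
    also have "\<dots> \<le> (\<Sum>k=1..m. (A (Suc k) - A k) * S) + S * A 1"
    proof (intro add_mono sum_mono)
      fix k assume k: "k \<in> {1..m}"
      have "norm (W k) \<le> S" using less.IH[of k] k less.prems Suc by simp
      then show "norm (of_real (A (Suc k) - A k) * W k) \<le> (A (Suc k) - A k) * S"
        using mono[OF k] by (simp add: norm_mult mult_left_mono del: of_real_diff)
    next
      show "norm (F n) \<le> S * A 1" using F[of n] less.prems Suc by (simp add: A_def)
    qed
    also have "\<dots> = A n * S" unfolding sum_distrib_right[symmetric] tele by (simp add: algebra_simps)
    finally show ?thesis using pos by simp
  qed
qed

section \<open>Truncation error of the L1 operator\<close>

text \<open>
Smoothness away from \<open>t = 0\<close> with an initial singularity of strength \<open>\<sigma>\<close>: the model function is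
\<open>t powr \<sigma>\<close>.
\<close>

definition graded_regular ::
  "real \<Rightarrow> real \<Rightarrow> real \<Rightarrow> (real \<Rightarrow> real) \<Rightarrow> (real \<Rightarrow> real) \<Rightarrow> (real \<Rightarrow> real) \<Rightarrow> bool" where
  "graded_regular T \<sigma> M w w' w'' \<longleftrightarrow> continuous_on {0..T} w \<and>
     (\<forall>t\<in>{0<..T}. (w has_real_derivative w' t) (at t) \<and> (w' has_real_derivative w'' t) (at t) \<and>
        \<bar>w' t\<bar> \<le> M * t powr (\<sigma> - 1) \<and> \<bar>w'' t\<bar> \<le> M * t powr (\<sigma> - 2))"

lemma graded_regularD:
  assumes "graded_regular T \<sigma> M w w' w''" "0 < t" "t \<le> T"
  shows "(w has_real_derivative w' t) (at t)" "(w' has_real_derivative w'' t) (at t)"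
    "\<bar>w' t\<bar> \<le> M * t powr (\<sigma> - 1)" "\<bar>w'' t\<bar> \<le> M * t powr (\<sigma> - 2)"
  using assms by (auto simp: graded_regular_def)

lemma graded_regular_increment:
  assumes "graded_regular T \<sigma> M w w' w''" "0 \<le> a" "a \<le> b" "b \<le> T"
  shows "(w' has_integral (w b - w a)) {a..b}"
proof (rule fundamental_theorem_of_calculus_interior)
  show "continuous_on {a..b} w"
    using assms by (auto simp: graded_regular_def intro: continuous_on_subset)
  show "(w has_vector_derivative w' x) (at x)" if "x \<in> {a<..<b}" for x
    using graded_regularD(1)[OF assms(1), of x] assms that
    by (simp add: has_real_derivative_iff_has_vector_derivative)
qed (use assms in auto)

text \<open>
The error committed on one cell by replacing \<open>w'\<close> with the slope of the chord. Since \<open>w'\<close> minus the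
slope has mean zero, a constant \<open>c\<close> may be subtracted from the kernel \<open>K\<close>; the choice of \<open>c\<close> exploits
the small oscillation of \<open>K\<close> on cells away from \<open>t\<^sub>n\<close>, and \<open>c = 0\<close> serves for the last cell.
\<close>

lemma cell_consistency:
  fixes K \<kappa> g w w' :: "real \<Rightarrow> real"
  assumes "a < b"
    and Kw: "((\<lambda>s. K s * w' s) has_integral vc) {a..b}" and K: "(K has_integral kc) {a..b}"
    and w: "(w' has_integral (w b - w a)) {a..b}"
    and \<kappa>: "\<And>s. a < s \<Longrightarrow> s < b \<Longrightarrow> \<bar>K s - c\<bar> \<le> \<kappa> s"
    and g: "\<And>s. a < s \<Longrightarrow> s < b \<Longrightarrow> \<bar>w' s - (w b - w a) / (b - a)\<bar> \<le> g s"
    and J: "((\<lambda>s. \<kappa> s * g s) has_integral J) {a..b}"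
  shows "\<bar>vc - 1 / (b - a) * kc * (w b - w a)\<bar> \<le> J"
proof -
  define d where "d = (w b - w a) / (b - a)"
  have d: "d * (b - a) = w b - w a" using \<open>a < b\<close> by (simp add: d_def)
  have *: "((\<lambda>s. (K s * w' s - d * K s) - c * (w' s - d)) has_integral
      ((vc - d * kc) - c * ((w b - w a) - d * (b - a)))) {a..b}"
    using has_integral_const_real[of d a b] \<open>a < b\<close>
    by (intro has_integral_diff Kw has_integral_mult_right K w) (simp add: mult.commute)
  have I: "((\<lambda>s. (K s - c) * (w' s - d)) has_integral (vc - d * kc)) {a<..<b}"
  proof -
    have "(\<lambda>s. (K s * w' s - d * K s) - c * (w' s - d)) = (\<lambda>s. (K s - c) * (w' s - d))"
      by (auto simp: algebra_simps)
    then show ?thesis using * unfolding d by (simp add: has_integral_Icc_iff_Ioo)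
  qed
  have bd: "\<bar>(K s - c) * (w' s - d)\<bar> \<le> \<kappa> s * g s" if "s \<in> {a<..<b}" for s
    using that \<kappa>[of s] g[of s] by (auto simp: abs_mult d_def intro!: mult_mono)
  have J': "((\<lambda>s. \<kappa> s * g s) has_integral J) {a<..<b}" using J by (simp add: has_integral_Icc_iff_Ioo)
  have "vc - d * kc \<le> J"
    by (rule has_integral_le[OF I J']) (use bd in \<open>auto simp: abs_le_iff\<close>)
  moreover have "- (vc - d * kc) \<le> J"
    by (rule has_integral_le[OF has_integral_neg[OF I] J']) (use bd in \<open>auto simp: abs_le_iff\<close>)
  ultimately show ?thesis by (simp add: d_def abs_le_iff mult.commute)
qed

lemma slope_deviation:
  assumes reg: "graded_regular T \<sigma> M w w' w''" and "0 < a" "a < b" "b \<le> T" "\<sigma> \<le> 1" "M \<ge> 0"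
    and s: "a < s" "s < b"
  shows "\<bar>w' s - (w b - w a) / (b - a)\<bar> \<le> M * a powr (\<sigma> - 2) * (b - a)"
proof -
  note D = graded_regularD[OF reg]
  have "\<exists>z. a < z \<and> z < b \<and> w b - w a = (b - a) * w' z"
    using assms by (intro MVT2 D) auto
  then obtain z where z: "a < z" "z < b" "(w b - w a) / (b - a) = w' z"
    using \<open>a < b\<close> by (auto simp: field_simps)
  have "norm (w' s - w' z) \<le> M * a powr (\<sigma> - 2) * norm (s - z)"
  proof (rule field_differentiable_bound[where S = "{a..b}"])
    fix x assume x: "x \<in> {a..b}"
    show "(w' has_field_derivative w'' x) (at x within {a..b})"
      using D(2)[of x] x assms by (auto intro: has_field_derivative_at_within)
    have "\<bar>w'' x\<bar> \<le> M * x powr (\<sigma> - 2)" using D(4)[of x] x assms by auto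
    also have "x powr (\<sigma> - 2) \<le> a powr (\<sigma> - 2)" using x assms by (intro powr_mono2') auto
    finally show "norm (w'' x) \<le> M * a powr (\<sigma> - 2)" using \<open>M \<ge> 0\<close> by (simp add: mult_left_mono)
  qed (use z s in auto)
  also have "\<dots> \<le> M * a powr (\<sigma> - 2) * (b - a)"
    using z s \<open>M \<ge> 0\<close> by (intro mult_left_mono) auto
  finally show ?thesis using z by simp
qed

lemma powr_has_integral_0:
  fixes \<sigma> b :: real
  assumes "\<sigma> > 0" "b \<ge> 0"
  shows "((\<lambda>s. s powr (\<sigma> - 1)) has_integral b powr \<sigma> / \<sigma>) {0..b}"
  using has_integral_powr_from_0[of "\<sigma> - 1" b] assms by simp

lemma slope_deviation_first:
  assumes reg: "graded_regular T \<sigma> M w w' w''" and "0 < b" "b \<le> T" "0 < \<sigma>" "\<sigma> \<le> 1" "M \<ge> 0"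
    and s: "0 < s" "s < b"
  shows "\<bar>w' s - (w b - w 0) / (b - 0)\<bar> \<le> M * (1 + 1 / \<sigma>) * s powr (\<sigma> - 1)"
proof -
  note D = graded_regularD[OF reg]
  have i: "(w' has_integral (w b - w 0)) {0<..<b}"
    using graded_regular_increment[OF reg, of 0 b] assms by (simp add: has_integral_Icc_iff_Ioo)
  have p: "((\<lambda>s. M * s powr (\<sigma> - 1)) has_integral M * (b powr \<sigma> / \<sigma>)) {0<..<b}"
    using powr_has_integral_0[of \<sigma> b] assms by (intro has_integral_mult_right) (simp add: has_integral_Icc_iff_Ioo)
  have "w b - w 0 \<le> M * (b powr \<sigma> / \<sigma>)"
    by (rule has_integral_le[OF i p]) (use D(3) assms in \<open>force simp: abs_le_iff\<close>)
  moreover have "- (w b - w 0) \<le> M * (b powr \<sigma> / \<sigma>)"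
    by (rule has_integral_le[OF has_integral_neg[OF i] p]) (use D(3) assms in \<open>force simp: abs_le_iff\<close>)
  ultimately have "\<bar>w b - w 0\<bar> / b \<le> M * (b powr \<sigma> / \<sigma>) / b"
    using assms by (intro divide_right_mono) (auto simp: abs_le_iff)
  also have "\<dots> = M / \<sigma> * b powr (\<sigma> - 1)" using assms by (simp add: powr_diff)
  also have "\<dots> \<le> M / \<sigma> * s powr (\<sigma> - 1)"
    using assms by (intro mult_left_mono powr_mono2') auto
  finally have 1: "\<bar>(w b - w 0) / (b - 0)\<bar> \<le> M / \<sigma> * s powr (\<sigma> - 1)" using assms by simp
  have "\<bar>w' s - (w b - w 0) / (b - 0)\<bar> \<le> \<bar>w' s\<bar> + \<bar>(w b - w 0) / (b - 0)\<bar>" by (rule abs_triangle_ineq4)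
  also have "\<dots> \<le> M * s powr (\<sigma> - 1) + M / \<sigma> * s powr (\<sigma> - 1)"
    using D(3)[of s] 1 assms by (intro add_mono) auto
  finally show ?thesis by (simp add: algebra_simps)
qed

lemma integral_eq_sum_over_cells:
  fixes f :: "real \<Rightarrow> real" and t :: "nat \<Rightarrow> real"
  assumes "mono t" "f integrable_on {t 0..t n}"
  shows "integral {t 0..t n} f = (\<Sum>k=1..n. integral {t (k - 1)..t k} f)"
  using assms(2)
proof (induction n)
  case 0 then show ?case by simp
next
  case (Suc n)
  have le: "t 0 \<le> t n" "t n \<le> t (Suc n)" using \<open>mono t\<close> by (auto simp: monoD)
  have "f integrable_on {t 0..t n}"
    by (rule integrable_on_subinterval[OF Suc.prems]) (use le in auto)
  then show ?case
    using Suc Henstock_Kurzweil_Integration.integral_combine[OF le Suc.prems] by simp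
qed

text \<open>
The condition \<open>p \<le> r \<sigma>\<close> converts the initial singularity into the rate \<open>N powr -p\<close>.
\<close>

lemma mesh_powr_bound:
  assumes "T > 0" "r \<ge> 1" "1 \<le> k" "k \<le> N" "0 < \<sigma>" "p \<le> r * \<sigma>"
  shows "mesh T r N k powr \<sigma> \<le> T powr \<sigma> * real k powr p * real N powr (- p)"
proof -
  have "mesh T r N k powr \<sigma> = T powr \<sigma> * (real k / real N) powr (r * \<sigma>)"
    using assms by (simp add: mesh_def powr_mult powr_powr)
  also have "(real k / real N) powr (r * \<sigma>) \<le> (real k / real N) powr p"
    using assms by (intro powr_mono') auto
  also have "\<dots> = real k powr p * real N powr (- p)"
    using assms by (subst powr_divide) (auto simp: powr_minus divide_inverse)
  finally show ?thesis using assms by (simp add: mult_left_mono mult.assoc)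
qed

text \<open>
The cellwise oscillations of the kernel telescope, but the last ones are of the order
\<open>\<tau>\<^sub>n powr -\<beta>\<close>, which is too large by a factor \<open>n powr \<beta>\<close>. That factor is compensated by
\<open>k powr -\<beta>\<close> on the cells with \<open>k \<ge> n/2\<close>; the oscillations on the remaining cells only add up to
\<open>\<omega>\<^bsub>1-\<beta>\<^esub>(t\<^sub>n/2)\<close> at most.
\<close>

lemma kernel_oscillation_sum:
  assumes "0 < \<beta>" "\<beta> < 1" "T > 0" "r \<ge> 1" "1 \<le> n" "n \<le> N"
  defines "t \<equiv> mesh T r N"
  shows "(\<Sum>k=1..n-1. (omega (1 - \<beta>) (t n - t k) - omega (1 - \<beta>) (t n - t (k - 1))) * real k powr (- \<beta>))
    \<le> 2 * 2 powr \<beta> / Gamma (1 - \<beta>) * t n powr (- \<beta>)"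
proof -
  define osc where "osc k = omega (1 - \<beta>) (t n - t k) - omega (1 - \<beta>) (t n - t (k - 1))" for k
  \<comment> \<open>the cells up to \<open>m\<close> have a distance of at least \<open>t\<^sub>n / 2\<close> from \<open>t\<^sub>n\<close>\<close>
  define m where "m = (n - 1) div 2"
  have N: "N \<ge> 1" using assms by simp
  have tlt: "t j < t k" if "j < k" for j k using mesh_strict_mono[OF assms(3,4) N that] by (simp add: t_def)
  have tn: "t n > 0" using mesh_pos[OF assms(3,4) N assms(5)] by (simp add: t_def)
  have G: "Gamma (1 - \<beta>) > 0" using assms by (intro Gamma_real_pos) auto
  have osc0: "osc k \<ge> 0" if "k \<in> {1..n-1}" for k
    using that omega_kernel_mono[OF assms(1,2), of "t (k - 1)" "t k" "t n"] tlt[of "k - 1" k] tlt[of k n]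
    by (auto simp: osc_def)
  have tele: "(\<Sum>k=1..j. osc k) \<le> omega (1 - \<beta>) (t n - t j)" for j
  proof -
    have "(\<Sum>k=1..j. osc k) = omega (1 - \<beta>) (t n - t j) - omega (1 - \<beta>) (t n - t 0)"
      unfolding osc_def by (induction j) auto
    then show ?thesis using omega_nonneg[of "1 - \<beta>" "t n - t 0"] assms by simp
  qed
  have "(\<Sum>k=1..n-1. osc k * real k powr (- \<beta>)) \<le>
      (\<Sum>k=1..n-1. osc k * (2 powr \<beta> * real n powr (- \<beta>)) + (if k \<le> m then osc k else 0))"
  proof (rule sum_mono)
    fix k assume k: "k \<in> {1..n-1}"
    show "osc k * real k powr (- \<beta>) \<le> osc k * (2 powr \<beta> * real n powr (- \<beta>)) + (if k \<le> m then osc k else 0)"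
    proof (cases "k \<le> m")
      case True
      have "real k powr (- \<beta>) \<le> 1 powr (- \<beta>)" using k assms by (intro powr_mono2') auto
      then have "osc k * real k powr (- \<beta>) \<le> osc k" using osc0[OF k] by (simp add: mult_left_le)
      moreover have "osc k * (2 powr \<beta> * real n powr (- \<beta>)) \<ge> 0" using osc0[OF k] by simp
      ultimately show ?thesis using True by simp
    next
      case False
      then have "real n / 2 \<le> real k" by (simp add: m_def)
      then have "real k powr (- \<beta>) \<le> (real n / 2) powr (- \<beta>)"
        using assms by (intro powr_mono2') auto
      also have "\<dots> = 2 powr \<beta> * real n powr (- \<beta>)"
        using assms by (simp add: powr_divide powr_minus field_simps)
      finally show ?thesis using False osc0[OF k] by (simp add: mult_left_mono)
    qed
  qed
  also have "\<dots> = (\<Sum>k=1..n-1. osc k) * (2 powr \<beta> * real n powr (- \<beta>)) + (\<Sum>k=1..m. osc k)"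
  proof -
    have "{1..n-1} \<inter> {k. k \<le> m} = {1..m}" by (auto simp: m_def)
    then show ?thesis by (simp add: sum.distrib sum_distrib_right sum.If_cases)
  qed
  also have "\<dots> \<le> omega (1 - \<beta>) (t n - t (n - 1)) * (2 powr \<beta> * real n powr (- \<beta>)) + omega (1 - \<beta>) (t n - t m)"
    by (intro add_mono mult_right_mono tele) auto
  also have "\<dots> \<le> 2 powr \<beta> / Gamma (1 - \<beta>) * t n powr (- \<beta>) + 2 powr \<beta> / Gamma (1 - \<beta>) * t n powr (- \<beta>)"
  proof (rule add_mono)
    have "t n / real n \<le> t n - t (n - 1)"
      using mesh_step_lower[OF assms(3,4) N assms(5)] by (simp add: t_def)
    then have "(t n - t (n - 1)) powr (- \<beta>) \<le> (t n / real n) powr (- \<beta>)"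
      using assms tn by (intro powr_mono2') auto
    also have "\<dots> = t n powr (- \<beta>) * real n powr \<beta>"
      using assms tn by (simp add: powr_divide powr_minus field_simps)
    finally have "(t n - t (n - 1)) powr (- \<beta>) * real n powr (- \<beta>) \<le> t n powr (- \<beta>) * real n powr \<beta> * real n powr (- \<beta>)"
      by (rule mult_right_mono) simp
    then have "(t n - t (n - 1)) powr (- \<beta>) * real n powr (- \<beta>) \<le> t n powr (- \<beta>)"
      using assms by (simp add: powr_minus field_simps)
    from mult_left_mono[OF this, of "2 powr \<beta> / Gamma (1 - \<beta>)"] G
    show "omega (1 - \<beta>) (t n - t (n - 1)) * (2 powr \<beta> * real n powr (- \<beta>)) \<le> 2 powr \<beta> / Gamma (1 - \<beta>) * t n powr (- \<beta>)"
      by (simp add: omega_def field_simps)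
    have "t m \<le> t n / 2"
    proof -
      have q: "real m / real n \<le> 1 / 2" using assms by (simp add: m_def field_simps)
      have "t m = T * (real n / real N * (real m / real n)) powr r"
        using assms by (simp add: t_def mesh_def)
      also have "\<dots> = t n * (real m / real n) powr r"
        by (subst powr_mult) (simp_all add: t_def mesh_def)
      also have "\<dots> \<le> t n * (1 / 2) powr 1"
      proof (intro mult_left_mono)
        have "(real m / real n) powr r \<le> (1 / 2) powr r" using q assms by (intro powr_mono2) auto
        also have "\<dots> \<le> (1 / 2) powr 1" using assms by (intro powr_mono') auto
        finally show "(real m / real n) powr r \<le> (1 / 2) powr 1" .
      qed (use tn in auto)
      finally show ?thesis by simp
    qed
    then have "(t n - t m) powr (- \<beta>) \<le> (t n / 2) powr (- \<beta>)"
      using assms tn by (intro powr_mono2') auto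
    also have "\<dots> = 2 powr \<beta> * t n powr (- \<beta>)"
      using assms tn by (simp add: powr_divide powr_minus field_simps)
    finally show "omega (1 - \<beta>) (t n - t m) \<le> 2 powr \<beta> / Gamma (1 - \<beta>) * t n powr (- \<beta>)"
      using G by (simp add: omega_def divide_right_mono)
  qed
  finally show ?thesis by (simp add: osc_def mult_ac)
qed


text \<open>
\<open>v\<close> stands for the Caputo derivative of \<open>w\<close> at \<open>t\<^sub>n\<close>. The same constant has to serve all functions with
the given singularity, since it is applied to infinitely many modes at once.
\<close>

definition L1_accurate :: "real \<Rightarrow> real \<Rightarrow> real \<Rightarrow> real \<Rightarrow> real \<Rightarrow> bool" where
  "L1_accurate T r \<beta> \<sigma> C \<longleftrightarrow> (\<forall>M N n w w' w'' v. graded_regular T \<sigma> M w w' w'' \<longrightarrow> M \<ge> 0 \<longrightarrow> 1 \<le> n \<longrightarrow> n \<le> N \<longrightarrow>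
    ((\<lambda>s. omega (1 - \<beta>) (mesh T r N n - s) * w' s) has_integral v) {0..mesh T r N n} \<longrightarrow>
    \<bar>v - (\<Sum>k=1..n. L1_coeff \<beta> (mesh T r N) n k * (w (mesh T r N k) - w (mesh T r N (k - 1))))\<bar>
      \<le> C * M * real N powr (- (2 - \<beta>)) * mesh T r N n powr (- \<beta>))"

text \<open>
On the \<open>k\<close>-th cell the integral of \<open>\<bar>w' - slope\<bar>\<close> is at most a constant times
\<open>M k powr -\<beta> N powr (\<beta> - 2)\<close>: for \<open>k \<ge> 2\<close> by \<open>\<tau>\<^sub>k\<^sup>2 \<bar>w''\<bar>\<close>, for \<open>k = 1\<close> by integrating the bound on \<open>w'\<close>. Every
cell but the last contributes this number times the oscillation of the kernel, and
\<open>kernel_oscillation_sum\<close> adds these up. The last cell sees the singularity of the kernel and is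
estimated directly; if it is also the first cell, both singularities meet in a Beta integral.
\<close>

theorem L1_truncation:
  fixes \<beta> \<sigma> r T :: real
  assumes \<beta>: "0 < \<beta>" "\<beta> < 1" and \<sigma>: "0 < \<sigma>" "\<sigma> \<le> 1" and r: "1 \<le> r" "2 - \<beta> \<le> r * \<sigma>" and T: "T > 0"
  shows "\<exists>C>0. L1_accurate T r \<beta> \<sigma> C"
proof -
  define p where "p = 2 - \<beta>"
  \<comment> \<open>\<open>Ka\<close> and \<open>Kb\<close> belong to the later cells and the first cell, \<open>Kc\<close> to the case \<open>n = 1\<close>\<close>
  define Ka where "Ka = r\<^sup>2 * 2 powr (r * (2 - \<sigma>)) * T powr \<sigma>"
  define Kb where "Kb = (1 + 1 / \<sigma>) / \<sigma> * T powr \<sigma>"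
  define Kc where "Kc = (1 + 1 / \<sigma>) * Gamma \<sigma> / Gamma (1 - \<beta> + \<sigma>) * T powr \<sigma>"
  define K where "K = Ka + Kb"
  define Cs where "Cs = 2 * 2 powr \<beta> / Gamma (1 - \<beta>)"
  define C where "C = K * Cs + K / Gamma (2 - \<beta>) + Kc"
  have G: "Gamma (1 - \<beta>) > 0" "Gamma (2 - \<beta>) > 0" "Gamma \<sigma> > 0" "Gamma (1 - \<beta> + \<sigma>) > 0"
    using \<beta> \<sigma> by (auto intro!: Gamma_real_pos)
  have K0: "Ka \<ge> 0" "Kb \<ge> 0" "Kc > 0" "K \<ge> 0" "Cs \<ge> 0"
    using \<sigma> T G by (auto simp: Ka_def Kb_def Kc_def K_def Cs_def intro!: mult_pos_pos divide_pos_pos add_pos_pos)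
  show ?thesis
    unfolding L1_accurate_def
  proof (intro exI[of _ C] conjI allI impI)
    show "C > 0" using K0 G by (simp add: C_def add_nonneg_pos)
    fix M :: real and N n :: nat and w w' w'' :: "real \<Rightarrow> real" and v :: real
    assume reg: "graded_regular T \<sigma> M w w' w''" and M: "M \<ge> 0" and n: "1 \<le> n" "n \<le> N"
      and v: "((\<lambda>s. omega (1 - \<beta>) (mesh T r N n - s) * w' s) has_integral v) {0..mesh T r N n}"
    define t where "t = mesh T r N"
    define \<epsilon> where "\<epsilon> = real N powr (- p)"
    have N: "N \<ge> 1" using n by simp
    have tlt: "t j < t k" if "j < k" for j k using mesh_strict_mono[OF T r(1) N that] by (simp add: t_def)
    have tmono: "mono t" using tlt by (intro strict_mono_mono) (simp add: strict_mono_def)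
    have t0: "t 0 = 0" by (simp add: t_def)
    have tpos: "t k > 0" if "k \<ge> 1" for k using tlt[of 0 k] that t0 by simp
    have tT: "t k \<le> T" if "k \<le> n" for k using mesh_le[OF T r(1) N, of k] that n by (simp add: t_def)
    have tsig: "t k powr \<sigma> \<le> T powr \<sigma> * real k powr p * \<epsilon>" if "1 \<le> k" "k \<le> n" for k
      unfolding t_def \<epsilon>_def by (rule mesh_powr_bound) (use T r \<sigma> that n in \<open>auto simp: p_def\<close>)
    have t1sig: "t 1 powr \<sigma> \<le> T powr \<sigma> * \<epsilon>" using tsig[of 1] n by simp
    have \<epsilon>0: "\<epsilon> \<ge> 0" by (simp add: \<epsilon>_def)
    define ker where "ker s = omega (1 - \<beta>) (t n - s)" for s
    define vc where "vc k = integral {t (k - 1)..t k} (\<lambda>s. ker s * w' s)" for k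
    define kc where "kc k = integral {t (k - 1)..t k} ker" for k
    define D where "D k = vc k - 1 / (t k - t (k - 1)) * kc k * (w (t k) - w (t (k - 1)))" for k
    have v': "((\<lambda>s. ker s * w' s) has_integral v) {0..t n}" using v by (simp add: ker_def t_def)
    have cell: "0 \<le> t (k - 1)" "t (k - 1) < t k" "t k \<le> t n" "t k \<le> T" if "k \<in> {1..n}" for k
      using that tlt[of "k - 1" k] monoD[OF tmono, of k n] monoD[OF tmono, of 0 "k - 1"] t0 tT[of k] by auto
    have hvc: "((\<lambda>s. ker s * w' s) has_integral vc k) {t (k - 1)..t k}" if k: "k \<in> {1..n}" for k
      unfolding vc_def
      by (intro integrable_integral integrable_on_subinterval[OF has_integral_integrable[OF v']])
        (use cell[OF k] in auto)
    have hkc: "(ker has_integral kc k) {t (k - 1)..t k}" "kc k = omega (2 - \<beta>) (t n - t (k - 1)) - omega (2 - \<beta>) (t n - t k)"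
      if k: "k \<in> {1..n}" for k
      using omega_kernel_has_integral[OF \<beta>, of "t (k - 1)" "t k" "t n"] cell[OF k]
      unfolding ker_def[abs_def] kc_def by (auto simp: has_integral_iff)
    have hw: "(w' has_integral (w (t k) - w (t (k - 1)))) {t (k - 1)..t k}" if k: "k \<in> {1..n}" for k
      using graded_regular_increment[OF reg, of "t (k - 1)" "t k"] cell[OF k] by simp
    have total: "v - (\<Sum>k=1..n. L1_coeff \<beta> t n k * (w (t k) - w (t (k - 1)))) = (\<Sum>k=1..n. D k)"
    proof -
      have "v = (\<Sum>k=1..n. vc k)"
        using integral_eq_sum_over_cells[OF tmono, of "\<lambda>s. ker s * w' s" n] v' t0
        by (simp add: vc_def has_integral_iff)
      then show ?thesis
        by (simp add: D_def L1_coeff_def kc_def ker_def[abs_def] sum_subtractf)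
    qed
    \<comment> \<open>majorant of the deviation of \<open>w'\<close> from the slope; \<open>h k\<close> is its integral\<close>
    define g where "g k s = (if k = 1 then M * (1 + 1 / \<sigma>) * s powr (\<sigma> - 1)
      else M * t (k - 1) powr (\<sigma> - 2) * (t k - t (k - 1)))" for k and s :: real
    define h where "h k = integral {t (k - 1)..t k} (g k)" for k
    have g: "\<bar>w' s - (w (t k) - w (t (k - 1))) / (t k - t (k - 1))\<bar> \<le> g k s"
      if k: "k \<in> {1..n}" and s: "t (k - 1) < s" "s < t k" for k s
    proof (cases "k = 1")
      case True
      then show ?thesis using slope_deviation_first[OF reg, of "t 1" s] tpos[of 1] cell[OF k] \<sigma> M s t0
        by (simp add: g_def)
    next
      case False
      then have "t (k - 1) > 0" using k by (intro tpos) auto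
      then show ?thesis using slope_deviation[OF reg, of "t (k - 1)" "t k" s] cell[OF k] \<sigma> M s False
        by (simp add: g_def)
    qed
    have h1: "(g 1 has_integral h 1) {t 0..t 1}" "h 1 = M * (1 + 1 / \<sigma>) * (t 1 powr \<sigma> / \<sigma>)"
    proof -
      have "((\<lambda>s. M * (1 + 1 / \<sigma>) * s powr (\<sigma> - 1)) has_integral M * (1 + 1 / \<sigma>) * (t 1 powr \<sigma> / \<sigma>)) {0..t 1}"
        by (intro has_integral_mult_right powr_has_integral_0) (use \<sigma> tpos[of 1] in auto)
      then show "(g 1 has_integral h 1) {t 0..t 1}" "h 1 = M * (1 + 1 / \<sigma>) * (t 1 powr \<sigma> / \<sigma>)"
        by (auto simp: g_def[abs_def] h_def t0 has_integral_iff)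
    qed
    have hk: "(g k has_integral h k) {t (k - 1)..t k}" "h k = M * t (k - 1) powr (\<sigma> - 2) * (t k - t (k - 1))\<^sup>2"
      if k: "k \<in> {1..n}" "k \<noteq> 1" for k
      using has_integral_const_real[of "M * t (k - 1) powr (\<sigma> - 2) * (t k - t (k - 1))" "t (k - 1)" "t k"] cell[OF k(1)] k(2)
      by (auto simp: g_def[abs_def] h_def has_integral_iff power2_eq_square)
    have gh: "(g k has_integral h k) {t (k - 1)..t k}" if "k \<in> {1..n}" for k
      using h1 hk that by (cases "k = 1") auto
    have hbound: "h k \<le> K * M * \<epsilon> * real k powr (- \<beta>)" if k: "k \<in> {1..n}" for k
    proof (cases "k = 1")
      case True
      have "h 1 \<le> M * (1 + 1 / \<sigma>) * (T powr \<sigma> * \<epsilon> / \<sigma>)"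
        unfolding h1 using M \<sigma> t1sig by (intro mult_left_mono divide_right_mono) auto
      also have "\<dots> = Kb * M * \<epsilon>" by (simp add: Kb_def)
      also have "\<dots> \<le> K * M * \<epsilon>" using K0 M \<epsilon>0 by (intro mult_right_mono) (auto simp: K_def)
      finally show ?thesis using True by simp
    next
      case False
      then have k2: "k \<ge> 2" using k by auto
      have "t k / 2 powr r \<le> t (k - 1)"
      proof -
        have half: "1 / 2 \<le> real (k - 1) / real k" using k2 by (simp add: field_simps)
        have "(1 / 2) powr r \<le> (real (k - 1) / real k) powr r"
          by (rule powr_mono2[OF _ _ half]) (use r in auto)
        then have "t k * (1 / 2) powr r \<le> t k * (real (k - 1) / real k) powr r"
          using tpos[of k] k by (intro mult_left_mono) auto
        also have "\<dots> = T * (real k / real N * (real (k - 1) / real k)) powr r"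
          by (subst powr_mult) (simp_all add: t_def mesh_def)
        also have "\<dots> = t (k - 1)" using k by (simp add: t_def mesh_def)
        finally show ?thesis by (simp add: powr_divide)
      qed
      then have "t (k - 1) powr (\<sigma> - 2) \<le> (t k / 2 powr r) powr (\<sigma> - 2)"
        using \<sigma> tpos[of k] k by (intro powr_mono2') auto
      also have "\<dots> = t k powr (\<sigma> - 2) * 2 powr (r * (2 - \<sigma>))"
      proof -
        have "(2 powr r) powr (\<sigma> - 2) = inverse (2 powr (r * (2 - \<sigma>)))"
          by (simp add: powr_powr powr_minus[symmetric] algebra_simps)
        then show ?thesis using tpos[of k] k by (subst powr_divide) (auto simp: divide_inverse)
      qed
      finally have A: "t (k - 1) powr (\<sigma> - 2) \<le> t k powr (\<sigma> - 2) * 2 powr (r * (2 - \<sigma>))" .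
      have "t k - t (k - 1) \<le> r * t k / real k"
        using mesh_step_upper[OF T r(1) N, of k] k by (simp add: t_def)
      then have B: "(t k - t (k - 1))\<^sup>2 \<le> (r * t k / real k)\<^sup>2"
        using cell[OF k] by (intro power_mono) auto
      have "h k \<le> M * (t k powr (\<sigma> - 2) * 2 powr (r * (2 - \<sigma>))) * (r * t k / real k)\<^sup>2"
        unfolding hk(2)[OF k False] using M A B by (intro mult_mono) auto
      also have "\<dots> = M * r\<^sup>2 * 2 powr (r * (2 - \<sigma>)) * (t k powr \<sigma> * (1 / (real k)\<^sup>2))"
      proof -
        have "t k powr \<sigma> = t k powr (\<sigma> - 2) * (t k)\<^sup>2"
          using tpos[of k] k by (simp add: powr_diff)
        then show ?thesis by (simp add: power_divide power_mult_distrib)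
      qed
      also have "\<dots> \<le> M * r\<^sup>2 * 2 powr (r * (2 - \<sigma>)) * ((T powr \<sigma> * real k powr p * \<epsilon>) * (1 / (real k)\<^sup>2))"
        using M r tsig[of k] k by (intro mult_left_mono mult_right_mono) auto
      also have "\<dots> = Ka * M * \<epsilon> * (real k powr p / (real k)\<^sup>2)" by (simp add: Ka_def)
      also have "real k powr p / (real k)\<^sup>2 = real k powr (- \<beta>)"
        using k by (simp add: p_def powr_diff powr_minus divide_inverse)
      also have "Ka * M * \<epsilon> * real k powr (- \<beta>) \<le> K * M * \<epsilon> * real k powr (- \<beta>)"
        using K0 M \<epsilon>0 by (intro mult_right_mono) (auto simp: K_def)
      finally show ?thesis .
    qed
    define osc where "osc k = omega (1 - \<beta>) (t n - t k) - omega (1 - \<beta>) (t n - t (k - 1))" for k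
    have far: "\<bar>D k\<bar> \<le> osc k * (K * M * \<epsilon> * real k powr (- \<beta>))" if k: "k \<in> {1..n-1}" for k
    proof -
      have k': "k \<in> {1..n}" and kn: "t k < t n" using k tlt[of k n] by auto
      have "\<bar>D k\<bar> \<le> osc k * h k"
        unfolding D_def
      proof (rule cell_consistency[OF cell(2)[OF k'] hvc[OF k'] hkc(1)[OF k'] hw[OF k'], where \<kappa> = "\<lambda>_. osc k" and g = "g k"
            and c = "omega (1 - \<beta>) (t n - t (k - 1))"])
        fix s assume s: "t (k - 1) < s" "s < t k"
        show "\<bar>ker s - omega (1 - \<beta>) (t n - t (k - 1))\<bar> \<le> osc k"
          using omega_kernel_mono[OF \<beta>, of "t (k - 1)" s "t n"] omega_kernel_mono[OF \<beta>, of s "t k" "t n"] s kn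
          by (simp add: ker_def osc_def)
      qed (use g[OF k'] has_integral_mult_right[OF gh[OF k'], of "osc k"] in auto)
      also have "\<dots> \<le> osc k * (K * M * \<epsilon> * real k powr (- \<beta>))"
        using omega_kernel_mono[OF \<beta>, of "t (k - 1)" "t k" "t n"] cell(2)[OF k'] kn
        by (intro mult_left_mono hbound[OF k']) (simp add: osc_def)
      finally show ?thesis .
    qed
    have near: "\<bar>D n\<bar> \<le> (K / Gamma (2 - \<beta>) + Kc) * M * \<epsilon> * t n powr (- \<beta>)"
    proof (cases "n = 1")
      case True
      have "\<bar>D 1\<bar> \<le> M * (1 + 1 / \<sigma>) * Gamma \<sigma> * omega (1 - \<beta> + \<sigma>) (t 1)"
        unfolding D_def
      proof (rule cell_consistency[OF cell(2) hvc hkc(1) hw, where \<kappa> = ker and g = "g 1" and c = 0])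
        have "((\<lambda>s. M * (1 + 1 / \<sigma>) * Gamma \<sigma> * (omega (1 - \<beta>) (t 1 - s) * omega \<sigma> s)) has_integral
            M * (1 + 1 / \<sigma>) * Gamma \<sigma> * omega (1 - \<beta> + \<sigma>) (t 1)) {0..t 1}"
          by (intro has_integral_mult_right omega_convolution) (use \<beta> \<sigma> tpos[of 1] in auto)
        moreover have "(\<lambda>s. M * (1 + 1 / \<sigma>) * Gamma \<sigma> * (omega (1 - \<beta>) (t 1 - s) * omega \<sigma> s)) = (\<lambda>s. ker s * g 1 s)"
          using G True by (simp add: fun_eq_iff ker_def g_def omega_def[of \<sigma>])
        ultimately show "((\<lambda>s. ker s * g 1 s) has_integral M * (1 + 1 / \<sigma>) * Gamma \<sigma> * omega (1 - \<beta> + \<sigma>) (t 1)) {t (1 - 1)..t 1}"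
          by (simp add: t0)
        show "\<bar>ker s - 0\<bar> \<le> ker s" for s using omega_nonneg[of "1 - \<beta>"] \<beta> by (simp add: ker_def)
        show "\<bar>w' s - (w (t 1) - w (t (1 - 1))) / (t 1 - t (1 - 1))\<bar> \<le> g 1 s" if "t (1 - 1) < s" "s < t 1" for s
          using g[of 1 s] that True by simp
      qed (use True in auto)
      also have "\<dots> = M * (1 + 1 / \<sigma>) * Gamma \<sigma> / Gamma (1 - \<beta> + \<sigma>) * (t 1 powr \<sigma> * t 1 powr (- \<beta>))"
        by (simp add: omega_def powr_add[symmetric] add.commute)
      also have "\<dots> \<le> M * (1 + 1 / \<sigma>) * Gamma \<sigma> / Gamma (1 - \<beta> + \<sigma>) * ((T powr \<sigma> * \<epsilon>) * t 1 powr (- \<beta>))"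
        using M \<sigma> G t1sig by (intro mult_left_mono mult_right_mono) auto
      also have "\<dots> = Kc * M * \<epsilon> * t 1 powr (- \<beta>)" by (simp add: Kc_def)
      also have "\<dots> \<le> (K / Gamma (2 - \<beta>) + Kc) * M * \<epsilon> * t 1 powr (- \<beta>)"
        using K0 G M \<epsilon>0 by (intro mult_right_mono) auto
      finally show ?thesis using True by simp
    next
      case False
      have nn: "n \<in> {1..n}" using n by simp
      define \<tau> where "\<tau> = t n - t (n - 1)"
      have \<tau>: "\<tau> > 0" using cell[OF nn] by (simp add: \<tau>_def)
      have hn: "h n = M * t (n - 1) powr (\<sigma> - 2) * \<tau>\<^sup>2" using hk(2)[OF nn False] by (simp add: \<tau>_def)
      have "\<bar>D n\<bar> \<le> kc n * (M * t (n - 1) powr (\<sigma> - 2) * \<tau>)"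
        unfolding D_def
      proof (rule cell_consistency[OF cell(2)[OF nn] hvc[OF nn] hkc(1)[OF nn] hw[OF nn], where \<kappa> = ker and g = "g n" and c = 0])
        show "((\<lambda>s. ker s * g n s) has_integral kc n * (M * t (n - 1) powr (\<sigma> - 2) * \<tau>)) {t (n - 1)..t n}"
          using has_integral_mult_left[OF hkc(1)[OF nn], of "M * t (n - 1) powr (\<sigma> - 2) * \<tau>"] False
          by (simp add: g_def \<tau>_def)
        show "\<bar>ker s - 0\<bar> \<le> ker s" for s using omega_nonneg[of "1 - \<beta>"] \<beta> by (simp add: ker_def)
      qed (use g[OF nn] in auto)
      also have "kc n = \<tau> powr (1 - \<beta>) / Gamma (2 - \<beta>)"
        using hkc(2)[OF nn] by (simp add: \<tau>_def omega_def)
      also have "\<dots> * (M * t (n - 1) powr (\<sigma> - 2) * \<tau>) = h n * \<tau> powr (- \<beta>) / Gamma (2 - \<beta>)"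
      proof -
        have "\<tau> powr (1 - \<beta>) = \<tau> * \<tau> powr (- \<beta>)" using \<tau> by (simp add: powr_diff powr_minus divide_inverse)
        then show ?thesis by (simp add: hn power2_eq_square)
      qed
      also have "\<dots> \<le> (K * M * \<epsilon> * real n powr (- \<beta>)) * \<tau> powr (- \<beta>) / Gamma (2 - \<beta>)"
        using hbound[OF nn] G by (intro divide_right_mono mult_right_mono) auto
      also have "\<dots> = K * M * \<epsilon> / Gamma (2 - \<beta>) * (real n * \<tau>) powr (- \<beta>)"
        using \<tau> by (simp add: powr_mult)
      also have "\<dots> \<le> K * M * \<epsilon> / Gamma (2 - \<beta>) * t n powr (- \<beta>)"
      proof (intro mult_left_mono powr_mono2')
        show "t n \<le> real n * \<tau>"
          using mesh_step_lower[OF T r(1) N n(1)] n by (simp add: t_def \<tau>_def field_simps)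
      qed (use \<beta> tpos[of n] n K0 M \<epsilon>0 G in auto)
      also have "\<dots> = K / Gamma (2 - \<beta>) * M * \<epsilon> * t n powr (- \<beta>)" by simp
      also have "\<dots> \<le> (K / Gamma (2 - \<beta>) + Kc) * M * \<epsilon> * t n powr (- \<beta>)"
        using K0 G M \<epsilon>0 by (intro mult_right_mono) auto
      finally show ?thesis .
    qed
    have "\<bar>\<Sum>k=1..n. D k\<bar> \<le> (\<Sum>k=1..n-1. \<bar>D k\<bar>) + \<bar>D n\<bar>"
    proof -
      have "(\<Sum>k=1..n. D k) = (\<Sum>k=1..n-1. D k) + D n" using n by (cases n) auto
      then show ?thesis using sum_abs[of D "{1..n-1}"] by linarith
    qed
    also have "(\<Sum>k=1..n-1. \<bar>D k\<bar>) \<le> (\<Sum>k=1..n-1. osc k * (K * M * \<epsilon> * real k powr (- \<beta>)))"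
      by (intro sum_mono far)
    also have "\<dots> = K * M * \<epsilon> * (\<Sum>k=1..n-1. osc k * real k powr (- \<beta>))"
      by (simp add: sum_distrib_left mult_ac)
    also have "\<dots> \<le> K * M * \<epsilon> * (Cs * t n powr (- \<beta>))"
      using kernel_oscillation_sum[OF \<beta> T r(1) n] K0 M \<epsilon>0
      by (intro mult_left_mono) (auto simp: osc_def t_def Cs_def)
    finally have "\<bar>\<Sum>k=1..n. D k\<bar> \<le> K * M * \<epsilon> * (Cs * t n powr (- \<beta>)) + (K / Gamma (2 - \<beta>) + Kc) * M * \<epsilon> * t n powr (- \<beta>)"
      using near by linarith
    also have "\<dots> = C * M * \<epsilon> * t n powr (- \<beta>)" by (simp add: C_def algebra_simps)
    finally show "\<bar>v - (\<Sum>k=1..n. L1_coeff \<beta> (mesh T r N) n k * (w (mesh T r N k) - w (mesh T r N (k - 1))))\<bar>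
      \<le> C * M * real N powr (- (2 - \<beta>)) * mesh T r N n powr (- \<beta>)"
      using total by (simp add: t_def \<epsilon>_def p_def)
  qed
qed

section \<open>Mittag-Leffler modes\<close>

text \<open>
The function \<open>t powr (\<nu> - 1) E\<^sub>\<alpha>\<^sub>,\<^sub>\<nu>(-\<lambda> t\<^sup>\<alpha>)\<close>. In this normalisation differentiation lowers \<open>\<nu>\<close> by one
(\<open>ml_mode_derivative\<close>) and fractional integration of order \<open>\<mu>\<close> raises it by \<open>\<mu>\<close> (\<open>ml_mode_convolution\<close>).
\<close>

definition ml_mode :: "real \<Rightarrow> real \<Rightarrow> real \<Rightarrow> real \<Rightarrow> real" where
  "ml_mode \<alpha> lam \<nu> t = t powr (\<nu> - 1) * mittag_leffler \<alpha> \<nu> (- lam * t powr \<alpha>)"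

lemma rGamma_shift: "(x - 1) * rGamma x = rGamma (x - 1 :: real)"
  using rGamma_plus1[of "x - 1"] by simp

lemma mittag_leffler_recursion:
  assumes "\<alpha> > 0"
  shows "mittag_leffler \<alpha> \<nu> y = rGamma \<nu> + y * mittag_leffler \<alpha> (\<nu> + \<alpha>) y"
proof -
  have "(\<lambda>k. rGamma (\<alpha> * real k + \<nu>) * y ^ k) sums mittag_leffler \<alpha> \<nu> y"
    using mittag_leffler_sums[OF assms] .
  moreover have "(\<lambda>k. rGamma (\<alpha> * real k + \<nu>) * y ^ k) sums (y * mittag_leffler \<alpha> (\<nu> + \<alpha>) y + rGamma (\<alpha> * real 0 + \<nu>) * y ^ 0)"
  proof (rule sums_Suc)
    have "(\<lambda>k. y * (rGamma (\<alpha> * real k + (\<nu> + \<alpha>)) * y ^ k)) sums (y * mittag_leffler \<alpha> (\<nu> + \<alpha>) y)"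
      by (intro sums_mult mittag_leffler_sums assms)
    then show "(\<lambda>k. rGamma (\<alpha> * real (Suc k) + \<nu>) * y ^ Suc k) sums (y * mittag_leffler \<alpha> (\<nu> + \<alpha>) y)"
      by (simp add: algebra_simps)
  qed
  ultimately show ?thesis using sums_unique2 by fastforce
qed

text \<open>
The second property is the functional equation \<open>(x - 1) / \<Gamma>(x) = 1 / \<Gamma>(x - 1)\<close>, applied term by
term to the series.
\<close>

lemma mittag_leffler_has_derivative:
  assumes "\<alpha> > 0"
  obtains D where "\<And>y. (mittag_leffler \<alpha> \<nu> has_real_derivative D y) (at y)"
    "\<And>y. (\<nu> - 1) * mittag_leffler \<alpha> \<nu> y + \<alpha> * y * D y = mittag_leffler \<alpha> (\<nu> - 1) y"
proof -
  define c where "c k = rGamma (\<alpha> * real k + \<nu>)" for k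
  have sm: "summable (\<lambda>k. c k * y ^ k)" for y
    using mittag_leffler_sums[OF assms, of \<nu> y] by (auto simp: c_def sums_iff)
  have E: "mittag_leffler \<alpha> \<nu> = (\<lambda>y. \<Sum>k. c k * y ^ k)"
    using mittag_leffler_sums[OF assms, of \<nu>] by (auto simp: c_def sums_iff)
  define D where "D y = (\<Sum>k. diffs c k * y ^ k)" for y
  have der: "(mittag_leffler \<alpha> \<nu> has_real_derivative D y) (at y)" for y
    unfolding E D_def by (rule termdiffs_strong_converges_everywhere) (rule sm)
  have D_sums: "(\<lambda>k. real k * c k * y ^ k) sums (y * D y)" for y
  proof -
    have "(\<lambda>k. diffs c k * y ^ k) sums D y"
      unfolding D_def by (rule summable_sums) (rule termdiff_converges_all, rule sm)
    then have "(\<lambda>k. y * (diffs c k * y ^ k)) sums (y * D y)" by (rule sums_mult)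
    then have "(\<lambda>k. real (Suc k) * c (Suc k) * y ^ Suc k) sums (y * D y)"
      by (simp add: diffs_def mult_ac)
    from sums_Suc[OF this] show ?thesis by simp
  qed
  have "(\<nu> - 1) * mittag_leffler \<alpha> \<nu> y + \<alpha> * (y * D y) = mittag_leffler \<alpha> (\<nu> - 1) y" for y
  proof -
    have "(\<lambda>k. (\<nu> - 1) * (c k * y ^ k) + \<alpha> * (real k * c k * y ^ k)) sums
        ((\<nu> - 1) * mittag_leffler \<alpha> \<nu> y + \<alpha> * (y * D y))"
      by (intro sums_add sums_mult D_sums) (use mittag_leffler_sums[OF assms, of \<nu> y] in \<open>simp add: c_def\<close>)
    moreover have "(\<nu> - 1) * (c k * y ^ k) + \<alpha> * (real k * c k * y ^ k) = rGamma (\<alpha> * real k + (\<nu> - 1)) * y ^ k" for k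
    proof -
      have "(\<nu> - 1) * (c k * y ^ k) + \<alpha> * (real k * c k * y ^ k) = ((\<alpha> * real k + \<nu> - 1) * rGamma (\<alpha> * real k + \<nu>)) * y ^ k"
        by (simp add: c_def algebra_simps)
      then show ?thesis unfolding rGamma_shift by (simp add: algebra_simps)
    qed
    ultimately have "(\<lambda>k. rGamma (\<alpha> * real k + (\<nu> - 1)) * y ^ k) sums
        ((\<nu> - 1) * mittag_leffler \<alpha> \<nu> y + \<alpha> * (y * D y))" by simp
    then show ?thesis using mittag_leffler_sums[OF assms, of "\<nu> - 1" y] sums_unique2 by blast
  qed
  then show ?thesis using that[of D] der by (simp add: mult.assoc)
qed

lemma continuous_mittag_leffler:
  assumes "\<alpha> > 0"
  shows "continuous_on S (mittag_leffler \<alpha> \<nu>)"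
  by (rule mittag_leffler_has_derivative[OF assms, of \<nu>])
    (blast intro: continuous_at_imp_continuous_on DERIV_isCont)

lemma ml_mode_derivative:
  assumes "\<alpha> > 0" "t > 0"
  shows "(ml_mode \<alpha> lam \<nu> has_real_derivative ml_mode \<alpha> lam (\<nu> - 1) t) (at t)"
proof -
  obtain D where D: "\<And>y. (mittag_leffler \<alpha> \<nu> has_real_derivative D y) (at y)"
    "\<And>y. (\<nu> - 1) * mittag_leffler \<alpha> \<nu> y + \<alpha> * y * D y = mittag_leffler \<alpha> (\<nu> - 1) y"
    using mittag_leffler_has_derivative[OF assms(1)] by metis
  define y where "y = - lam * t powr \<alpha>"
  have p1: "((\<lambda>t. t powr (\<nu> - 1)) has_real_derivative (\<nu> - 1) * t powr (\<nu> - 1 - 1)) (at t)"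
    by (rule has_real_derivative_powr[OF assms(2)])
  have "((\<lambda>t. - lam * t powr \<alpha>) has_real_derivative - lam * (\<alpha> * t powr (\<alpha> - 1))) (at t)"
    by (intro DERIV_cmult has_real_derivative_powr assms(2))
  from DERIV_chain2[OF D(1) this]
  have p2: "((\<lambda>t. mittag_leffler \<alpha> \<nu> (- lam * t powr \<alpha>)) has_real_derivative D y * (- lam * (\<alpha> * t powr (\<alpha> - 1)))) (at t)"
    by (simp add: y_def)
  have "t powr (\<alpha> - 1) = t powr \<alpha> / t" using assms by (simp add: powr_diff)
  then have e: "- lam * (\<alpha> * t powr (\<alpha> - 1)) = \<alpha> * y / t" by (simp add: y_def)
  have "t powr 1 = t" using assms by simp
  then have t1: "t powr (\<nu> - 1 - 1) = t powr (\<nu> - 1) / t" by (simp only: powr_diff[of t "\<nu> - 1" 1])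
  have "(ml_mode \<alpha> lam \<nu> has_real_derivative
     (\<nu> - 1) * t powr (\<nu> - 1 - 1) * mittag_leffler \<alpha> \<nu> y + D y * (\<alpha> * y / t) * t powr (\<nu> - 1)) (at t)"
    unfolding ml_mode_def[abs_def] using DERIV_mult[OF p1 p2] unfolding e by (simp add: y_def)
  moreover have "(\<nu> - 1) * t powr (\<nu> - 1 - 1) * mittag_leffler \<alpha> \<nu> y + D y * (\<alpha> * y / t) * t powr (\<nu> - 1)
     = t powr (\<nu> - 1 - 1) * ((\<nu> - 1) * mittag_leffler \<alpha> \<nu> y + \<alpha> * y * D y)"
    unfolding t1 by (simp add: algebra_simps add_divide_distrib diff_divide_distrib)
  ultimately show ?thesis unfolding D(2) by (simp add: ml_mode_def y_def)
qed

text \<open>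
Splitting off the first term of the series. For \<open>\<nu> = 0\<close> and \<open>\<nu> = -1\<close> that term vanishes, because
\<open>1/\<Gamma>\<close> does; this is why the derivatives of the mode with datum \<open>a\<close> carry a factor \<open>\<lambda>\<close>.
\<close>

lemma ml_mode_recursion:
  assumes "\<alpha> > 0" "t > 0" "\<nu> > 0"
  shows "ml_mode \<alpha> lam \<nu> t = omega \<nu> t - lam * ml_mode \<alpha> lam (\<nu> + \<alpha>) t"
    and "ml_mode \<alpha> lam 0 t = - lam * ml_mode \<alpha> lam \<alpha> t"
    and "ml_mode \<alpha> lam (- 1) t = - lam * ml_mode \<alpha> lam (\<alpha> - 1) t"
proof -
  have p: "t powr (\<nu> + \<alpha> - 1) = t powr (\<nu> - 1) * t powr \<alpha>" for \<nu>
    by (simp add: powr_add[symmetric] algebra_simps)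
  have gen: "ml_mode \<alpha> lam \<nu> t = rGamma \<nu> * t powr (\<nu> - 1) - lam * ml_mode \<alpha> lam (\<nu> + \<alpha>) t" for \<nu>
    unfolding ml_mode_def p mittag_leffler_recursion[OF assms(1), of \<nu>] by (simp add: algebra_simps)
  show "ml_mode \<alpha> lam \<nu> t = omega \<nu> t - lam * ml_mode \<alpha> lam (\<nu> + \<alpha>) t"
    using gen[of \<nu>] by (simp add: omega_def rGamma_inverse_Gamma divide_inverse mult.commute)
  show "ml_mode \<alpha> lam 0 t = - lam * ml_mode \<alpha> lam \<alpha> t" using gen[of 0] by simp
  have "rGamma (-1 :: real) = 0" using rGamma_of_int[of "-1", where 'a = real] by simp
  then show "ml_mode \<alpha> lam (- 1) t = - lam * ml_mode \<alpha> lam (\<alpha> - 1) t" using gen[of "-1"] by simp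
qed

text \<open>
Term by term this is \<open>omega_convolution\<close>; the partial sums are dominated by a multiple of
\<open>\<omega>\<^sub>\<mu>(t - s) \<omega>\<^sub>\<nu>(s)\<close>, so that integration and summation may be interchanged.
\<close>

lemma ml_mode_convolution:
  assumes "\<alpha> > 0" "\<mu> > 0" "\<nu> > 0" "t > 0"
  shows "((\<lambda>s. omega \<mu> (t - s) * ml_mode \<alpha> lam \<nu> s) has_integral ml_mode \<alpha> lam (\<mu> + \<nu>) t) {0..t}"
proof (rule has_integral_dominated_convergence)
  define f where "f K s = (\<Sum>k<K. (- lam) ^ k * (omega \<mu> (t - s) * omega (\<alpha> * real k + \<nu>) s))" for K :: nat and s
  define I where "I K = (\<Sum>k<K. (- lam) ^ k * omega (\<mu> + (\<alpha> * real k + \<nu>)) t)" for K :: nat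
  have pos: "\<alpha> * real k + \<nu> > 0" for k using assms by (simp add: add_nonneg_pos)
  show "(f K has_integral I K) {0..t}" for K
    unfolding f_def[abs_def] I_def
    by (intro has_integral_sum has_integral_mult_right omega_convolution) (use assms pos in auto)
  have powr_k: "s powr (\<alpha> * real k + \<nu>' - 1) = s powr (\<nu>' - 1) * (s powr \<alpha>) ^ k" if "s > 0" for s \<nu>' k
  proof -
    have "(s powr \<alpha>) ^ k = s powr (\<alpha> * real k)" using that by (simp add: powr_powr[symmetric] powr_realpow)
    then show ?thesis by (simp add: powr_add[symmetric] algebra_simps)
  qed
  have om: "(- lam) ^ k * omega (\<alpha> * real k + \<nu>') s = s powr (\<nu>' - 1) * (rGamma (\<alpha> * real k + \<nu>') * (- lam * s powr \<alpha>) ^ k)"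
    if "s > 0" for s \<nu>' k
    unfolding omega_def powr_k[OF that] power_mult_distrib
    by (simp add: rGamma_inverse_Gamma divide_inverse mult_ac)
  define B where "B = (\<Sum>k. \<bar>rGamma (\<alpha> * real k + \<nu>)\<bar> * \<bar>lam * t powr \<alpha>\<bar> ^ k)"
  define h where "h s = B * Gamma \<nu> * (omega \<mu> (t - s) * omega \<nu> s)" for s
  show "h integrable_on {0..t}"
    unfolding h_def[abs_def]
    using has_integral_mult_right[OF omega_convolution[OF assms(2,3,4)], of "B * Gamma \<nu>"] by blast
  have sm: "summable (\<lambda>k. \<bar>rGamma (\<alpha> * real k + \<nu>)\<bar> * \<bar>lam * t powr \<alpha>\<bar> ^ k)"
    by (rule mittag_leffler_coeff_summable[OF assms(1)])
  show "\<forall>s\<in>{0..t}. norm (f K s) \<le> h s" for K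
  proof
    fix s assume s: "s \<in> {0..t}"
    show "norm (f K s) \<le> h s"
    proof (cases "s = 0")
      case True then show ?thesis by (simp add: f_def h_def omega_def)
    next
      case False
      then have s0: "s > 0" using s by simp
      have eq: "f K s = omega \<mu> (t - s) * s powr (\<nu> - 1) * (\<Sum>k<K. rGamma (\<alpha> * real k + \<nu>) * (- lam * s powr \<alpha>) ^ k)"
      proof -
        have "f K s = (\<Sum>k<K. omega \<mu> (t - s) * ((- lam) ^ k * omega (\<alpha> * real k + \<nu>) s))"
          by (simp add: f_def mult_ac)
        then show ?thesis unfolding om[OF s0] by (simp add: sum_distrib_left mult_ac)
      qed
      have "\<bar>\<Sum>k<K. rGamma (\<alpha> * real k + \<nu>) * (- lam * s powr \<alpha>) ^ k\<bar> \<le> (\<Sum>k<K. \<bar>rGamma (\<alpha> * real k + \<nu>)\<bar> * \<bar>lam * t powr \<alpha>\<bar> ^ k)"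
      proof (rule order_trans[OF sum_abs sum_mono])
        fix k
        have "\<bar>- lam * s powr \<alpha>\<bar> \<le> \<bar>lam * t powr \<alpha>\<bar>"
          using s assms by (auto simp: abs_mult intro!: mult_left_mono powr_mono2)
        then show "\<bar>rGamma (\<alpha> * real k + \<nu>) * (- lam * s powr \<alpha>) ^ k\<bar> \<le> \<bar>rGamma (\<alpha> * real k + \<nu>)\<bar> * \<bar>lam * t powr \<alpha>\<bar> ^ k"
          unfolding abs_mult[of "rGamma _"] power_abs by (intro mult_left_mono power_mono) auto
      qed
      also have "\<dots> \<le> B" unfolding B_def by (rule sum_le_suminf[OF sm]) auto
      finally have bd: "\<bar>\<Sum>k<K. rGamma (\<alpha> * real k + \<nu>) * (- lam * s powr \<alpha>) ^ k\<bar> \<le> B" .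
      have "norm (f K s) \<le> omega \<mu> (t - s) * s powr (\<nu> - 1) * B"
        unfolding eq real_norm_def abs_mult[of "_ * _"]
        using bd omega_nonneg[of \<mu> "t - s"] assms by (intro mult_mono) auto
      also have "\<dots> = h s"
        using Gamma_real_pos[OF assms(3)] by (simp add: h_def omega_def[of \<nu>])
      finally show ?thesis .
    qed
  qed
  show "\<forall>s\<in>{0..t}. (\<lambda>K. f K s) \<longlonglongrightarrow> omega \<mu> (t - s) * ml_mode \<alpha> lam \<nu> s"
  proof
    fix s assume s: "s \<in> {0..t}"
    show "(\<lambda>K. f K s) \<longlonglongrightarrow> omega \<mu> (t - s) * ml_mode \<alpha> lam \<nu> s"
    proof (cases "s = 0")
      case True then show ?thesis by (simp add: f_def ml_mode_def omega_def)
    next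
      case False
      then have s0: "s > 0" using s by simp
      have eq: "f K s = omega \<mu> (t - s) * (s powr (\<nu> - 1) * (\<Sum>k<K. rGamma (\<alpha> * real k + \<nu>) * (- lam * s powr \<alpha>) ^ k))" for K
      proof -
        have "f K s = (\<Sum>k<K. omega \<mu> (t - s) * ((- lam) ^ k * omega (\<alpha> * real k + \<nu>) s))"
          by (simp add: f_def mult_ac)
        then show ?thesis unfolding om[OF s0] by (simp add: sum_distrib_left mult_ac)
      qed
      show ?thesis unfolding eq ml_mode_def
        using mittag_leffler_sums[OF assms(1), of \<nu> "- lam * s powr \<alpha>"]
        by (intro tendsto_intros) (simp add: sums_def)
    qed
  qed
  show "I \<longlonglongrightarrow> ml_mode \<alpha> lam (\<mu> + \<nu>) t"
  proof -
    have eq: "I K = t powr (\<mu> + \<nu> - 1) * (\<Sum>k<K. rGamma (\<alpha> * real k + (\<mu> + \<nu>)) * (- lam * t powr \<alpha>) ^ k)" for K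
    proof -
      have "I K = (\<Sum>k<K. (- lam) ^ k * omega (\<alpha> * real k + (\<mu> + \<nu>)) t)" by (simp add: I_def algebra_simps)
      then show ?thesis unfolding om[OF assms(4)] by (simp add: sum_distrib_left)
    qed
    show ?thesis unfolding eq[abs_def] ml_mode_def
      using mittag_leffler_sums[OF assms(1), of "\<mu> + \<nu>" "- lam * t powr \<alpha>"]
      by (intro tendsto_intros) (simp add: sums_def)
  qed
qed

text \<open>
With \<open>y = \<lambda> t\<^sup>\<alpha>\<close> the decay \<open>C / (1 + y)\<close> absorbs a factor \<open>1\<close>, \<open>y\<close> or \<open>sqrt y\<close>. The last two trade powers of
\<open>\<lambda>\<close> for negative powers of \<open>t\<close>.
\<close>

lemma ml_mode_bound:
  assumes "1 < \<alpha>" "\<alpha> < 2"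
  shows "\<exists>C>0. \<forall>lam t. lam > 0 \<longrightarrow> t > 0 \<longrightarrow>
     \<bar>ml_mode \<alpha> lam \<nu> t\<bar> \<le> C * t powr (\<nu> - 1) \<and>
     lam * \<bar>ml_mode \<alpha> lam \<nu> t\<bar> \<le> C * t powr (\<nu> - 1 - \<alpha>) \<and>
     sqrt lam * \<bar>ml_mode \<alpha> lam \<nu> t\<bar> \<le> C * t powr (\<nu> - 1 - \<alpha> / 2)"
proof -
  obtain C where C: "C > 0" "\<And>y. y \<ge> 0 \<Longrightarrow> \<bar>mittag_leffler \<alpha> \<nu> (- y)\<bar> \<le> C / (1 + y)"
    using mittag_leffler_bound[OF assms] by metis
  show ?thesis
  proof (intro exI[of _ C] conjI allI impI C(1))
    fix lam t :: real assume p: "lam > 0" "t > 0"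
    define y where "y = lam * t powr \<alpha>"
    define E where "E = \<bar>mittag_leffler \<alpha> \<nu> (- y)\<bar>"
    have y: "y > 0" using p by (simp add: y_def)
    have E: "E \<le> C / (1 + y)" using C(2)[of y] y by (simp add: E_def)
    have m: "\<bar>ml_mode \<alpha> lam \<nu> t\<bar> = t powr (\<nu> - 1) * E" by (simp add: ml_mode_def E_def y_def abs_mult)
    have "C / (1 + y) \<le> C" using y C(1) by (simp add: field_simps)
    then have b1: "E \<le> C" using E by linarith
    have b2: "y * E \<le> C"
    proof -
      have "y * E \<le> y * (C / (1 + y))" using E y by (intro mult_left_mono) auto
      also have "\<dots> \<le> C" using y C(1) by (simp add: field_simps)
      finally show ?thesis .
    qed
    have b3: "sqrt y * E \<le> C"
    proof -
      have "sqrt y \<le> 1 + y"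
        using y arith_geo_mean_sqrt[of 1 y] by simp
      then have "C * sqrt y \<le> C * (1 + y)" using C(1) by simp
      then have "sqrt y * (C / (1 + y)) \<le> C" using y by (simp add: field_simps)
      moreover have "sqrt y * E \<le> sqrt y * (C / (1 + y))" using E y by (intro mult_left_mono) auto
      ultimately show ?thesis by linarith
    qed
    show "\<bar>ml_mode \<alpha> lam \<nu> t\<bar> \<le> C * t powr (\<nu> - 1)"
      unfolding m using mult_left_mono[OF b1, of "t powr (\<nu> - 1)"] by (simp add: mult.commute)
    have l: "lam = y * t powr (- \<alpha>)" using p by (simp add: y_def powr_minus field_simps)
    have "t powr (\<nu> - 1 - \<alpha>) = t powr (\<nu> - 1) * t powr (- \<alpha>)" by (simp add: powr_add[symmetric])
    then have "lam * \<bar>ml_mode \<alpha> lam \<nu> t\<bar> = t powr (\<nu> - 1 - \<alpha>) * (y * E)"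
      unfolding m by (subst l) (simp add: mult_ac)
    also have "\<dots> \<le> t powr (\<nu> - 1 - \<alpha>) * C" by (intro mult_left_mono b2) auto
    finally show "lam * \<bar>ml_mode \<alpha> lam \<nu> t\<bar> \<le> C * t powr (\<nu> - 1 - \<alpha>)" by (simp add: mult.commute)
    have "sqrt (t powr (- \<alpha>)) = t powr (- \<alpha> / 2)" using p by (simp add: powr_half_sqrt[symmetric] powr_powr)
    then have l2: "sqrt lam = sqrt y * t powr (- \<alpha> / 2)" by (subst l) (simp add: real_sqrt_mult)
    have "t powr (\<nu> - 1 - \<alpha> / 2) = t powr (\<nu> - 1) * t powr (- \<alpha> / 2)" by (simp add: powr_add[symmetric])
    then have "sqrt lam * \<bar>ml_mode \<alpha> lam \<nu> t\<bar> = t powr (\<nu> - 1 - \<alpha> / 2) * (sqrt y * E)"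
      unfolding m l2 by (simp add: mult_ac)
    also have "\<dots> \<le> t powr (\<nu> - 1 - \<alpha> / 2) * C" by (intro mult_left_mono b3) auto
    finally show "sqrt lam * \<bar>ml_mode \<alpha> lam \<nu> t\<bar> \<le> C * t powr (\<nu> - 1 - \<alpha> / 2)" by (simp add: mult.commute)
  qed
qed

section \<open>Error of the scalar schemes\<close>

text \<open>
One Fourier mode of either scheme: \<open>F\<close> is the right-hand side of the first equation and \<open>G\<close> the
quantity subtracted in the definition of the second unknown.
\<close>

definition mode_scheme ::
  "real \<Rightarrow> real \<Rightarrow> (nat \<Rightarrow> real) \<Rightarrow> nat \<Rightarrow> (nat \<Rightarrow> real) \<Rightarrow> (nat \<Rightarrow> real) \<Rightarrow> (nat \<Rightarrow> real) \<Rightarrow> (nat \<Rightarrow> real) \<Rightarrow> bool" where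
  "mode_scheme \<beta> lam t N F G U V \<longleftrightarrow> (\<forall>n\<in>{1..N}.
     (\<Sum>k=1..n. L1_coeff \<beta> t n k * (V k - V (k - 1))) + lam * U n = F n \<and>
     V n + G n = (\<Sum>k=1..n. L1_coeff \<beta> t n k * (U k - U (k - 1))))"

text \<open>
Multiplying the error \<open>u - U\<close> by \<open>sqrt \<lambda>\<close> makes the system skew-symmetric, so that
\<open>W = (v - V) + \<i> sqrt \<lambda> (u - U)\<close> satisfies a scalar equation with an imaginary coefficient. The
truncation error of \<open>v\<close> may be larger than that of \<open>u\<close> by a factor \<open>sqrt \<lambda>\<close>, because only \<open>u - U\<close> is
estimated.
\<close>

theorem L1_system_error:
  fixes u v du dv U V F G :: "nat \<Rightarrow> real" and \<beta> lam \<rho> :: real and t :: "nat \<Rightarrow> real"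
  defines "A \<equiv> L1_coeff \<beta> t"
  assumes \<beta>: "0 < \<beta>" "\<beta> < 1" and t: "strict_mono t" "t 0 = 0" and lam: "lam > 0" and "\<rho> \<ge> 0"
    and init: "u 0 = U 0" "v 0 = V 0"
    and exact: "\<And>n. 1 \<le> n \<Longrightarrow> n \<le> N \<Longrightarrow> dv n + lam * u n = F n"
      "\<And>n. 1 \<le> n \<Longrightarrow> n \<le> N \<Longrightarrow> v n + G n = du n"
    and mode_scheme: "mode_scheme \<beta> lam t N F G U V"
    and trunc: "\<And>n. 1 \<le> n \<Longrightarrow> n \<le> N \<Longrightarrow> \<bar>dv n - (\<Sum>k=1..n. A n k * (v k - v (k - 1)))\<bar> \<le> sqrt lam * \<rho> * t n powr (- \<beta>)"
      "\<And>n. 1 \<le> n \<Longrightarrow> n \<le> N \<Longrightarrow> \<bar>du n - (\<Sum>k=1..n. A n k * (u k - u (k - 1)))\<bar> \<le> \<rho> * t n powr (- \<beta>)"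
    and n: "n \<le> N"
  shows "\<bar>u n - U n\<bar> \<le> 2 * Gamma (1 - \<beta>) * \<rho>"
proof -
  have scheme: "(\<Sum>k=1..n. A n k * (V k - V (k - 1))) + lam * U n = F n"
    "V n + G n = (\<Sum>k=1..n. A n k * (U k - U (k - 1)))" if "1 \<le> n" "n \<le> N" for n
    using mode_scheme that unfolding mode_scheme_def A_def by auto
  define W where "W n = Complex (v n - V n) (sqrt lam * (u n - U n))" for n
  define r1 where "r1 n = dv n - (\<Sum>k=1..n. A n k * (v k - v (k - 1)))" for n
  define r2 where "r2 n = du n - (\<Sum>k=1..n. A n k * (u k - u (k - 1)))" for n
  define F' where "F' n = - Complex (r1 n) (sqrt lam * r2 n)" for n
  define S where "S = 2 * Gamma (1 - \<beta>) * \<rho> * sqrt lam"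
  have G: "Gamma (1 - \<beta>) > 0" using \<beta> by (intro Gamma_real_pos) auto
  have sq: "sqrt lam * sqrt lam = lam" using lam by simp
  have "norm (W n) \<le> S"
  proof (rule L1_stability[OF \<beta> t(1), where F = F' and \<mu> = "sqrt lam" and N = N])
    show "S \<ge> 0" using G lam \<open>\<rho> \<ge> 0\<close> by (simp add: S_def)
    show "W 0 = 0" using init by (simp add: W_def complex_eq_iff)
    fix n assume n: "1 \<le> n" "n \<le> N"
    have Sv: "(\<Sum>k=1..n. A n k * ((v k - V k) - (v (k - 1) - V (k - 1)))) = - lam * (u n - U n) - r1 n"
    proof -
      have "(\<Sum>k=1..n. A n k * ((v k - V k) - (v (k - 1) - V (k - 1))))
        = (\<Sum>k=1..n. A n k * (v k - v (k - 1))) - (\<Sum>k=1..n. A n k * (V k - V (k - 1)))"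
        by (simp add: sum_subtractf[symmetric] algebra_simps)
      then show ?thesis using exact(1)[OF n] scheme(1)[OF n] by (simp add: r1_def algebra_simps)
    qed
    have Su: "(\<Sum>k=1..n. A n k * ((u k - U k) - (u (k - 1) - U (k - 1)))) = (v n - V n) - r2 n"
    proof -
      have "(\<Sum>k=1..n. A n k * ((u k - U k) - (u (k - 1) - U (k - 1))))
        = (\<Sum>k=1..n. A n k * (u k - u (k - 1))) - (\<Sum>k=1..n. A n k * (U k - U (k - 1)))"
        by (simp add: sum_subtractf[symmetric] algebra_simps)
      then show ?thesis using exact(2)[OF n] scheme(2)[OF n] by (simp add: r2_def algebra_simps)
    qed
    show "(\<Sum>k=1..n. of_real (L1_coeff \<beta> t n k) * (W k - W (k - 1))) = \<i> * of_real (sqrt lam) * W n + F' n"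
    proof (rule complex_eqI)
      show "Re (\<Sum>k=1..n. of_real (L1_coeff \<beta> t n k) * (W k - W (k - 1))) = Re (\<i> * of_real (sqrt lam) * W n + F' n)"
        using Sv sq by (simp add: W_def F'_def A_def)
      have "(\<Sum>k=1..n. A n k * (sqrt lam * (u k - U k) - sqrt lam * (u (k - 1) - U (k - 1))))
        = sqrt lam * (\<Sum>k=1..n. A n k * ((u k - U k) - (u (k - 1) - U (k - 1))))"
        by (simp add: sum_distrib_left algebra_simps)
      then show "Im (\<Sum>k=1..n. of_real (L1_coeff \<beta> t n k) * (W k - W (k - 1))) = Im (\<i> * of_real (sqrt lam) * W n + F' n)"
        unfolding Su by (simp add: W_def F'_def A_def right_diff_distrib)
    qed
    have "norm (F' n) \<le> \<bar>r1 n\<bar> + \<bar>sqrt lam * r2 n\<bar>"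
      unfolding F'_def norm_minus_cancel using cmod_le[of "Complex (r1 n) (sqrt lam * r2 n)"] by simp
    also have "\<dots> \<le> sqrt lam * \<rho> * t n powr (- \<beta>) + sqrt lam * (\<rho> * t n powr (- \<beta>))"
      using trunc(1)[OF n] mult_left_mono[OF trunc(2)[OF n], of "sqrt lam"] lam
      by (intro add_mono) (simp_all add: r1_def r2_def abs_mult)
    also have "\<dots> = S * omega (1 - \<beta>) (t n - t (1 - 1))" using G t(2) by (simp add: S_def omega_def)
    also have "\<dots> \<le> S * L1_coeff \<beta> t n 1"
      using L1_coeff_lower[OF \<beta> t(1) order_refl n(1)] G lam \<open>\<rho> \<ge> 0\<close> by (intro mult_left_mono) (auto simp: S_def)
    finally show "norm (F' n) \<le> S * L1_coeff \<beta> t n 1" .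
  qed (rule n)
  then have "\<bar>sqrt lam * (u n - U n)\<bar> \<le> S" using abs_Im_le_cmod[of "W n"] by (simp add: W_def)
  then have "sqrt lam * \<bar>u n - U n\<bar> \<le> sqrt lam * (2 * Gamma (1 - \<beta>) * \<rho>)"
    using lam by (simp add: abs_mult S_def mult_ac)
  then show ?thesis using lam by simp
qed

lemma continuous_ml_mode:
  assumes "\<alpha> > 0" "\<nu> > 1"
  shows "continuous_on {0..T} (ml_mode \<alpha> lam \<nu>)"
proof -
  have 1: "continuous_on {0..T} (\<lambda>t. t powr p)" if "p > 0" for p
    by (rule continuous_on_powr') (use that in \<open>auto intro!: continuous_intros\<close>)
  have "continuous_on {0..T} (\<lambda>t. mittag_leffler \<alpha> \<nu> (- lam * t powr \<alpha>))"
    by (rule continuous_on_compose2[OF continuous_mittag_leffler[OF assms(1), of UNIV]])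
      (intro continuous_on_mult continuous_on_const 1 assms, auto)
  then show ?thesis
    unfolding ml_mode_def[abs_def] using assms by (intro continuous_on_mult 1) auto
qed

lemma powr_le_shift:
  fixes t T :: real
  assumes "0 < t" "t \<le> T" "q \<le> p"
  shows "t powr p \<le> T powr (p - q) * t powr q"
proof -
  have "t powr p = t powr (p - q) * t powr q" using assms by (simp add: powr_add[symmetric])
  also have "\<dots> \<le> T powr (p - q) * t powr q" using assms by (intro mult_right_mono powr_mono2) auto
  finally show ?thesis .
qed

text \<open>
The coefficient of the exact solution. It is not written with \<open>ml_mode\<close>, whose factor
\<open>t powr 0\<close> is \<open>0\<close> at \<open>t = 0\<close>.
\<close>

definition mode_u :: "real \<Rightarrow> real \<Rightarrow> real \<Rightarrow> real \<Rightarrow> real \<Rightarrow> real" where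
  "mode_u \<alpha> lam a b t = a * mittag_leffler \<alpha> 1 (- lam * t powr \<alpha>) + b * (t * mittag_leffler \<alpha> 2 (- lam * t powr \<alpha>))"

lemma mode_u_eq: "t > 0 \<Longrightarrow> mode_u \<alpha> lam a b t = a * ml_mode \<alpha> lam 1 t + b * ml_mode \<alpha> lam 2 t"
  by (simp add: mode_u_def ml_mode_def)

text \<open>
By \<open>ml_mode_recursion\<close> the first two derivatives of the part with datum \<open>a\<close> are \<open>-\<lambda> a\<close> times modes
with \<open>\<nu> = \<alpha>\<close> and \<open>\<nu> = \<alpha> - 1\<close>, which are bounded by multiples of \<open>t powr (\<alpha> - 1)\<close> and \<open>t powr (\<alpha> - 2)\<close>. The part with datum \<open>b\<close>
is less regular and determines \<open>\<sigma> = 1\<close>.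
\<close>

lemma mode_u_regular:
  assumes \<alpha>: "1 < \<alpha>" "\<alpha> < 2" and T: "T > 0"
  shows "\<exists>C>0. \<forall>lam a b. lam > 0 \<longrightarrow> graded_regular T 1 (C * (lam * \<bar>a\<bar> + \<bar>b\<bar>)) (mode_u \<alpha> lam a b)
    (\<lambda>t. a * ml_mode \<alpha> lam 0 t + b * ml_mode \<alpha> lam 1 t) (\<lambda>t. a * ml_mode \<alpha> lam (-1) t + b * ml_mode \<alpha> lam 0 t)"
proof -
  obtain C1 where C1: "C1 > 0" "\<And>lam t. lam > 0 \<Longrightarrow> t > 0 \<Longrightarrow> \<bar>ml_mode \<alpha> lam \<alpha> t\<bar> \<le> C1 * t powr (\<alpha> - 1)"
    "\<And>lam t. lam > 0 \<Longrightarrow> t > 0 \<Longrightarrow> lam * \<bar>ml_mode \<alpha> lam \<alpha> t\<bar> \<le> C1 * t powr (\<alpha> - 1 - \<alpha>)"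
    using ml_mode_bound[OF \<alpha>, of \<alpha>] by blast
  obtain C2 where C2: "C2 > 0" "\<And>lam t. lam > 0 \<Longrightarrow> t > 0 \<Longrightarrow> \<bar>ml_mode \<alpha> lam (\<alpha> - 1) t\<bar> \<le> C2 * t powr (\<alpha> - 1 - 1)"
    using ml_mode_bound[OF \<alpha>, of "\<alpha> - 1"] by blast
  obtain C3 where C3: "C3 > 0" "\<And>lam t. lam > 0 \<Longrightarrow> t > 0 \<Longrightarrow> \<bar>ml_mode \<alpha> lam 1 t\<bar> \<le> C3 * t powr (1 - 1)"
    using ml_mode_bound[OF \<alpha>, of 1] by blast
  define P where "P = T powr (\<alpha> - 1)"
  define C where "C = C1 * P + C2 * P + C1 + C3"
  have P: "P > 0" using T by (simp add: P_def)
  have CC: "C1 * P \<le> C" "C2 * P \<le> C" "C1 \<le> C" "C3 \<le> C" "C > 0"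
    using P C1(1) C2(1) C3(1) by (auto simp: C_def add_pos_pos)
  have a0: "\<alpha> > 0" using \<alpha> by simp
  show ?thesis
  proof (intro exI[of _ C] conjI allI impI CC(5))
    fix lam a b :: real assume lam: "lam > 0"
    show "graded_regular T 1 (C * (lam * \<bar>a\<bar> + \<bar>b\<bar>)) (mode_u \<alpha> lam a b)
      (\<lambda>t. a * ml_mode \<alpha> lam 0 t + b * ml_mode \<alpha> lam 1 t) (\<lambda>t. a * ml_mode \<alpha> lam (-1) t + b * ml_mode \<alpha> lam 0 t)"
      unfolding graded_regular_def
    proof (intro conjI ballI)
      have "continuous_on {0..T} (\<lambda>t. t powr \<alpha>)"
        by (rule continuous_on_powr') (use a0 in \<open>auto intro!: continuous_intros\<close>)
      then have "continuous_on {0..T} (\<lambda>t. mittag_leffler \<alpha> \<nu> (- lam * t powr \<alpha>))" for \<nu>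
        by (intro continuous_on_compose2[OF continuous_mittag_leffler[OF a0, of UNIV]] continuous_on_mult continuous_on_const) auto
      then show "continuous_on {0..T} (mode_u \<alpha> lam a b)"
        unfolding mode_u_def[abs_def] by (intro continuous_intros)
      fix t assume t: "t \<in> {0<..T}"
      then have t0: "t > 0" and tT: "t \<le> T" by auto
      note d = ml_mode_derivative[OF a0 t0, of lam]
      have "((\<lambda>t. a * ml_mode \<alpha> lam 1 t + b * ml_mode \<alpha> lam 2 t) has_real_derivative
          a * ml_mode \<alpha> lam 0 t + b * ml_mode \<alpha> lam 1 t) (at t)"
        using DERIV_add[OF DERIV_cmult[OF d[of 1], of a] DERIV_cmult[OF d[of 2], of b]] by simp
      then show "(mode_u \<alpha> lam a b has_real_derivative a * ml_mode \<alpha> lam 0 t + b * ml_mode \<alpha> lam 1 t) (at t)"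
        by (rule has_field_derivative_transform_within_open[where S = "{0<..}"]) (use t0 in \<open>auto simp: mode_u_eq\<close>)
      show "((\<lambda>t. a * ml_mode \<alpha> lam 0 t + b * ml_mode \<alpha> lam 1 t) has_real_derivative
          a * ml_mode \<alpha> lam (-1) t + b * ml_mode \<alpha> lam 0 t) (at t)"
        using DERIV_add[OF DERIV_cmult[OF d[of 0], of a] DERIV_cmult[OF d[of 1], of b]] by simp
      have rec: "ml_mode \<alpha> lam 0 t = - lam * ml_mode \<alpha> lam \<alpha> t" "ml_mode \<alpha> lam (- 1) t = - lam * ml_mode \<alpha> lam (\<alpha> - 1) t"
        using ml_mode_recursion(2,3)[OF a0 t0 zero_less_one, of lam] by auto
      have b1: "\<bar>ml_mode \<alpha> lam \<alpha> t\<bar> \<le> C"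
      proof -
        have "t powr (\<alpha> - 1) \<le> P" unfolding P_def using t0 tT \<alpha> by (intro powr_mono2) auto
        then have "C1 * t powr (\<alpha> - 1) \<le> C1 * P" using C1 by simp
        then show ?thesis using C1(2)[OF lam t0] CC by linarith
      qed
      have b2: "\<bar>ml_mode \<alpha> lam 1 t\<bar> \<le> C" using C3(2)[OF lam t0] CC t0 by simp
      have b3: "\<bar>ml_mode \<alpha> lam (\<alpha> - 1) t\<bar> \<le> C * t powr (- 1)"
      proof -
        have "t powr (\<alpha> - 1 - 1) \<le> P * t powr (- 1)"
          using powr_le_shift[OF t0 tT, of "-1" "\<alpha> - 1 - 1"] \<alpha> by (simp add: P_def)
        then have "C2 * t powr (\<alpha> - 1 - 1) \<le> C2 * (P * t powr (- 1))"
          using C2(1) by (intro mult_left_mono) auto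
        also have "\<dots> \<le> C * t powr (-1)" using CC(2) mult_right_mono[of "C2 * P" C "t powr (-1)"] by simp
        finally show ?thesis using C2(2)[OF lam t0] by linarith
      qed
      have b4: "lam * \<bar>ml_mode \<alpha> lam \<alpha> t\<bar> \<le> C * t powr (- 1)"
        using C1(3)[OF lam t0] mult_right_mono[OF CC(3), of "t powr (-1)"] by simp
      have "\<bar>a * ml_mode \<alpha> lam 0 t + b * ml_mode \<alpha> lam 1 t\<bar> \<le> lam * \<bar>a\<bar> * \<bar>ml_mode \<alpha> lam \<alpha> t\<bar> + \<bar>b\<bar> * \<bar>ml_mode \<alpha> lam 1 t\<bar>"
        unfolding rec using lam by (intro order_trans[OF abs_triangle_ineq]) (simp add: abs_mult)
      also have "\<dots> \<le> lam * \<bar>a\<bar> * C + \<bar>b\<bar> * C" using b1 b2 lam by (intro add_mono mult_left_mono) auto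
      finally show "\<bar>a * ml_mode \<alpha> lam 0 t + b * ml_mode \<alpha> lam 1 t\<bar> \<le> C * (lam * \<bar>a\<bar> + \<bar>b\<bar>) * t powr (1 - 1)"
        using t0 by (simp add: algebra_simps)
      have "\<bar>a * ml_mode \<alpha> lam (-1) t + b * ml_mode \<alpha> lam 0 t\<bar>
          \<le> lam * \<bar>a\<bar> * \<bar>ml_mode \<alpha> lam (\<alpha> - 1) t\<bar> + \<bar>b\<bar> * (lam * \<bar>ml_mode \<alpha> lam \<alpha> t\<bar>)"
        unfolding rec using lam by (intro order_trans[OF abs_triangle_ineq]) (simp add: abs_mult)
      also have "\<dots> \<le> lam * \<bar>a\<bar> * (C * t powr (- 1)) + \<bar>b\<bar> * (C * t powr (- 1))"
        using b3 b4 lam by (intro add_mono mult_left_mono) auto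
      finally show "\<bar>a * ml_mode \<alpha> lam (-1) t + b * ml_mode \<alpha> lam 0 t\<bar> \<le> C * (lam * \<bar>a\<bar> + \<bar>b\<bar>) * t powr (1 - 2)"
        by (simp add: algebra_simps)
    qed
  qed
qed

lemma combination_bound:
  fixes x y p q A B X :: real
  assumes "\<bar>x\<bar> \<le> A * X" "\<bar>y\<bar> \<le> B * X" "\<bar>p\<bar> * A + \<bar>q\<bar> * B \<le> M" "X \<ge> 0"
  shows "\<bar>p * x + q * y\<bar> \<le> M * X"
proof -
  have "\<bar>p * x + q * y\<bar> \<le> \<bar>p\<bar> * \<bar>x\<bar> + \<bar>q\<bar> * \<bar>y\<bar>" using abs_triangle_ineq[of "p * x" "q * y"] by (simp add: abs_mult)
  also have "\<dots> \<le> \<bar>p\<bar> * (A * X) + \<bar>q\<bar> * (B * X)" using assms by (intro add_mono mult_left_mono) auto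
  also have "\<dots> = (\<bar>p\<bar> * A + \<bar>q\<bar> * B) * X" by (simp add: algebra_simps)
  also have "\<dots> \<le> M * X" using assms by (intro mult_right_mono) auto
  finally show ?thesis .
qed

lemma ml_mode_pair_regular:
  assumes "\<alpha> > 0" "\<nu>1 > 1" "\<nu>2 > 1" "M \<ge> 0"
    and "\<And>t. 0 < t \<Longrightarrow> t \<le> T \<Longrightarrow> \<bar>p * ml_mode \<alpha> lam (\<nu>1 - 1) t + q * ml_mode \<alpha> lam (\<nu>2 - 1) t\<bar> \<le> M * t powr (\<sigma> - 1)"
    and "\<And>t. 0 < t \<Longrightarrow> t \<le> T \<Longrightarrow> \<bar>p * ml_mode \<alpha> lam (\<nu>1 - 2) t + q * ml_mode \<alpha> lam (\<nu>2 - 2) t\<bar> \<le> M * t powr (\<sigma> - 2)"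
  shows "graded_regular T \<sigma> M (\<lambda>t. p * ml_mode \<alpha> lam \<nu>1 t + q * ml_mode \<alpha> lam \<nu>2 t)
    (\<lambda>t. p * ml_mode \<alpha> lam (\<nu>1 - 1) t + q * ml_mode \<alpha> lam (\<nu>2 - 1) t)
    (\<lambda>t. p * ml_mode \<alpha> lam (\<nu>1 - 2) t + q * ml_mode \<alpha> lam (\<nu>2 - 2) t)"
  unfolding graded_regular_def
proof (intro conjI ballI)
  show "continuous_on {0..T} (\<lambda>t. p * ml_mode \<alpha> lam \<nu>1 t + q * ml_mode \<alpha> lam \<nu>2 t)"
    by (intro continuous_intros continuous_ml_mode assms)
  fix t assume t: "t \<in> {0<..T}"
  then have t0: "t > 0" by simp
  have d: "(ml_mode \<alpha> lam \<nu> has_real_derivative ml_mode \<alpha> lam (\<nu> - 1) t) (at t)" for \<nu>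
    by (rule ml_mode_derivative[OF assms(1) t0])
  show "((\<lambda>t. p * ml_mode \<alpha> lam \<nu>1 t + q * ml_mode \<alpha> lam \<nu>2 t) has_real_derivative
      p * ml_mode \<alpha> lam (\<nu>1 - 1) t + q * ml_mode \<alpha> lam (\<nu>2 - 1) t) (at t)"
    by (intro DERIV_add DERIV_cmult d)
  show "((\<lambda>t. p * ml_mode \<alpha> lam (\<nu>1 - 1) t + q * ml_mode \<alpha> lam (\<nu>2 - 1) t) has_real_derivative
      p * ml_mode \<alpha> lam (\<nu>1 - 2) t + q * ml_mode \<alpha> lam (\<nu>2 - 2) t) (at t)"
    using d[of "\<nu>1 - 1"] d[of "\<nu>2 - 1"] by (intro DERIV_add DERIV_cmult) simp_all
qed (use assms in auto)

text \<open>
The two parts have strengths \<open>\<beta>\<close> and \<open>1 - \<beta>\<close>, and \<open>1 - \<beta> \<le> \<beta>\<close>. The factor \<open>sqrt \<lambda>\<close> on the right costs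
nothing since the eigenvalues are bounded below by \<open>lam0\<close>.
\<close>

lemma mode_v_regular:
  assumes \<alpha>: "1 < \<alpha>" "\<alpha> < 2" and T: "T > 0" and lam0: "lam0 > 0"
  defines "\<beta> \<equiv> \<alpha> / 2"
  shows "\<exists>C>0. \<forall>lam a b. lam \<ge> lam0 \<longrightarrow> graded_regular T (1 - \<beta>) (sqrt lam * (C * (lam * \<bar>a\<bar> + \<bar>b\<bar>)))
    (\<lambda>t. - (lam * a) * ml_mode \<alpha> lam (1 + \<beta>) t + b * ml_mode \<alpha> lam (2 - \<beta>) t)
    (\<lambda>t. - (lam * a) * ml_mode \<alpha> lam (1 + \<beta> - 1) t + b * ml_mode \<alpha> lam (2 - \<beta> - 1) t)
    (\<lambda>t. - (lam * a) * ml_mode \<alpha> lam (1 + \<beta> - 2) t + b * ml_mode \<alpha> lam (2 - \<beta> - 2) t)"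
proof -
  have "\<exists>C>0. \<forall>lam t. lam > 0 \<longrightarrow> t > 0 \<longrightarrow> \<bar>ml_mode \<alpha> lam \<nu> t\<bar> \<le> C * t powr (\<nu> - 1)" for \<nu>
    using ml_mode_bound[OF \<alpha>, of \<nu>] by blast
  then obtain K where K: "\<And>\<nu>. K \<nu> > 0" "\<And>\<nu> lam t. lam > 0 \<Longrightarrow> t > 0 \<Longrightarrow> \<bar>ml_mode \<alpha> lam \<nu> t\<bar> \<le> K \<nu> * t powr (\<nu> - 1)"
    by metis
  define P where "P = max 1 (T powr (2 * \<beta> - 1))"
  define C where "C = (K (1 + \<beta> - 1) + K (1 + \<beta> - 2) + K (2 - \<beta> - 1) + K (2 - \<beta> - 2)) * P / sqrt lam0"
  have P: "P \<ge> 1" by (simp add: P_def)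
  have C: "C > 0" using P K(1) lam0 by (simp add: C_def add_pos_pos)
  have C': "K \<nu> * P \<le> C * sqrt lam0" if "\<nu> \<in> {1 + \<beta> - 1, 1 + \<beta> - 2, 2 - \<beta> - 1, 2 - \<beta> - 2}" for \<nu>
    using that K(1)[of "1 + \<beta> - 1"] K(1)[of "1 + \<beta> - 2"] K(1)[of "2 - \<beta> - 1"] K(1)[of "2 - \<beta> - 2"] P lam0
    by (auto simp: C_def)
  show ?thesis
  proof (intro exI[of _ C] conjI allI impI C)
    fix lam a b :: real assume "lam \<ge> lam0"
    then have lam: "lam > 0" and sl: "sqrt lam0 \<le> sqrt lam" using lam0 by auto
    have CC: "K \<nu> * P \<le> sqrt lam * C" if "\<nu> \<in> {1 + \<beta> - 1, 1 + \<beta> - 2, 2 - \<beta> - 1, 2 - \<beta> - 2}" for \<nu>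
    proof -
      have "C * sqrt lam0 \<le> C * sqrt lam" by (rule mult_left_mono[OF sl]) (use C in simp)
      then show ?thesis using C'[OF that] unfolding mult.commute[of "sqrt lam"] by linarith
    qed
    have mode_le: "\<bar>ml_mode \<alpha> lam \<nu> t\<bar> \<le> (sqrt lam * C) * t powr q"
      if "\<nu> \<in> {1 + \<beta> - 1, 1 + \<beta> - 2, 2 - \<beta> - 1, 2 - \<beta> - 2}" "\<nu> - 1 = q \<or> \<nu> - 1 = q + (2 * \<beta> - 1)" "0 < t" "t \<le> T" for \<nu> q t
    proof -
      have "t powr (\<nu> - 1) \<le> P * t powr q"
        using that(2)
      proof
        assume "\<nu> - 1 = q"
        then show ?thesis using mult_right_mono[OF P, of "t powr q"] by simp
      next
        assume e: "\<nu> - 1 = q + (2 * \<beta> - 1)"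
        have "t powr (q + (2 * \<beta> - 1)) \<le> T powr (2 * \<beta> - 1) * t powr q"
          using powr_le_shift[OF that(3,4), of q "q + (2 * \<beta> - 1)"] \<alpha> by (simp add: \<beta>_def)
        also have "\<dots> \<le> P * t powr q" by (intro mult_right_mono) (auto simp: P_def)
        finally show ?thesis unfolding e .
      qed
      then have "K \<nu> * t powr (\<nu> - 1) \<le> K \<nu> * (P * t powr q)" using K(1)[of \<nu>] by simp
      also have "\<dots> \<le> (sqrt lam * C) * t powr q" using mult_right_mono[OF CC[OF that(1)], of "t powr q"] by (simp add: mult.assoc)
      finally show ?thesis using K(2)[OF lam that(3), of \<nu>] by linarith
    qed
    have M: "\<bar>- (lam * a)\<bar> * (sqrt lam * C) + \<bar>b\<bar> * (sqrt lam * C) \<le> sqrt lam * (C * (lam * \<bar>a\<bar> + \<bar>b\<bar>))"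
      using lam by (simp add: abs_mult algebra_simps)
    show "graded_regular T (1 - \<beta>) (sqrt lam * (C * (lam * \<bar>a\<bar> + \<bar>b\<bar>)))
      (\<lambda>t. - (lam * a) * ml_mode \<alpha> lam (1 + \<beta>) t + b * ml_mode \<alpha> lam (2 - \<beta>) t)
      (\<lambda>t. - (lam * a) * ml_mode \<alpha> lam (1 + \<beta> - 1) t + b * ml_mode \<alpha> lam (2 - \<beta> - 1) t)
      (\<lambda>t. - (lam * a) * ml_mode \<alpha> lam (1 + \<beta> - 2) t + b * ml_mode \<alpha> lam (2 - \<beta> - 2) t)"
    proof (rule ml_mode_pair_regular)
      fix t assume t: "0 < t" "t \<le> T"
      show "\<bar>- (lam * a) * ml_mode \<alpha> lam (1 + \<beta> - 1) t + b * ml_mode \<alpha> lam (2 - \<beta> - 1) t\<bar>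
        \<le> sqrt lam * (C * (lam * \<bar>a\<bar> + \<bar>b\<bar>)) * t powr (1 - \<beta> - 1)"
        by (rule combination_bound[OF mode_le mode_le M]) (use t in auto)
      show "\<bar>- (lam * a) * ml_mode \<alpha> lam (1 + \<beta> - 2) t + b * ml_mode \<alpha> lam (2 - \<beta> - 2) t\<bar>
        \<le> sqrt lam * (C * (lam * \<bar>a\<bar> + \<bar>b\<bar>)) * t powr (1 - \<beta> - 2)"
        by (rule combination_bound[OF mode_le mode_le M]) (use t in auto)
    qed (use \<alpha> lam C in \<open>auto simp: \<beta>_def\<close>)
  qed
qed

text \<open>
Removing the singular term of \<open>v\<close> replaces its part with datum \<open>b\<close> by \<open>-\<lambda> b\<close> times the mode with
\<open>\<nu> = 2 + \<beta>\<close>. One factor \<open>sqrt \<lambda>\<close> is permitted by \<open>L1_system_error\<close>, the other one is absorbed by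
\<open>ml_mode_bound\<close> at the price of \<open>t powr -\<beta>\<close>. What remains has strength \<open>1\<close>, and \<open>\<sigma> = \<beta>\<close> comes from the
part with datum \<open>a\<close>.
\<close>

lemma mode_z_regular:
  assumes \<alpha>: "1 < \<alpha>" "\<alpha> < 2" and T: "T > 0" and lam0: "lam0 > 0"
  defines "\<beta> \<equiv> \<alpha> / 2"
  shows "\<exists>C>0. \<forall>lam a b. lam \<ge> lam0 \<longrightarrow> graded_regular T \<beta> (sqrt lam * (C * (lam * \<bar>a\<bar> + \<bar>b\<bar>)))
    (\<lambda>t. - (lam * a) * ml_mode \<alpha> lam (1 + \<beta>) t + - (lam * b) * ml_mode \<alpha> lam (2 + \<beta>) t)
    (\<lambda>t. - (lam * a) * ml_mode \<alpha> lam (1 + \<beta> - 1) t + - (lam * b) * ml_mode \<alpha> lam (2 + \<beta> - 1) t)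
    (\<lambda>t. - (lam * a) * ml_mode \<alpha> lam (1 + \<beta> - 2) t + - (lam * b) * ml_mode \<alpha> lam (2 + \<beta> - 2) t)"
proof -
  have "\<exists>C>0. \<forall>lam t. lam > 0 \<longrightarrow> t > 0 \<longrightarrow> \<bar>ml_mode \<alpha> lam \<nu> t\<bar> \<le> C * t powr (\<nu> - 1) \<and>
      sqrt lam * \<bar>ml_mode \<alpha> lam \<nu> t\<bar> \<le> C * t powr (\<nu> - 1 - \<beta>)" for \<nu>
    using ml_mode_bound[OF \<alpha>, of \<nu>] unfolding \<beta>_def by blast
  then obtain K where K: "\<And>\<nu>. K \<nu> > 0" "\<And>\<nu> lam t. lam > 0 \<Longrightarrow> t > 0 \<Longrightarrow> \<bar>ml_mode \<alpha> lam \<nu> t\<bar> \<le> K \<nu> * t powr (\<nu> - 1)"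
    "\<And>\<nu> lam t. lam > 0 \<Longrightarrow> t > 0 \<Longrightarrow> sqrt lam * \<bar>ml_mode \<alpha> lam \<nu> t\<bar> \<le> K \<nu> * t powr (\<nu> - 1 - \<beta>)"
    by metis
  define P where "P = T powr (1 - \<beta>)"
  define Ca where "Ca = K (1 + \<beta> - 1) + K (1 + \<beta> - 2)"
  define Cb where "Cb = (K (2 + \<beta> - 1) + K (2 + \<beta> - 2)) * P"
  define C where "C = Ca / sqrt lam0 + Cb"
  have P: "P > 0" using T by (simp add: P_def)
  have Ca: "Ca > 0" "K (1 + \<beta> - 1) \<le> Ca" "K (1 + \<beta> - 2) \<le> Ca"
    using K(1)[of "1 + \<beta> - 1"] K(1)[of "1 + \<beta> - 2"] by (auto simp: Ca_def)
  have Cb: "Cb > 0" "K (2 + \<beta> - 1) * P \<le> Cb" "K (2 + \<beta> - 2) * P \<le> Cb"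
    using K(1)[of "2 + \<beta> - 1"] K(1)[of "2 + \<beta> - 2"] P by (auto simp: Cb_def intro!: mult_pos_pos add_pos_pos)
  have C: "C > 0" using Ca Cb lam0 by (simp add: C_def add_pos_pos)
  show ?thesis
  proof (intro exI[of _ C] conjI allI impI C)
    fix lam a b :: real assume "lam \<ge> lam0"
    then have lam: "lam > 0" and sl: "sqrt lam0 \<le> sqrt lam" using lam0 by auto
    have sq: "lam = sqrt lam * sqrt lam" using lam by simp
    have Ca': "Ca \<le> sqrt lam * C"
    proof -
      have "Ca = sqrt lam0 * (Ca / sqrt lam0)" using lam0 by simp
      also have "\<dots> \<le> sqrt lam * C" using sl lam0 Ca(1) Cb(1) by (intro mult_mono) (auto simp: C_def)
      finally show ?thesis .
    qed
    have Cb': "Cb \<le> C" using Ca(1) lam0 by (simp add: C_def)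
    have term_a: "\<bar>ml_mode \<alpha> lam \<nu> t\<bar> \<le> Ca * t powr (\<nu> - 1)" if "\<nu> \<in> {1 + \<beta> - 1, 1 + \<beta> - 2}" "0 < t" for \<nu> t
      using K(2)[OF lam that(2), of \<nu>] mult_right_mono[of "K \<nu>" Ca "t powr (\<nu> - 1)"] Ca that(1) by fastforce
    have term_b: "\<bar>sqrt lam * ml_mode \<alpha> lam \<nu> t\<bar> \<le> Cb * t powr q"
      if "\<nu> \<in> {2 + \<beta> - 1, 2 + \<beta> - 2}" "\<nu> - 1 - \<beta> = q + (1 - \<beta>)" "0 < t" "t \<le> T" for \<nu> q t
    proof -
      have "t powr (\<nu> - 1 - \<beta>) \<le> P * t powr q"
        using powr_le_shift[OF that(3,4), of q "q + (1 - \<beta>)"] \<alpha> unfolding that(2) by (simp add: \<beta>_def P_def)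
      then have "K \<nu> * t powr (\<nu> - 1 - \<beta>) \<le> K \<nu> * P * t powr q" using K(1)[of \<nu>] by simp
      also have "\<dots> \<le> Cb * t powr q" using that(1) Cb by (intro mult_right_mono) auto
      finally show ?thesis using K(3)[OF lam that(3), of \<nu>] lam by (simp add: abs_mult)
    qed
    have M: "\<bar>- (lam * a)\<bar> * Ca + \<bar>- (sqrt lam * b)\<bar> * Cb \<le> sqrt lam * (C * (lam * \<bar>a\<bar> + \<bar>b\<bar>))"
    proof -
      have "\<bar>- (lam * a)\<bar> * Ca + \<bar>- (sqrt lam * b)\<bar> * Cb \<le> (lam * \<bar>a\<bar>) * (sqrt lam * C) + (sqrt lam * \<bar>b\<bar>) * C"
        using Ca' Cb' lam by (intro add_mono mult_mono) (auto simp: abs_mult Ca(1) Cb(1) less_imp_le)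
      then show ?thesis by (simp add: algebra_simps)
    qed
    have split: "- (lam * b) * x = - (sqrt lam * b) * (sqrt lam * x)" for x
      using sq by algebra
    show "graded_regular T \<beta> (sqrt lam * (C * (lam * \<bar>a\<bar> + \<bar>b\<bar>)))
      (\<lambda>t. - (lam * a) * ml_mode \<alpha> lam (1 + \<beta>) t + - (lam * b) * ml_mode \<alpha> lam (2 + \<beta>) t)
      (\<lambda>t. - (lam * a) * ml_mode \<alpha> lam (1 + \<beta> - 1) t + - (lam * b) * ml_mode \<alpha> lam (2 + \<beta> - 1) t)
      (\<lambda>t. - (lam * a) * ml_mode \<alpha> lam (1 + \<beta> - 2) t + - (lam * b) * ml_mode \<alpha> lam (2 + \<beta> - 2) t)"
    proof (rule ml_mode_pair_regular)
      fix t assume t: "0 < t" "t \<le> T"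
      show "\<bar>- (lam * a) * ml_mode \<alpha> lam (1 + \<beta> - 1) t + - (lam * b) * ml_mode \<alpha> lam (2 + \<beta> - 1) t\<bar>
        \<le> sqrt lam * (C * (lam * \<bar>a\<bar> + \<bar>b\<bar>)) * t powr (\<beta> - 1)"
        unfolding split
        by (rule combination_bound[OF _ term_b M]) (use t term_a[of "1 + \<beta> - 1" t] in auto)
      show "\<bar>- (lam * a) * ml_mode \<alpha> lam (1 + \<beta> - 2) t + - (lam * b) * ml_mode \<alpha> lam (2 + \<beta> - 2) t\<bar>
        \<le> sqrt lam * (C * (lam * \<bar>a\<bar> + \<bar>b\<bar>)) * t powr (\<beta> - 2)"
        unfolding split
        by (rule combination_bound[OF _ term_b M]) (use t term_a[of "1 + \<beta> - 2" t] in auto)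
    qed (use \<alpha> lam C in \<open>auto simp: \<beta>_def\<close>)
  qed
qed


text \<open>
The Caputo derivative of order \<open>\<alpha> / 2\<close> of the exact mode, whose first derivative stands under the
integral.
\<close>

lemma mode_u_half_derivative:
  assumes "0 < \<alpha>" "\<alpha> < 2" "t > 0"
  shows "((\<lambda>s. omega (1 - \<alpha> / 2) (t - s) * (a * ml_mode \<alpha> lam 0 s + b * ml_mode \<alpha> lam 1 s)) has_integral
    - (lam * a) * ml_mode \<alpha> lam (1 + \<alpha> / 2) t + b * ml_mode \<alpha> lam (2 - \<alpha> / 2) t) {0..t}"
proof -
  define \<beta> where "\<beta> = \<alpha> / 2"
  have \<alpha>\<beta>: "\<alpha> = \<beta> + \<beta>" by (simp add: \<beta>_def)
  have "((\<lambda>s. - (lam * a) * (omega (1 - \<beta>) (t - s) * ml_mode \<alpha> lam \<alpha> s) + b * (omega (1 - \<beta>) (t - s) * ml_mode \<alpha> lam 1 s))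
      has_integral - (lam * a) * ml_mode \<alpha> lam (1 - \<beta> + \<alpha>) t + b * ml_mode \<alpha> lam (1 - \<beta> + 1) t) {0..t}"
    by (intro has_integral_add has_integral_mult_right ml_mode_convolution) (use assms in \<open>auto simp: \<beta>_def\<close>)
  moreover have "- (lam * a) * (omega (1 - \<beta>) (t - s) * ml_mode \<alpha> lam \<alpha> s) + b * (omega (1 - \<beta>) (t - s) * ml_mode \<alpha> lam 1 s)
      = omega (1 - \<beta>) (t - s) * (a * ml_mode \<alpha> lam 0 s + b * ml_mode \<alpha> lam 1 s)" if "s \<in> {0..t}" for s
    using that ml_mode_recursion(2)[OF assms(1), of s 1 lam]
    by (cases "s = 0") (auto simp: ml_mode_def algebra_simps)
  ultimately have "((\<lambda>s. omega (1 - \<beta>) (t - s) * (a * ml_mode \<alpha> lam 0 s + b * ml_mode \<alpha> lam 1 s))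
      has_integral - (lam * a) * ml_mode \<alpha> lam (1 - \<beta> + \<alpha>) t + b * ml_mode \<alpha> lam (1 - \<beta> + 1) t) {0..t}"
    by (rule has_integral_eq[rotated])
  moreover have "1 - \<beta> + \<alpha> = 1 + \<alpha> / 2" "1 - \<beta> + 1 = 2 - \<alpha> / 2" by (simp_all add: \<beta>_def)
  ultimately show ?thesis unfolding \<beta>_def[symmetric] by simp
qed

text \<open>
The error estimate for one mode, with a constant that is uniform over all eigenvalues \<open>\<lambda> \<ge> lam0\<close>.
\<close>

definition mode_scheme_accurate ::
  "real \<Rightarrow> real \<Rightarrow> real \<Rightarrow> real \<Rightarrow> (real \<Rightarrow> real \<Rightarrow> real) \<Rightarrow> (real \<Rightarrow> real \<Rightarrow> real) \<Rightarrow> real \<Rightarrow> bool" where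
  "mode_scheme_accurate \<alpha> T r lam0 F G C \<longleftrightarrow> (\<forall>lam a b N U V. lam0 \<le> lam \<longrightarrow> U 0 = a \<longrightarrow> V 0 = 0 \<longrightarrow>
     mode_scheme (\<alpha> / 2) lam (mesh T r N) N (\<lambda>n. F b (mesh T r N n)) (\<lambda>n. G b (mesh T r N n)) U V \<longrightarrow>
     (\<forall>n\<in>{1..N}. \<bar>mode_u \<alpha> lam a b (mesh T r N n) - U n\<bar> \<le> C * (lam * \<bar>a\<bar> + \<bar>b\<bar>) * real N powr (- (2 - \<alpha> / 2))))"

text \<open>
Both schemes are instances of this lemma. The second unknown is the mode
\<open>-\<lambda> a e\<^bsub>1+\<beta>\<^esub> + c e\<^sub>\<nu>\<close>, with \<open>e\<close> abbreviating \<open>ml_mode\<close>, and its derivative of order \<open>\<beta>\<close> is found by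
convolution. The assumptions on \<open>F\<close> and \<open>G\<close> express that the exact solution satisfies the system.
\<close>

lemma mode_scheme_accurateI:
  fixes \<alpha> T lam0 r \<sigma> \<nu> :: real and c F G :: "real \<Rightarrow> real \<Rightarrow> real"
  assumes \<alpha>: "1 < \<alpha>" "\<alpha> < 2" and T: "T > 0" and lam0: "lam0 > 0"
    and r: "1 \<le> r" "2 - \<alpha> / 2 \<le> r" "2 - \<alpha> / 2 \<le> r * \<sigma>" and \<sigma>: "0 < \<sigma>" "\<sigma> \<le> 1" and \<nu>: "\<nu> > 1"
    and v_regular: "\<exists>C>0. \<forall>lam a b. lam \<ge> lam0 \<longrightarrow> graded_regular T \<sigma> (sqrt lam * (C * (lam * \<bar>a\<bar> + \<bar>b\<bar>)))
      (\<lambda>t. - (lam * a) * ml_mode \<alpha> lam (1 + \<alpha> / 2) t + c lam b * ml_mode \<alpha> lam \<nu> t)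
      (\<lambda>t. - (lam * a) * ml_mode \<alpha> lam (1 + \<alpha> / 2 - 1) t + c lam b * ml_mode \<alpha> lam (\<nu> - 1) t)
      (\<lambda>t. - (lam * a) * ml_mode \<alpha> lam (1 + \<alpha> / 2 - 2) t + c lam b * ml_mode \<alpha> lam (\<nu> - 2) t)"
    and F: "\<And>lam b t. t > 0 \<Longrightarrow> F b t = c lam b * ml_mode \<alpha> lam (\<nu> - \<alpha> / 2) t + lam * b * ml_mode \<alpha> lam 2 t"
    and G: "\<And>lam b t. t > 0 \<Longrightarrow> G b t = b * ml_mode \<alpha> lam (2 - \<alpha> / 2) t - c lam b * ml_mode \<alpha> lam \<nu> t"
  shows "\<exists>C>0. mode_scheme_accurate \<alpha> T r lam0 F G C"
proof -
  define \<beta> where "\<beta> = \<alpha> / 2"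
  have \<beta>: "0 < \<beta>" "\<beta> < 1" and \<alpha>0: "\<alpha> > 0" using \<alpha> by (auto simp: \<beta>_def)
  have r': "2 - \<beta> \<le> r * 1" "2 - \<beta> \<le> r * \<sigma>" using r by (auto simp: \<beta>_def)
  obtain Cu where Cu: "Cu > 0" "\<And>lam a b. lam > 0 \<Longrightarrow> graded_regular T 1 (Cu * (lam * \<bar>a\<bar> + \<bar>b\<bar>)) (mode_u \<alpha> lam a b)
    (\<lambda>t. a * ml_mode \<alpha> lam 0 t + b * ml_mode \<alpha> lam 1 t) (\<lambda>t. a * ml_mode \<alpha> lam (-1) t + b * ml_mode \<alpha> lam 0 t)"
    using mode_u_regular[OF \<alpha> T] by blast
  obtain Cv where Cv: "Cv > 0" "\<And>lam a b. lam \<ge> lam0 \<Longrightarrow> graded_regular T \<sigma> (sqrt lam * (Cv * (lam * \<bar>a\<bar> + \<bar>b\<bar>)))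
    (\<lambda>t. - (lam * a) * ml_mode \<alpha> lam (1 + \<beta>) t + c lam b * ml_mode \<alpha> lam \<nu> t)
    (\<lambda>t. - (lam * a) * ml_mode \<alpha> lam (1 + \<beta> - 1) t + c lam b * ml_mode \<alpha> lam (\<nu> - 1) t)
    (\<lambda>t. - (lam * a) * ml_mode \<alpha> lam (1 + \<beta> - 2) t + c lam b * ml_mode \<alpha> lam (\<nu> - 2) t)"
    using v_regular unfolding \<beta>_def by blast
  obtain K1 where K1: "K1 > 0" "L1_accurate T r \<beta> 1 K1"
    using L1_truncation[OF \<beta> zero_less_one order_refl r(1) r'(1) T] by blast
  obtain K2 where K2: "K2 > 0" "L1_accurate T r \<beta> \<sigma> K2"
    using L1_truncation[OF \<beta> \<sigma> r(1) r'(2) T] by blast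
  have \<Gamma>: "Gamma (1 - \<beta>) > 0" using \<beta> by (intro Gamma_real_pos) auto
  define C where "C = 2 * Gamma (1 - \<beta>) * (K1 * Cu + K2 * Cv)"
  show ?thesis
    unfolding mode_scheme_accurate_def
  proof (intro exI[of _ C] conjI allI impI ballI)
    show "C > 0" using \<Gamma> K1(1) K2(1) Cu(1) Cv(1) by (simp add: C_def add_pos_pos)
    fix lam a b :: real and N and U V :: "nat \<Rightarrow> real" and n
    assume lam: "lam0 \<le> lam" and init: "U 0 = a" "V 0 = 0"
      and scheme: "mode_scheme (\<alpha> / 2) lam (mesh T r N) N (\<lambda>n. F b (mesh T r N n)) (\<lambda>n. G b (mesh T r N n)) U V"
      and n: "n \<in> {1..N}"
    have N: "N \<ge> 1" and l0: "lam > 0" using n lam lam0 by auto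
    define t where "t = mesh T r N"
    have t: "strict_mono t" "t 0 = 0"
      using mesh_strict_mono[OF T r(1) N] by (auto simp: t_def strict_mono_def)
    have tpos: "t k > 0" if "1 \<le> k" for k using strict_monoD[OF t(1), of 0 k] that t(2) by simp
    define \<epsilon> where "\<epsilon> = real N powr (- (2 - \<beta>))"
    define M where "M = lam * \<bar>a\<bar> + \<bar>b\<bar>"
    have M: "M \<ge> 0" and \<epsilon>0: "\<epsilon> \<ge> 0" using l0 by (simp_all add: M_def \<epsilon>_def)
    define v where "v s = - (lam * a) * ml_mode \<alpha> lam (1 + \<beta>) s + c lam b * ml_mode \<alpha> lam \<nu> s" for s
    define dv where "dv s = - (lam * a) * ml_mode \<alpha> lam 1 s + c lam b * ml_mode \<alpha> lam (\<nu> - \<beta>) s" for s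
    define du where "du s = - (lam * a) * ml_mode \<alpha> lam (1 + \<beta>) s + b * ml_mode \<alpha> lam (2 - \<beta>) s" for s
    have "\<bar>mode_u \<alpha> lam a b (t n) - U n\<bar> \<le> 2 * Gamma (1 - \<beta>) * ((K1 * Cu + K2 * Cv) * M * \<epsilon>)"
    proof (rule L1_system_error[OF \<beta> t l0, where v = "\<lambda>k. v (t k)" and V = V and du = "\<lambda>k. du (t k)" and dv = "\<lambda>k. dv (t k)"
          and F = "\<lambda>k. F b (t k)" and G = "\<lambda>k. G b (t k)" and N = N and u = "\<lambda>k. mode_u \<alpha> lam a b (t k)" and U = U])
      show "0 \<le> (K1 * Cu + K2 * Cv) * M * \<epsilon>" using M \<epsilon>0 K1(1) K2(1) Cu(1) Cv(1) by simp
      have "mittag_leffler \<alpha> 1 0 = 1" using mittag_leffler_recursion[OF \<alpha>0, of 1 0] by simp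
      then show "mode_u \<alpha> lam a b (t 0) = U 0" using init t by (simp add: mode_u_def)
      show "v (t 0) = V 0" using init t by (simp add: v_def ml_mode_def)
      show "n \<le> N" using n by simp
      show "mode_scheme \<beta> lam t N (\<lambda>k. F b (t k)) (\<lambda>k. G b (t k)) U V"
        using scheme by (simp add: t_def \<beta>_def)
    next
      fix m assume m: "1 \<le> m" "m \<le> N"
      note tm = tpos[OF m(1)]
      show "dv (t m) + lam * mode_u \<alpha> lam a b (t m) = F b (t m)"
        unfolding dv_def mode_u_eq[OF tm] F[OF tm, of b lam] by (simp add: \<beta>_def algebra_simps)
      show "v (t m) + G b (t m) = du (t m)"
        unfolding v_def du_def G[OF tm, of b lam] by (simp add: \<beta>_def algebra_simps)
      have "((\<lambda>s. - (lam * a) * (omega (1 - \<beta>) (t m - s) * ml_mode \<alpha> lam \<beta> s) + c lam b * (omega (1 - \<beta>) (t m - s) * ml_mode \<alpha> lam (\<nu> - 1) s))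
          has_integral - (lam * a) * ml_mode \<alpha> lam (1 - \<beta> + \<beta>) (t m) + c lam b * ml_mode \<alpha> lam (1 - \<beta> + (\<nu> - 1)) (t m)) {0..t m}"
        by (intro has_integral_add has_integral_mult_right ml_mode_convolution) (use \<beta> \<alpha> \<nu> tm in auto)
      then have cv: "((\<lambda>s. omega (1 - \<beta>) (t m - s) * (- (lam * a) * ml_mode \<alpha> lam (1 + \<beta> - 1) s + c lam b * ml_mode \<alpha> lam (\<nu> - 1) s))
          has_integral dv (t m)) {0..t m}"
        by (simp add: dv_def algebra_simps)
      have "\<bar>dv (t m) - (\<Sum>k=1..m. L1_coeff \<beta> t m k * (v (t k) - v (t (k - 1))))\<bar>
          \<le> K2 * (sqrt lam * (Cv * M)) * \<epsilon> * t m powr (- \<beta>)"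
        unfolding t_def \<epsilon>_def M_def v_def
        by (rule K2(2)[unfolded L1_accurate_def, rule_format, OF Cv(2)[OF lam]])
          (use cv m l0 Cv(1) in \<open>auto simp: t_def\<close>)
      also have "\<dots> = sqrt lam * (K2 * Cv * M * \<epsilon>) * t m powr (- \<beta>)" by simp
      also have "\<dots> \<le> sqrt lam * ((K1 * Cu + K2 * Cv) * M * \<epsilon>) * t m powr (- \<beta>)"
        using K1(1) Cu(1) M \<epsilon>0 l0 by (intro mult_right_mono mult_left_mono) auto
      finally show "\<bar>dv (t m) - (\<Sum>k=1..m. L1_coeff \<beta> t m k * (v (t k) - v (t (k - 1))))\<bar>
          \<le> sqrt lam * ((K1 * Cu + K2 * Cv) * M * \<epsilon>) * t m powr (- \<beta>)" .
      have cu: "((\<lambda>s. omega (1 - \<beta>) (t m - s) * (a * ml_mode \<alpha> lam 0 s + b * ml_mode \<alpha> lam 1 s))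
          has_integral du (t m)) {0..t m}"
        unfolding du_def \<beta>_def using \<alpha> by (intro mode_u_half_derivative tm) auto
      have "\<bar>du (t m) - (\<Sum>k=1..m. L1_coeff \<beta> t m k * (mode_u \<alpha> lam a b (t k) - mode_u \<alpha> lam a b (t (k - 1))))\<bar>
          \<le> K1 * (Cu * M) * \<epsilon> * t m powr (- \<beta>)"
        unfolding t_def \<epsilon>_def M_def
        by (rule K1(2)[unfolded L1_accurate_def, rule_format, OF Cu(2)[OF l0]])
          (use cu m l0 Cu(1) in \<open>auto simp: t_def\<close>)
      also have "\<dots> \<le> (K1 * Cu + K2 * Cv) * M * \<epsilon> * t m powr (- \<beta>)"
        using K2(1) Cv(1) M \<epsilon>0 l0 by (simp add: mult_right_mono flip: mult.assoc)
      finally show "\<bar>du (t m) - (\<Sum>k=1..m. L1_coeff \<beta> t m k * (mode_u \<alpha> lam a b (t k) - mode_u \<alpha> lam a b (t (k - 1))))\<bar>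
          \<le> (K1 * Cu + K2 * Cv) * M * \<epsilon> * t m powr (- \<beta>)" .
    qed
    then show "\<bar>mode_u \<alpha> lam a b (mesh T r N n) - U n\<bar> \<le> C * (lam * \<bar>a\<bar> + \<bar>b\<bar>) * real N powr (- (2 - \<alpha> / 2))"
      by (simp add: C_def t_def M_def \<epsilon>_def \<beta>_def mult_ac)
  qed
qed

theorem uv_mode_error:
  assumes \<alpha>: "1 < \<alpha>" "\<alpha> < 2" and T: "T > 0" and lam0: "lam0 > 0" and r: "r = (4 - \<alpha>) / (2 - \<alpha>)"
  shows "\<exists>C>0. mode_scheme_accurate \<alpha> T r lam0 (\<lambda>b t. b * omega (2 - \<alpha>) t) (\<lambda>b t. 0) C"
proof (rule mode_scheme_accurateI[where \<sigma> = "1 - \<alpha> / 2" and \<nu> = "2 - \<alpha> / 2" and c = "\<lambda>lam b. b", OF \<alpha> T lam0 _ _ _ _ _ _ mode_v_regular[OF \<alpha> T lam0]])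
  have e: "r * (1 - \<alpha> / 2) = 2 - \<alpha> / 2" using \<alpha> by (simp add: r field_simps)
  show r1: "1 \<le> r" using \<alpha> by (simp add: r field_simps)
  have "r * (1 - \<alpha> / 2) \<le> r * 1" using r1 \<alpha> by (intro mult_left_mono) auto
  then show "2 - \<alpha> / 2 \<le> r" by (simp add: e)
  show "2 - \<alpha> / 2 \<le> r * (1 - \<alpha> / 2)" by (simp add: e)
  fix lam b t :: real assume t: "t > 0"
  have e2: "2 - \<alpha> / 2 - \<alpha> / 2 = 2 - \<alpha>" by simp
  have rec: "ml_mode \<alpha> lam (2 - \<alpha>) t = omega (2 - \<alpha>) t - lam * ml_mode \<alpha> lam 2 t"
    using ml_mode_recursion(1)[of \<alpha> t "2 - \<alpha>" lam] \<alpha> t by simp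
  show "b * omega (2 - \<alpha>) t = b * ml_mode \<alpha> lam (2 - \<alpha> / 2 - \<alpha> / 2) t + lam * b * ml_mode \<alpha> lam 2 t"
    unfolding e2 rec by (simp add: algebra_simps)
qed (use \<alpha> in auto)

theorem uz_mode_error:
  assumes \<alpha>: "1 < \<alpha>" "\<alpha> < 2" and T: "T > 0" and lam0: "lam0 > 0" and r: "r = max ((4 - \<alpha>) / \<alpha>) 2"
  shows "\<exists>C>0. mode_scheme_accurate \<alpha> T r lam0 (\<lambda>b t. 0) (\<lambda>b t. b * omega (2 - \<alpha> / 2) t) C"
proof (rule mode_scheme_accurateI[where \<sigma> = "\<alpha> / 2" and \<nu> = "2 + \<alpha> / 2" and c = "\<lambda>lam b. - (lam * b)", OF \<alpha> T lam0 _ _ _ _ _ _ mode_z_regular[OF \<alpha> T lam0]])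
  have "(4 - \<alpha>) / \<alpha> * (\<alpha> / 2) \<le> r * (\<alpha> / 2)" unfolding r using \<alpha> by (intro mult_right_mono) auto
  moreover have "(4 - \<alpha>) / \<alpha> * (\<alpha> / 2) = 2 - \<alpha> / 2" using \<alpha> by (simp add: field_simps)
  ultimately show "2 - \<alpha> / 2 \<le> r * (\<alpha> / 2)" by simp
  show "1 \<le> r" by (simp add: r)
  have "2 \<le> r" by (simp add: r)
  then show "2 - \<alpha> / 2 \<le> r" using \<alpha> by linarith
  fix lam b t :: real assume t: "t > 0"
  have "2 - \<alpha> / 2 + \<alpha> = 2 + \<alpha> / 2" "0 < 2 - \<alpha> / 2" using \<alpha> by auto
  then have rec: "ml_mode \<alpha> lam (2 - \<alpha> / 2) t = omega (2 - \<alpha> / 2) t - lam * ml_mode \<alpha> lam (2 + \<alpha> / 2) t"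
    using ml_mode_recursion(1)[of \<alpha> t "2 - \<alpha> / 2" lam] \<alpha> t by (simp only:)
  show "b * omega (2 - \<alpha> / 2) t = b * ml_mode \<alpha> lam (2 - \<alpha> / 2) t - - (lam * b) * ml_mode \<alpha> lam (2 + \<alpha> / 2) t"
    unfolding rec by (simp add: algebra_simps)
qed (use \<alpha> in auto)

section \<open>The space of square integrable functions\<close>

lemma L2_spaceD:
  assumes "w \<in> L2_space L"
  shows "w \<in> borel_measurable (lebesgue_on {0<..<L})" "integrable (lebesgue_on {0<..<L}) (\<lambda>x. (w x)\<^sup>2)"
  using assms by (auto simp: L2_space_def)

lemma L2_mult_integrable:
  assumes "v \<in> L2_space L" "w \<in> L2_space L"
  shows "integrable (lebesgue_on {0<..<L}) (\<lambda>x. v x * w x)"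
proof (rule Bochner_Integration.integrable_bound)
  show "integrable (lebesgue_on {0<..<L}) (\<lambda>x. (v x)\<^sup>2 + (w x)\<^sup>2)"
    using assms by (intro Bochner_Integration.integrable_add L2_spaceD)
  show "(\<lambda>x. v x * w x) \<in> borel_measurable (lebesgue_on {0<..<L})"
    using assms by (intro borel_measurable_times L2_spaceD)
  have "\<bar>a * b\<bar> \<le> a\<^sup>2 + b\<^sup>2" for a b :: real
    using sum_squares_bound[of a b] sum_squares_bound[of a "-b"] by (simp add: abs_le_iff)
  then show "AE x in lebesgue_on {0<..<L}. norm (v x * w x) \<le> norm ((v x)\<^sup>2 + (w x)\<^sup>2)"
    by simp
qed

lemma L2_space_scale: "w \<in> L2_space L \<Longrightarrow> (\<lambda>x. c * w x) \<in> L2_space L"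
  by (auto simp: L2_space_def power_mult_distrib)

lemma L2_space_add:
  assumes "v \<in> L2_space L" "w \<in> L2_space L"
  shows "(\<lambda>x. v x + w x) \<in> L2_space L"
proof -
  have "integrable (lebesgue_on {0<..<L}) (\<lambda>x. (v x)\<^sup>2 + (w x)\<^sup>2 + 2 * (v x * w x))"
    using assms by (intro Bochner_Integration.integrable_add integrable_mult_right L2_spaceD L2_mult_integrable)
  then show ?thesis using assms by (auto simp: L2_space_def power2_sum mult.assoc)
qed

lemma L2_space_diff:
  assumes "v \<in> L2_space L" "w \<in> L2_space L"
  shows "(\<lambda>x. v x - w x) \<in> L2_space L"
  using L2_space_add[OF assms(1) L2_space_scale[OF assms(2), of "-1"]] by simp

lemma L2_space_zero: "(\<lambda>x. 0) \<in> L2_space L"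
  by (simp add: L2_space_def)

lemma L2_space_sum:
  assumes "\<And>i. i \<in> I \<Longrightarrow> w i \<in> L2_space L"
  shows "(\<lambda>x. \<Sum>i\<in>I. w i x) \<in> L2_space L"
  using assms
  by (induction I rule: infinite_finite_induct) (auto intro: L2_space_zero L2_space_add)

lemma L2_inner_commute: "L2_inner L v w = L2_inner L w v"
  by (simp add: L2_inner_def mult.commute)

lemma L2_inner_scale_left: "L2_inner L (\<lambda>x. c * v x) w = c * L2_inner L v w"
  by (simp add: L2_inner_def mult.assoc)

lemma L2_inner_add_left:
  assumes "u \<in> L2_space L" "v \<in> L2_space L" "w \<in> L2_space L"
  shows "L2_inner L (\<lambda>x. u x + v x) w = L2_inner L u w + L2_inner L v w"
  unfolding L2_inner_def distrib_right
  by (intro Bochner_Integration.integral_add L2_mult_integrable assms)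

lemma L2_inner_diff_left:
  assumes "u \<in> L2_space L" "v \<in> L2_space L" "w \<in> L2_space L"
  shows "L2_inner L (\<lambda>x. u x - v x) w = L2_inner L u w - L2_inner L v w"
  unfolding L2_inner_def left_diff_distrib
  by (intro Bochner_Integration.integral_diff L2_mult_integrable assms)

lemma L2_inner_sum_left:
  assumes "\<And>i. i \<in> I \<Longrightarrow> v i \<in> L2_space L" "w \<in> L2_space L"
  shows "L2_inner L (\<lambda>x. \<Sum>i\<in>I. v i x) w = (\<Sum>i\<in>I. L2_inner L (v i) w)"
  unfolding L2_inner_def sum_distrib_right
  by (intro Bochner_Integration.integral_sum L2_mult_integrable assms)

lemma L2_inner_cong:
  assumes "L2_eq L v v'" "v \<in> L2_space L" "v' \<in> L2_space L" "w \<in> L2_space L"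
  shows "L2_inner L v w = L2_inner L v' w"
  unfolding L2_inner_def
proof (rule integral_cong_AE)
  show "AE x in lebesgue_on {0<..<L}. v x * w x = v' x * w x"
    using assms(1) unfolding L2_eq_def by eventually_elim simp
qed (use assms in \<open>auto intro!: borel_measurable_times dest: L2_spaceD\<close>)

lemma L2_inner_cong_on:
  assumes "\<And>x. x \<in> {0<..<L} \<Longrightarrow> v x = v' x" "\<And>x. x \<in> {0<..<L} \<Longrightarrow> w x = w' x"
  shows "L2_inner L v w = L2_inner L v' w'"
  unfolding L2_inner_def by (rule Bochner_Integration.integral_cong) (use assms in auto)

lemma L2_norm_cong_on:
  assumes "\<And>x. x \<in> {0<..<L} \<Longrightarrow> v x = v' x"
  shows "L2_norm L v = L2_norm L v'"
  unfolding L2_norm_def using L2_inner_cong_on[OF assms assms] by simp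

lemma L2_space_cong_on:
  assumes "\<And>x. x \<in> {0<..<L} \<Longrightarrow> v x = v' x"
  shows "v \<in> L2_space L \<longleftrightarrow> v' \<in> L2_space L"
proof -
  have "v \<in> borel_measurable (lebesgue_on {0<..<L}) \<longleftrightarrow> v' \<in> borel_measurable (lebesgue_on {0<..<L})"
    by (rule measurable_cong) (use assms in auto)
  moreover have "integrable (lebesgue_on {0<..<L}) (\<lambda>x. (v x)\<^sup>2) \<longleftrightarrow> integrable (lebesgue_on {0<..<L}) (\<lambda>x. (v' x)\<^sup>2)"
    by (rule Bochner_Integration.integrable_cong) (use assms in auto)
  ultimately show ?thesis by (simp add: L2_space_def)
qed

lemma L2_inner_self_nonneg: "L2_inner L v v \<ge> 0"
  by (simp add: L2_inner_def integral_nonneg_AE)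

lemma L2_norm_nonneg: "L2_norm L v \<ge> 0"
  by (simp add: L2_norm_def L2_inner_self_nonneg)

lemma L2_norm_power2: "(L2_norm L v)\<^sup>2 = L2_inner L v v"
  by (simp add: L2_norm_def L2_inner_self_nonneg)

lemma L2_inner_self_combination:
  assumes "v \<in> L2_space L" "w \<in> L2_space L"
  shows "L2_inner L (\<lambda>x. v x + s * w x) (\<lambda>x. v x + s * w x) =
    L2_inner L v v + 2 * s * L2_inner L v w + s\<^sup>2 * L2_inner L w w"
proof -
  note sw = L2_space_scale[OF assms(2), of s]
  note vsw = L2_space_add[OF assms(1) sw]
  have "L2_inner L z (\<lambda>x. v x + s * w x) = L2_inner L z v + s * L2_inner L z w" if "z \<in> L2_space L" for z
    using L2_inner_add_left[OF assms(1) sw that] L2_inner_scale_left[of L s w z] by (simp add: L2_inner_commute)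
  note right = this
  show ?thesis
    using L2_inner_add_left[OF assms(1) sw vsw] right[OF assms(1)] right[OF assms(2)]
      L2_inner_scale_left[of L s w "\<lambda>x. v x + s * w x"] L2_inner_commute[of L w v]
    by (simp add: power2_eq_square algebra_simps)
qed

lemma L2_cauchy_schwarz:
  assumes "v \<in> L2_space L" "w \<in> L2_space L"
  shows "\<bar>L2_inner L v w\<bar> \<le> L2_norm L v * L2_norm L w"
proof -
  define a b c where "a = L2_inner L v v" and "b = L2_inner L v w" and "c = L2_inner L w w"
  have q: "0 \<le> a + 2 * s * b + s\<^sup>2 * c" for s
    using L2_inner_self_nonneg[of L "\<lambda>x. v x + s * w x"] L2_inner_self_combination[OF assms, of s]
    by (simp add: a_def b_def c_def)
  have "b\<^sup>2 \<le> a * c"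
  proof (cases "c = 0")
    case True
    have "b = 0"
    proof (rule ccontr)
      assume "b \<noteq> 0"
      then have "2 * (- (a + 1) / (2 * b)) * b = - (a + 1)" by simp
      \<comment> \<open>at this value of \<open>s\<close> the quadratic \<open>q\<close>, linear for \<open>c = 0\<close>, equals \<open>-1\<close>\<close>
      then show False using q[of "- (a + 1) / (2 * b)"] True by simp
    qed
    then show ?thesis using True by simp
  next
    case False
    then have "c > 0" using L2_inner_self_nonneg[of L w] by (simp add: c_def)
    then show ?thesis using q[of "- b / c"] by (simp add: field_simps power2_eq_square)
  qed
  then have "sqrt (b\<^sup>2) \<le> sqrt (a * c)" by (rule real_sqrt_le_mono)
  then show ?thesis by (simp add: real_sqrt_mult L2_norm_def a_def b_def c_def)
qed

lemma L2_norm_triangle: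
  assumes "v \<in> L2_space L" "w \<in> L2_space L"
  shows "L2_norm L (\<lambda>x. v x + w x) \<le> L2_norm L v + L2_norm L w"
proof (rule power2_le_imp_le)
  have "(L2_norm L (\<lambda>x. v x + w x))\<^sup>2 = L2_inner L v v + 2 * L2_inner L v w + L2_inner L w w"
    using L2_inner_self_combination[OF assms, of 1] by (simp add: L2_norm_power2)
  also have "\<dots> \<le> (L2_norm L v)\<^sup>2 + 2 * (L2_norm L v * L2_norm L w) + (L2_norm L w)\<^sup>2"
    using L2_cauchy_schwarz[OF assms] by (simp add: L2_norm_power2 abs_le_iff)
  also have "\<dots> = (L2_norm L v + L2_norm L w)\<^sup>2" by (simp add: power2_sum)
  finally show "(L2_norm L (\<lambda>x. v x + w x))\<^sup>2 \<le> (L2_norm L v + L2_norm L w)\<^sup>2" .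
qed (simp add: L2_norm_nonneg)

lemma L2_norm_scale: "L2_norm L (\<lambda>x. c * w x) = \<bar>c\<bar> * L2_norm L w"
proof -
  have "L2_inner L (\<lambda>x. c * w x) (\<lambda>x. c * w x) = c\<^sup>2 * L2_inner L w w"
    using L2_inner_scale_left[of L c w "\<lambda>x. c * w x"] L2_inner_scale_left[of L c w w]
    by (simp add: L2_inner_commute power2_eq_square)
  then show ?thesis by (simp add: L2_norm_def real_sqrt_mult)
qed

lemma L2_norm_minus_commute: "L2_norm L (\<lambda>x. v x - w x) = L2_norm L (\<lambda>x. w x - v x)"
proof -
  have "(v x - w x) * (v x - w x) = (w x - v x) * (w x - v x)" for x by (simp add: algebra_simps)
  then show ?thesis by (simp add: L2_norm_def L2_inner_def)
qed

lemma L2_norm_diff_triangle: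
  assumes "u \<in> L2_space L" "v \<in> L2_space L" "w \<in> L2_space L"
  shows "L2_norm L (\<lambda>x. u x - w x) \<le> L2_norm L (\<lambda>x. u x - v x) + L2_norm L (\<lambda>x. v x - w x)"
  using L2_norm_triangle[OF L2_space_diff[OF assms(1,2)] L2_space_diff[OF assms(2,3)]] by simp

lemma bounded_measurable_L2:
  assumes "w \<in> borel_measurable (lebesgue_on {0<..<L})" "\<And>x. x \<in> {0<..<L} \<Longrightarrow> \<bar>w x\<bar> \<le> K" "L > 0"
  shows "w \<in> L2_space L" "L2_norm L w \<le> sqrt L * K"
proof -
  interpret finite_measure "lebesgue_on {0<..<L}"
    by (rule finite_measure_lebesgue_on) simp
  have K: "(w x)\<^sup>2 \<le> K\<^sup>2" if "x \<in> {0<..<L}" for x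
    using assms(2)[OF that] by (metis abs_le_square_iff abs_ge_self order_trans abs_of_nonneg abs_ge_zero)
  have int: "integrable (lebesgue_on {0<..<L}) (\<lambda>x. (w x)\<^sup>2)"
  proof (rule integrable_const_bound[where B = "K\<^sup>2"])
    show "AE x in lebesgue_on {0<..<L}. norm ((w x)\<^sup>2) \<le> K\<^sup>2"
      using K by (intro AE_I2) auto
    show "(\<lambda>x. (w x)\<^sup>2) \<in> borel_measurable (lebesgue_on {0<..<L})"
      using assms(1) by simp
  qed
  then show w: "w \<in> L2_space L" using assms(1) by (simp add: L2_space_def)
  have K0: "K \<ge> 0" using assms(2)[of "L / 2"] assms(3) by auto
  have "L2_inner L w w \<le> (\<integral>x. K\<^sup>2 \<partial>lebesgue_on {0<..<L})"
    unfolding L2_inner_def power2_eq_square[symmetric]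
    by (rule integral_mono[OF int]) (use K in auto)
  also have "\<dots> = L * K\<^sup>2" using \<open>L > 0\<close> by (simp add: measure_restrict_space)
  finally have "sqrt (L2_inner L w w) \<le> sqrt (L * K\<^sup>2)" by (rule real_sqrt_le_mono)
  then show "L2_norm L w \<le> sqrt L * K" using K0 by (simp add: L2_norm_def real_sqrt_mult)
qed

lemma continuous_bounded_interval:
  fixes w :: "real \<Rightarrow> real"
  assumes "continuous_on {0..L} w"
  obtains K where "\<And>x. x \<in> {0..L} \<Longrightarrow> \<bar>w x\<bar> \<le> K"
proof -
  have "bounded (w ` {0..L})" by (intro compact_imp_bounded compact_continuous_image assms) simp
  then obtain K where "\<forall>y\<in>w ` {0..L}. norm y \<le> K" by (auto simp: bounded_iff)
  then show ?thesis using that[of K] by auto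
qed

lemma continuous_on_imp_borel_measurable:
  fixes w :: "real \<Rightarrow> real"
  assumes "continuous_on {0..L} w"
  shows "w \<in> borel_measurable (lebesgue_on {0<..<L})"
  by (rule continuous_imp_measurable_on_sets_lebesgue[OF continuous_on_subset[OF assms]]) auto

lemma continuous_L2:
  assumes "continuous_on {0..L} w" "L > 0"
  shows "w \<in> L2_space L"
proof -
  obtain K where "\<And>x. x \<in> {0..L} \<Longrightarrow> \<bar>w x\<bar> \<le> K" using continuous_bounded_interval[OF assms(1)] by blast
  then show ?thesis using bounded_measurable_L2(1)[OF continuous_on_imp_borel_measurable[OF assms(1)], of K] assms(2) by auto
qed

lemma lebesgue_on_integral_FTC:
  fixes F f :: "real \<Rightarrow> real"
  assumes "L > 0" "continuous_on {0..L} f"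
    and "\<And>x. x \<in> {0..L} \<Longrightarrow> (F has_real_derivative f x) (at x within {0..L})"
  shows "(\<integral>x. f x \<partial>lebesgue_on {0<..<L}) = F L - F 0"
proof -
  have "integrable (lebesgue_on {0<..<L}) f"
    using L2_mult_integrable[OF continuous_L2[OF assms(2,1)] continuous_L2[of L "\<lambda>x. 1"]] assms(1) by simp
  then have "(\<integral>x. f x \<partial>lebesgue_on {0<..<L}) = integral {0<..<L} f"
    by (intro lebesgue_integral_eq_integral) auto
  also have "\<dots> = integral {0..L} f" by (simp add: integral_open_interval_real)
  also have "\<dots> = F L - F 0"
    using assms by (intro integral_unique fundamental_theorem_of_calculus)
      (auto simp: has_real_derivative_iff_has_vector_derivative)
  finally show ?thesis .
qed


section \<open>Orthonormal systems\<close>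

definition L2_orthonormal :: "real \<Rightarrow> (nat \<Rightarrow> real \<Rightarrow> real) \<Rightarrow> bool" where
  "L2_orthonormal L \<phi> \<longleftrightarrow> (\<forall>k\<ge>1. \<phi> k \<in> L2_space L) \<and>
     (\<forall>j\<ge>1. \<forall>k\<ge>1. L2_inner L (\<phi> j) (\<phi> k) = (if j = k then 1 else 0))"

lemma orthonormal_sum_coefficient:
  assumes "L2_orthonormal L \<phi>" "1 \<le> j"
  shows "L2_inner L (\<lambda>x. \<Sum>k=1..M. c k * \<phi> k x) (\<phi> j) = (if j \<le> M then c j else 0)"
proof -
  have "L2_inner L (\<lambda>x. \<Sum>k=1..M. c k * \<phi> k x) (\<phi> j) = (\<Sum>k=1..M. L2_inner L (\<lambda>x. c k * \<phi> k x) (\<phi> j))"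
    using assms by (intro L2_inner_sum_left) (auto simp: L2_orthonormal_def intro: L2_space_scale)
  also have "\<dots> = (\<Sum>k=1..M. if k = j then c k else 0)"
    using assms by (intro sum.cong) (auto simp: L2_inner_scale_left L2_orthonormal_def)
  finally show ?thesis using assms by (simp add: sum.delta)
qed

lemma orthonormal_sum_L2:
  assumes "L2_orthonormal L \<phi>"
  shows "(\<lambda>x. \<Sum>k=1..M. c k * \<phi> k x) \<in> L2_space L"
  using assms by (intro L2_space_sum L2_space_scale) (auto simp: L2_orthonormal_def)

lemma orthonormal_sum_inner:
  assumes "L2_orthonormal L \<phi>" "w \<in> L2_space L"
  shows "L2_inner L w (\<lambda>x. \<Sum>k=1..M. c k * \<phi> k x) = (\<Sum>k=1..M. c k * L2_inner L w (\<phi> k))"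
proof -
  have "L2_inner L (\<lambda>x. \<Sum>k=1..M. c k * \<phi> k x) w = (\<Sum>k=1..M. L2_inner L (\<lambda>x. c k * \<phi> k x) w)"
    using assms by (intro L2_inner_sum_left) (auto simp: L2_orthonormal_def intro: L2_space_scale)
  then show ?thesis by (simp add: L2_inner_scale_left L2_inner_commute)
qed

lemma orthonormal_sum_norm:
  assumes "L2_orthonormal L \<phi>"
  shows "(L2_norm L (\<lambda>x. \<Sum>k=1..M. c k * \<phi> k x))\<^sup>2 = (\<Sum>k=1..M. (c k)\<^sup>2)"
  unfolding L2_norm_power2 orthonormal_sum_inner[OF assms orthonormal_sum_L2[OF assms]]
proof (intro sum.cong refl)
  fix k assume "k \<in> {1..M}"
  then show "c k * L2_inner L (\<lambda>x. \<Sum>k=1..M. c k * \<phi> k x) (\<phi> k) = (c k)\<^sup>2"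
    using orthonormal_sum_coefficient[OF assms, of k c M] by (simp add: power2_eq_square)
qed

lemma L2_bessel_inequality:
  assumes "L2_orthonormal L \<phi>" "w \<in> L2_space L"
  shows "(\<Sum>k=1..M. (L2_inner L w (\<phi> k))\<^sup>2) \<le> (L2_norm L w)\<^sup>2"
proof -
  define p where "p x = (\<Sum>k=1..M. L2_inner L w (\<phi> k) * \<phi> k x)" for x
  define S where "S = (\<Sum>k=1..M. (L2_inner L w (\<phi> k))\<^sup>2)"
  have p: "p \<in> L2_space L" unfolding p_def[abs_def] by (rule orthonormal_sum_L2[OF assms(1)])
  have 1: "L2_inner L w p = S"
    unfolding p_def[abs_def] orthonormal_sum_inner[OF assms] by (simp add: S_def power2_eq_square)
  have 2: "L2_inner L p p = S"
    using orthonormal_sum_norm[OF assms(1)] by (simp add: p_def[abs_def] S_def L2_norm_power2)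
  have "0 \<le> L2_inner L w w + 2 * (- 1) * L2_inner L w p + (- 1)\<^sup>2 * L2_inner L p p"
    using L2_inner_self_nonneg[of L "\<lambda>x. w x + (- 1) * p x"] unfolding L2_inner_self_combination[OF assms(2) p, of "-1"] .
  then show ?thesis using 1 2 by (simp add: L2_norm_power2 S_def)
qed

definition in_closed_span :: "real \<Rightarrow> (nat \<Rightarrow> real \<Rightarrow> real) \<Rightarrow> (real \<Rightarrow> real) \<Rightarrow> bool" where
  "in_closed_span L \<phi> w \<longleftrightarrow> (\<forall>\<epsilon>>0. \<exists>M c. L2_norm L (\<lambda>x. w x - (\<Sum>k=1..M. c k * \<phi> k x)) < \<epsilon>)"

lemma sum_extend_coefficients:
  fixes c :: "nat \<Rightarrow> real"
  assumes "M \<le> M'"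
  shows "(\<Sum>k=1..M. c k * f k) = (\<Sum>k=1..M'. (if k \<le> M then c k else 0) * f k)"
  using assms by (intro sum.mono_neutral_cong_left) auto

lemma in_closed_span_combine:
  assumes on: "L2_orthonormal L \<phi>" and v: "in_closed_span L \<phi> v" "v \<in> L2_space L" and w: "in_closed_span L \<phi> w" "w \<in> L2_space L"
  shows "in_closed_span L \<phi> (\<lambda>x. v x + s * w x)"
  unfolding in_closed_span_def
proof (intro allI impI)
  fix \<epsilon> :: real assume "\<epsilon> > 0"
  then have pos: "\<epsilon> / 2 > 0" "\<epsilon> / (2 * (\<bar>s\<bar> + 1)) > 0" by auto
  obtain M c where c: "L2_norm L (\<lambda>x. v x - (\<Sum>k=1..M. c k * \<phi> k x)) < \<epsilon> / 2"
    using v(1)[unfolded in_closed_span_def, rule_format, OF pos(1)] by blast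
  obtain M' c' where c': "L2_norm L (\<lambda>x. w x - (\<Sum>k=1..M'. c' k * \<phi> k x)) < \<epsilon> / (2 * (\<bar>s\<bar> + 1))"
    using w(1)[unfolded in_closed_span_def, rule_format, OF pos(2)] by blast
  define p where "p x = (\<Sum>k=1..M. c k * \<phi> k x)" for x
  define p' where "p' x = (\<Sum>k=1..M'. c' k * \<phi> k x)" for x
  define d where "d k = (if k \<le> M then c k else 0) + s * (if k \<le> M' then c' k else 0)" for k
  have L2: "p \<in> L2_space L" "p' \<in> L2_space L"
    unfolding p_def[abs_def] p'_def[abs_def] by (intro orthonormal_sum_L2[OF on])+
  have sum: "(\<Sum>k=1..max M M'. d k * \<phi> k x) = p x + s * p' x" for x
    unfolding p_def p'_def sum_extend_coefficients[OF max.cobounded1[of M M']] sum_extend_coefficients[OF max.cobounded2[of M' M]]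
    by (simp add: d_def distrib_right sum.distrib sum_distrib_left mult.assoc)
  have "L2_norm L (\<lambda>x. (v x - p x) + s * (w x - p' x)) \<le> L2_norm L (\<lambda>x. v x - p x) + L2_norm L (\<lambda>x. s * (w x - p' x))"
    using v w L2 by (intro L2_norm_triangle L2_space_diff L2_space_scale)
  also have "L2_norm L (\<lambda>x. s * (w x - p' x)) = \<bar>s\<bar> * L2_norm L (\<lambda>x. w x - p' x)" by (rule L2_norm_scale)
  also have "L2_norm L (\<lambda>x. v x - p x) + \<bar>s\<bar> * L2_norm L (\<lambda>x. w x - p' x) < \<epsilon> / 2 + \<epsilon> / 2"
  proof (rule add_less_le_mono)
    show "L2_norm L (\<lambda>x. v x - p x) < \<epsilon> / 2" using c by (simp add: p_def)
    have "\<bar>s\<bar> * L2_norm L (\<lambda>x. w x - p' x) \<le> \<bar>s\<bar> * (\<epsilon> / (2 * (\<bar>s\<bar> + 1)))"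
      using c' by (intro mult_left_mono) (auto simp: p'_def)
    also have "\<dots> \<le> \<epsilon> / 2" using \<open>\<epsilon> > 0\<close> by (simp add: field_simps)
    finally show "\<bar>s\<bar> * L2_norm L (\<lambda>x. w x - p' x) \<le> \<epsilon> / 2" .
  qed
  finally have "L2_norm L (\<lambda>x. v x + s * w x - (\<Sum>k=1..max M M'. d k * \<phi> k x)) < \<epsilon>"
    unfolding sum by (simp add: algebra_simps)
  then show "\<exists>M c. L2_norm L (\<lambda>x. v x + s * w x - (\<Sum>k=1..M. c k * \<phi> k x)) < \<epsilon>" by blast
qed

text \<open>
Approximate \<open>w\<close> by a finite combination \<open>p\<close>. Then
\<open>(w, w) = (w - p, w) + (p, w)\<close>, where the first term is small and the second is at most \<open>B \<parallel>p\<parallel>\<close> by the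
Cauchy-Schwarz inequality for finite sums.
\<close>

lemma L2_norm_le_coefficients:
  assumes on: "L2_orthonormal L \<phi>" and w: "w \<in> L2_space L" "in_closed_span L \<phi> w" and "B \<ge> 0"
    and B: "\<And>M. (\<Sum>k=1..M. (L2_inner L w (\<phi> k))\<^sup>2) \<le> B\<^sup>2"
  shows "L2_norm L w \<le> B"
proof (rule field_le_epsilon)
  fix e :: real assume e: "e > 0"
  show "L2_norm L w \<le> B + e"
  proof (cases "L2_norm L w = 0")
    case True then show ?thesis using e \<open>B \<ge> 0\<close> by simp
  next
    case False
    define n where "n = L2_norm L w"
    have n: "n > 0" using False L2_norm_nonneg[of L w] by (simp add: n_def)
    \<comment> \<open>makes the error term \<open>\<epsilon> (n + B)\<close> below at most \<open>e n\<close>\<close>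
    define \<epsilon> where "\<epsilon> = e * n / (n + B + 1)"
    have \<epsilon>: "\<epsilon> > 0" using e n \<open>B \<ge> 0\<close> by (simp add: \<epsilon>_def)
    then obtain M c where Mc: "L2_norm L (\<lambda>x. w x - (\<Sum>k=1..M. c k * \<phi> k x)) < \<epsilon>"
      using w(2) unfolding in_closed_span_def by blast
    define p where "p x = (\<Sum>k=1..M. c k * \<phi> k x)" for x
    have p: "p \<in> L2_space L" unfolding p_def[abs_def] by (rule orthonormal_sum_L2[OF on])
    have d: "L2_norm L (\<lambda>x. w x - p x) < \<epsilon>" using Mc by (simp add: p_def)
    have np: "L2_norm L p \<le> n + \<epsilon>"
    proof -
      have "L2_norm L p \<le> L2_norm L w + L2_norm L (\<lambda>x. p x - w x)"
        using L2_norm_triangle[OF w(1) L2_space_diff[OF p w(1)]] by simp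
      then show ?thesis using d L2_norm_minus_commute[of L w p] by (simp add: n_def)
    qed
    have 1: "L2_inner L w p \<le> B * L2_norm L p"
    proof -
      have "L2_inner L w p = (\<Sum>k=1..M. c k * L2_inner L w (\<phi> k))"
        unfolding p_def[abs_def] by (rule orthonormal_sum_inner[OF on w(1)])
      also have "\<dots> \<le> sqrt ((\<Sum>k=1..M. (c k)\<^sup>2) * (\<Sum>k=1..M. (L2_inner L w (\<phi> k))\<^sup>2))"
        by (rule real_le_rsqrt) (rule Cauchy_Schwarz_ineq_sum)
      also have "\<dots> \<le> sqrt ((L2_norm L p)\<^sup>2 * B\<^sup>2)"
        using orthonormal_sum_norm[OF on, of c M] B[of M] by (intro real_sqrt_le_mono mult_mono) (auto simp: p_def[abs_def] sum_nonneg)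
      also have "\<dots> = B * L2_norm L p" using \<open>B \<ge> 0\<close> L2_norm_nonneg[of L p] by (simp add: real_sqrt_mult)
      finally show ?thesis .
    qed
    have 2: "L2_inner L (\<lambda>x. w x - p x) w \<le> \<epsilon> * n"
    proof -
      have "L2_inner L (\<lambda>x. w x - p x) w \<le> L2_norm L (\<lambda>x. w x - p x) * n"
        using L2_cauchy_schwarz[OF L2_space_diff[OF w(1) p] w(1)] by (simp add: n_def)
      also have "\<dots> \<le> \<epsilon> * n" using d n by (intro mult_right_mono) auto
      finally show ?thesis .
    qed
    have "n * n = L2_inner L (\<lambda>x. w x - p x) w + L2_inner L w p"
      using L2_inner_diff_left[OF w(1) p w(1)] L2_norm_power2[of L w] L2_inner_commute[of L p w]
      by (simp add: n_def power2_eq_square)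
    also have "\<dots> \<le> \<epsilon> * n + B * (n + \<epsilon>)"
      using 1 2 mult_left_mono[OF np \<open>B \<ge> 0\<close>] by linarith
    also have "\<dots> \<le> B * n + \<epsilon> * (n + B + 1)" using \<epsilon> by (simp add: algebra_simps)
    also have "\<dots> = (B + e) * n"
    proof -
      have "\<epsilon> * (n + B + 1) = e * n" using n \<open>B \<ge> 0\<close> by (simp add: \<epsilon>_def)
      then show ?thesis by (simp add: algebra_simps)
    qed
    finally show ?thesis using n by (simp add: n_def)
  qed
qed

section \<open>Dirichlet eigenfunctions on an interval\<close>

lemma eq_on_interval_of_zero_derivative:
  fixes F :: "real \<Rightarrow> real"
  assumes "L > 0" "\<And>x. x \<in> {0..L} \<Longrightarrow> (F has_real_derivative 0) (at x within {0..L})" "x \<in> {0..L}"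
  shows "F x = F 0"
proof -
  have "\<exists>c. \<forall>x\<in>{0..L}. F x = c"
    by (rule has_field_derivative_zero_constant) (use assms(2) in auto)
  then show ?thesis using assms(1,3) by auto
qed

text \<open>
If \<open>\<mu> \<le> 0\<close>, then \<open>\<psi> \<psi>'\<close> is nondecreasing and vanishes at both ends. So it vanishes identically, the
square of \<open>\<psi>\<close> is constant, and \<open>\<psi> = 0\<close>.
\<close>

lemma dirichlet_eigenvalue_pos:
  assumes L: "L > 0" and e: "dirichlet_eigenpair L \<mu> \<psi>"
  shows "\<mu> > 0"
proof (rule ccontr)
  assume "\<not> \<mu> > 0"
  then have \<mu>: "\<mu> \<le> 0" by simp
  obtain d\<psi> x0 where x0: "x0 \<in> {0..L}" "\<psi> x0 \<noteq> 0" and bc: "\<psi> 0 = 0" "\<psi> L = 0"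
    and d: "\<And>x. x \<in> {0..L} \<Longrightarrow> (\<psi> has_real_derivative d\<psi> x) (at x within {0..L})"
      "\<And>x. x \<in> {0..L} \<Longrightarrow> (d\<psi> has_real_derivative - \<mu> * \<psi> x) (at x within {0..L})"
    using e unfolding dirichlet_eigenpair_def by blast
  define g where "g x = \<psi> x * d\<psi> x" for x
  have g': "(g has_real_derivative (d\<psi> x)\<^sup>2 - \<mu> * (\<psi> x)\<^sup>2) (at x within {0..L})" if "x \<in> {0..L}" for x
    unfolding g_def[abs_def] by (rule derivative_eq_intros refl d that | simp add: power2_eq_square algebra_simps)+
  have mono: "g a \<le> g b" if "0 \<le> a" "a \<le> b" "b \<le> L" for a b
  proof (cases "a = b")
    case False
    then have "a < b" using that by simp
    have "((\<lambda>x. (d\<psi> x)\<^sup>2 - \<mu> * (\<psi> x)\<^sup>2) has_integral (g b - g a)) {a..b}"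
    proof (rule fundamental_theorem_of_calculus)
      fix x assume "x \<in> {a..b}"
      then show "(g has_vector_derivative (d\<psi> x)\<^sup>2 - \<mu> * (\<psi> x)\<^sup>2) (at x within {a..b})"
        using g'[of x] that
        by (auto simp: has_real_derivative_iff_has_vector_derivative intro: has_vector_derivative_within_subset)
    qed (use that in auto)
    then have "0 \<le> g b - g a"
      by (rule has_integral_nonneg) (use \<mu> in \<open>auto intro: order_trans[OF mult_nonpos_nonneg zero_le_power2]\<close>)
    then show ?thesis by simp
  qed simp
  have g0: "g x = 0" if "x \<in> {0..L}" for x
    using mono[of 0 x] mono[of x L] that bc by (auto simp: g_def)
  have "((\<lambda>x. (\<psi> x)\<^sup>2) has_real_derivative 0) (at x within {0..L})" if "x \<in> {0..L}" for x
  proof -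
    have "((\<lambda>x. (\<psi> x)\<^sup>2) has_real_derivative 2 * (\<psi> x * d\<psi> x)) (at x within {0..L})"
      by (rule derivative_eq_intros refl d that | simp)+
    moreover have "2 * (\<psi> x * d\<psi> x) = 0" using g0[OF that] by (simp add: g_def)
    ultimately show ?thesis by (simp only:)
  qed
  then have "(\<psi> x0)\<^sup>2 = (\<psi> 0)\<^sup>2" by (rule eq_on_interval_of_zero_derivative[OF L _ x0(1)])
  then show False using x0 bc by simp
qed

text \<open>
The difference \<open>D\<close> between \<open>\<psi>\<close> and the sine with the same initial data has the conserved energy
\<open>D'\<^sup>2 + \<mu> D\<^sup>2\<close>, which is zero at \<open>0\<close>.
\<close>

lemma dirichlet_eigenpair_sine:
  assumes L: "L > 0" and e: "dirichlet_eigenpair L \<mu> \<psi>"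
  obtains c :: real and m :: nat where "c \<noteq> 0" "m \<ge> 1" "sqrt \<mu> = real m * pi / L"
    "\<And>x. x \<in> {0..L} \<Longrightarrow> \<psi> x = c * sin (sqrt \<mu> * x)"
proof -
  have \<mu>: "\<mu> > 0" by (rule dirichlet_eigenvalue_pos[OF assms])
  obtain d\<psi> x0 where x0: "x0 \<in> {0..L}" "\<psi> x0 \<noteq> 0" and bc: "\<psi> 0 = 0" "\<psi> L = 0"
    and d: "\<And>x. x \<in> {0..L} \<Longrightarrow> (\<psi> has_real_derivative d\<psi> x) (at x within {0..L})"
      "\<And>x. x \<in> {0..L} \<Longrightarrow> (d\<psi> has_real_derivative - \<mu> * \<psi> x) (at x within {0..L})"
    using e unfolding dirichlet_eigenpair_def by blast
  define \<kappa> where "\<kappa> = sqrt \<mu>"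
  have \<kappa>: "\<kappa> > 0" "\<mu> = \<kappa> * \<kappa>" using \<mu> by (auto simp: \<kappa>_def)
  define c where "c = d\<psi> 0 / \<kappa>"
  define D where "D x = \<psi> x - c * sin (\<kappa> * x)" for x
  define D' where "D' x = d\<psi> x - c * \<kappa> * cos (\<kappa> * x)" for x
  have dD: "(D has_real_derivative D' x) (at x within {0..L})" if "x \<in> {0..L}" for x
    unfolding D_def[abs_def] D'_def by (rule derivative_eq_intros refl d that | simp)+
  have dD': "(D' has_real_derivative - \<mu> * D x) (at x within {0..L})" if "x \<in> {0..L}" for x
    unfolding D'_def[abs_def] D_def
    by (rule derivative_eq_intros refl d that | simp add: \<kappa>(2) algebra_simps)+
  have "(D' x)\<^sup>2 + \<mu> * (D x)\<^sup>2 = (D' 0)\<^sup>2 + \<mu> * (D 0)\<^sup>2" if "x \<in> {0..L}" for x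
  proof (rule eq_on_interval_of_zero_derivative[OF L _ that])
    fix x assume x: "x \<in> {0..L}"
    show "((\<lambda>x. (D' x)\<^sup>2 + \<mu> * (D x)\<^sup>2) has_real_derivative 0) (at x within {0..L})"
      by (rule derivative_eq_intros refl dD dD' x | simp)+
  qed
  moreover have "D 0 = 0" "D' 0 = 0" using bc \<kappa> by (auto simp: D_def D'_def c_def)
  ultimately have "D x = 0" if "x \<in> {0..L}" for x
    using that \<mu> by (auto simp: sum_power2_eq_zero_iff add_nonneg_eq_0_iff)
  then have \<psi>: "\<psi> x = c * sin (\<kappa> * x)" if "x \<in> {0..L}" for x using that by (simp add: D_def)
  have c: "c \<noteq> 0" using \<psi>[OF x0(1)] x0(2) by auto
  have "sin (\<kappa> * L) = 0" using \<psi>[of L] L bc c by simp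
  then obtain i :: int where i: "\<kappa> * L = of_int i * pi" by (auto simp: sin_zero_iff_int2)
  have "of_int i * pi > 0" using i \<kappa> L by (metis mult_pos_pos)
  then have "i > 0" using pi_gt_zero by (simp add: zero_less_mult_iff)
  then have "real (nat i) = of_int i" "nat i \<ge> 1" by auto
  then show ?thesis using that[of c "nat i"] c \<psi> i L by (auto simp: \<kappa>_def field_simps)
qed

lemma sine_dirichlet_eigenpair:
  assumes "L > 0" "m \<ge> 1"
  shows "dirichlet_eigenpair L ((real m * pi / L)\<^sup>2) (\<lambda>x. sin (real m * pi / L * x))"
  unfolding dirichlet_eigenpair_def
proof (intro conjI exI ballI)
  have e: "real m * pi / L * (L / (2 * real m)) = pi / 2" using assms by simp
  have "sin (real m * pi / L * (L / (2 * real m))) \<noteq> 0" unfolding e by simp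
  moreover have "L / (2 * real m) \<in> {0..L}" using assms by (simp add: field_simps)
  ultimately show "\<exists>x\<in>{0..L}. sin (real m * pi / L * x) \<noteq> 0" by blast
  have "real m * pi / L * L = real m * pi" using assms by simp
  then show "sin (real m * pi / L * L) = 0" by (simp only: sin_npi)
  fix x
  show "((\<lambda>x. sin (real m * pi / L * x)) has_real_derivative (\<lambda>x. real m * pi / L * cos (real m * pi / L * x)) x) (at x within {0..L})"
    using assms by (auto intro!: derivative_eq_intros)
  show "((\<lambda>x. real m * pi / L * cos (real m * pi / L * x)) has_real_derivative
     - ((real m * pi / L)\<^sup>2) * sin (real m * pi / L * x)) (at x within {0..L})"
    by (rule derivative_eq_intros refl | simp add: power2_eq_square)+
qed simp

lemma dirichlet_eigenpairs_sine:
  assumes L: "L > 0" and e: "dirichlet_eigenpairs L lam \<phi>" and k: "k \<ge> 1"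
  shows "(pi / L)\<^sup>2 \<le> lam k" "\<exists>c. c \<noteq> 0 \<and> (\<forall>x\<in>{0..L}. \<phi> k x = c * sin (sqrt (lam k) * x))"
    "sin (sqrt (lam k) * L) = 0" "\<phi> k \<in> L2_space L"
proof -
  have ep: "dirichlet_eigenpair L (lam k) (\<phi> k)" using e k by (simp add: dirichlet_eigenpairs_def)
  from dirichlet_eigenpair_sine[OF L ep] obtain c m where cm: "c \<noteq> 0" "m \<ge> (1::nat)" "sqrt (lam k) = real m * pi / L"
    "\<And>x. x \<in> {0..L} \<Longrightarrow> \<phi> k x = c * sin (sqrt (lam k) * x)" by metis
  have pos: "lam k > 0" by (rule dirichlet_eigenvalue_pos[OF L ep])
  have "pi / L \<le> sqrt (lam k)" using cm(2,3) L by (simp add: divide_right_mono)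
  then have "(pi / L)\<^sup>2 \<le> (sqrt (lam k))\<^sup>2" using L by (intro power_mono) auto
  then show "(pi / L)\<^sup>2 \<le> lam k" using pos by simp
  show "\<exists>c. c \<noteq> 0 \<and> (\<forall>x\<in>{0..L}. \<phi> k x = c * sin (sqrt (lam k) * x))" using cm by blast
  show "sin (sqrt (lam k) * L) = 0" using cm(3) L sin_npi[of m] by simp
  have "continuous_on {0..L} (\<lambda>x. c * sin (sqrt (lam k) * x))" by (intro continuous_intros)
  then have "(\<lambda>x. c * sin (sqrt (lam k) * x)) \<in> L2_space L" by (rule continuous_L2[OF _ L])
  then show "\<phi> k \<in> L2_space L" using L2_space_cong_on[of L "\<phi> k" "\<lambda>x. c * sin (sqrt (lam k) * x)"] cm(4) by auto
qed

lemma dirichlet_eigenpairs_orthonormal: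
  assumes "L > 0" "dirichlet_eigenpairs L lam \<phi>"
  shows "L2_orthonormal L \<phi>"
  using dirichlet_eigenpairs_sine(4)[OF assms] assms(2) by (auto simp: L2_orthonormal_def dirichlet_eigenpairs_def)


section \<open>Completeness of the sines\<close>

definition mode_sums :: "real \<Rightarrow> (nat \<Rightarrow> real \<Rightarrow> real) \<Rightarrow> (real \<Rightarrow> real) set" where
  "mode_sums L \<phi> = {q. \<exists>M c. \<forall>x\<in>{0<..<L}. q x = (\<Sum>k=1..M. c k * \<phi> k x)}"

lemma mode_sumsI:
  "(\<And>x. x \<in> {0<..<L} \<Longrightarrow> q x = (\<Sum>k=1..M. c k * \<phi> k x)) \<Longrightarrow> q \<in> mode_sums L \<phi>"
  by (auto simp: mode_sums_def)

lemma mode_sums_add: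
  assumes "p \<in> mode_sums L \<phi>" "q \<in> mode_sums L \<phi>"
  shows "(\<lambda>x. p x + s * q x) \<in> mode_sums L \<phi>"
proof -
  obtain M c M' c' where 1: "\<And>x. x \<in> {0<..<L} \<Longrightarrow> p x = (\<Sum>k=1..M. c k * \<phi> k x)"
    "\<And>x. x \<in> {0<..<L} \<Longrightarrow> q x = (\<Sum>k=1..M'. c' k * \<phi> k x)" using assms unfolding mode_sums_def by blast
  have "p x + s * q x = (\<Sum>k=1..max M M'. ((if k \<le> M then c k else 0) + s * (if k \<le> M' then c' k else 0)) * \<phi> k x)"
    if "x \<in> {0<..<L}" for x
    unfolding 1[OF that] sum_extend_coefficients[OF max.cobounded1[of M M']] sum_extend_coefficients[OF max.cobounded2[of M' M]]
    by (simp add: distrib_right sum.distrib sum_distrib_left mult.assoc)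
  then show ?thesis by (rule mode_sumsI)
qed

lemma mode_sums_zero: "(\<lambda>x. 0) \<in> mode_sums L \<phi>"
  by (auto simp: mode_sums_def intro!: exI[of _ 0])

lemma mode_sums_sum:
  "(\<And>i. i \<in> I \<Longrightarrow> p i \<in> mode_sums L \<phi>) \<Longrightarrow> (\<lambda>x. \<Sum>i\<in>I. s i * p i x) \<in> mode_sums L \<phi>"
proof (induction I rule: infinite_finite_induct)
  case (insert i I)
  then have "(\<lambda>x. (\<Sum>i\<in>I. s i * p i x) + s i * p i x) \<in> mode_sums L \<phi>"
    by (intro mode_sums_add) auto
  then show ?case using insert by (simp add: add.commute)
qed (auto intro: mode_sums_zero)

lemma sine_in_mode_sums:
  assumes L: "L > 0" and e: "dirichlet_eigenpairs L lam \<phi>"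
  shows "(\<lambda>x. sin (real m * (pi / L * x))) \<in> mode_sums L \<phi>"
proof (cases "m = 0")
  case True then show ?thesis by (simp add: mode_sums_zero)
next
  case False
  then have m: "m \<ge> 1" by simp
  have "\<exists>k\<ge>1. lam k = (real m * pi / L)\<^sup>2"
    using e sine_dirichlet_eigenpair[OF L m] by (auto simp: dirichlet_eigenpairs_def)
  then obtain k where k: "k \<ge> 1" "lam k = (real m * pi / L)\<^sup>2" by blast
  obtain c where c: "c \<noteq> 0" "\<And>x. x \<in> {0..L} \<Longrightarrow> \<phi> k x = c * sin (sqrt (lam k) * x)"
    using dirichlet_eigenpairs_sine(2)[OF L e k(1)] by blast
  have "sqrt (lam k) = real m * pi / L" using L by (simp add: k(2))
  then have "sin (real m * (pi / L * x)) = (\<Sum>i=1..k. (if i = k then 1 / c else 0) * \<phi> i x)" if "x \<in> {0<..<L}" for x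
  proof -
    have "(\<Sum>i=1..k. (if i = k then 1 / c else 0) * \<phi> i x) = (\<Sum>i=1..k. if i = k then 1 / c * \<phi> k x else 0)"
      by (intro sum.cong) auto
    also have "\<dots> = sin (real m * (pi / L * x))"
      using k(1) c that \<open>sqrt (lam k) = _\<close> by (simp add: sum.delta mult.assoc)
    finally show ?thesis by simp
  qed
  then show ?thesis by (rule mode_sumsI)
qed

text \<open>
Repeated use of \<open>2 sin(m y) cos y = sin((m+1) y) + sin((m-1) y)\<close>.
\<close>

lemma sine_cos_power_in_mode_sums:
  assumes L: "L > 0" and e: "dirichlet_eigenpairs L lam \<phi>"
  shows "(\<lambda>x. sin (real m * (pi / L * x)) * cos (pi / L * x) ^ i) \<in> mode_sums L \<phi>"
proof (induction i arbitrary: m)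
  case 0 then show ?case using sine_in_mode_sums[OF assms] by simp
next
  case (Suc i)
  show ?case
  proof (cases "m = 0")
    case True then show ?thesis by (simp add: mode_sums_zero)
  next
    case False
    have "sin (real m * y) * cos y = sin (real (m + 1) * y) / 2 + sin (real (m - 1) * y) / 2" for y
      using False by (simp add: of_nat_diff sin_add sin_diff algebra_simps add_divide_distrib diff_divide_distrib)
    note prod = this
    have eq: "sin (real m * y) * cos y ^ Suc i
        = (0 + 1 / 2 * (sin (real (m + 1) * y) * cos y ^ i)) + 1 / 2 * (sin (real (m - 1) * y) * cos y ^ i)" for y
    proof -
      have "sin (real m * y) * cos y ^ Suc i = (sin (real m * y) * cos y) * cos y ^ i" by simp
      then show ?thesis unfolding prod by (simp add: distrib_right)
    qed
    show ?thesis unfolding eq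
      by (intro mode_sums_add mode_sums_zero Suc.IH)
  qed
qed

text \<open>
With \<open>y = \<pi> x / L\<close>, a function with compact support in \<open>(0, L)\<close> has the form \<open>h(x) sin y\<close> with \<open>h\<close> continuous
up to the boundary, and \<open>h\<close> is a continuous function of \<open>cos y\<close>. By the Weierstrass theorem it is
uniformly close to a polynomial in \<open>cos y\<close>, and \<open>sin y\<close> times such a polynomial is a sine sum.
\<close>

lemma test_fun_approx:
  assumes L: "L > 0" and e: "dirichlet_eigenpairs L lam \<phi>" and \<psi>: "test_fun L \<psi>" and "\<epsilon> > 0"
  obtains q where "q \<in> mode_sums L \<phi>" "continuous_on {0..L} q" "\<And>x. x \<in> {0..L} \<Longrightarrow> \<bar>\<psi> x - q x\<bar> \<le> \<epsilon>"
proof -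
  obtain a b where ab: "0 < a" "b < L" "\<And>x. x \<notin> {a..b} \<Longrightarrow> \<psi> x = 0" using \<psi> by (auto simp: test_fun_def)
  have "((deriv ^^ 0) \<psi>) differentiable (at x)" for x using \<psi> unfolding test_fun_def by blast
  then have cont: "continuous_on UNIV \<psi>"
    by (simp add: continuous_on_eq_continuous_at differentiable_imp_continuous_within)
  define h where "h x = \<psi> x / sin (pi / L * x)" for x
  have sin_pos: "sin (pi / L * x) > 0" if "0 < x" "x < L" for x
    using that L by (intro sin_gt_zero) (auto simp: field_simps)
  have h0: "h x = 0" if "x \<notin> {a..b}" for x using ab(3)[OF that] by (simp add: h_def)
  have "continuous_on ({0..a/2} \<union> {a/2..(b+L)/2} \<union> {(b+L)/2..L}) h"
  proof (intro continuous_on_closed_Un)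
    show "continuous_on {0..a/2} h"
      using ab by (subst continuous_on_cong[OF refl, where g = "\<lambda>_. 0"]) (auto intro!: h0)
    show "continuous_on {(b+L)/2..L} h"
      using ab by (subst continuous_on_cong[OF refl, where g = "\<lambda>_. 0"]) (auto intro!: h0)
    have "sin (pi / L * x) \<noteq> 0" if "x \<in> {a/2..(b+L)/2}" for x
      using sin_pos[of x] that ab by auto
    then show "continuous_on {a/2..(b+L)/2} h"
      unfolding h_def by (intro continuous_on_divide continuous_on_subset[OF cont] continuous_intros) auto
  qed auto
  then have h_cont: "continuous_on {0..L} h" by (rule continuous_on_subset) auto
  have "continuous_on {-1..1} (\<lambda>c. h (L / pi * arccos c))"
  proof (rule continuous_on_compose2[OF h_cont])
    show "continuous_on {-1..1} (\<lambda>c. L / pi * arccos c)" by (intro continuous_intros) auto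
    have "L / pi * arccos c \<le> L" "0 \<le> L / pi * arccos c" if "c \<in> {-1..1}" for c
      using that L arccos_ubound[of c] arccos_lbound[of c] by (auto simp: field_simps)
    then show "(\<lambda>c. L / pi * arccos c) ` {-1..1} \<subseteq> {0..L}" by (intro image_subsetI) auto
  qed
  then obtain g where g: "real_polynomial_function g" "\<And>c. c \<in> {-1..1} \<Longrightarrow> \<bar>h (L / pi * arccos c) - g c\<bar> < \<epsilon>"
    using Stone_Weierstrass_real_polynomial_function[of "{-1..1::real}" "\<lambda>c. h (L / pi * arccos c)" \<epsilon>] \<open>\<epsilon> > 0\<close>
    by (metis compact_Icc)
  obtain A n where A: "g = (\<lambda>c. \<Sum>i\<le>n. A i * c ^ i)" using g(1) unfolding real_polynomial_function_iff_sum by blast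
  define q where "q x = (\<Sum>i\<le>n. A i * (sin (real 1 * (pi / L * x)) * cos (pi / L * x) ^ i))" for x
  show ?thesis
  proof
    show "q \<in> mode_sums L \<phi>"
      unfolding q_def[abs_def] by (intro mode_sums_sum sine_cos_power_in_mode_sums[OF L e])
    show "continuous_on {0..L} q" unfolding q_def[abs_def] by (intro continuous_intros)
    fix x assume x: "x \<in> {0..L}"
    define \<theta> where "\<theta> = pi / L * x"
    have \<theta>: "0 \<le> \<theta>" "\<theta> \<le> pi" using x L by (auto simp: \<theta>_def field_simps)
    have q: "q x = sin \<theta> * g (cos \<theta>)" by (simp add: q_def \<theta>_def A sum_distrib_left mult_ac)
    have xe: "L / pi * arccos (cos \<theta>) = x" using \<theta> L by (simp add: arccos_cos) (simp add: \<theta>_def)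
    have "\<psi> x = sin \<theta> * h x"
    proof (cases "0 < x \<and> x < L")
      case True then show ?thesis using sin_pos[of x] by (simp add: h_def \<theta>_def)
    next
      case False
      then have "x = 0 \<or> x = L" using x by auto
      then show ?thesis using ab by (auto simp: h0)
    qed
    then have "\<bar>\<psi> x - q x\<bar> = \<bar>sin \<theta>\<bar> * \<bar>h (L / pi * arccos (cos \<theta>)) - g (cos \<theta>)\<bar>"
      unfolding q xe by (simp add: abs_mult[symmetric] algebra_simps)
    also have "\<dots> \<le> 1 * \<epsilon>" using g(2)[of "cos \<theta>"] by (intro mult_mono) auto
    finally show "\<bar>\<psi> x - q x\<bar> \<le> \<epsilon>" by simp
  qed
qed

lemma H10_in_closed_span:
  assumes L: "L > 0" and e: "dirichlet_eigenpairs L lam \<phi>" and w: "w \<in> H10_space L"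
  shows "in_closed_span L \<phi> w"
  unfolding in_closed_span_def
proof (intro allI impI)
  fix \<epsilon> :: real assume \<epsilon>: "\<epsilon> > 0"
  have w2: "w \<in> L2_space L" using w by (simp add: H10_space_def)
  obtain dw where "\<And>e. e > 0 \<Longrightarrow> \<exists>\<psi>. test_fun L \<psi> \<and> L2_norm L (\<lambda>x. w x - \<psi> x) < e \<and> L2_norm L (\<lambda>x. dw x - deriv \<psi> x) < e"
    using w by (auto simp: H10_space_def)
  then obtain \<psi> where \<psi>: "test_fun L \<psi>" "L2_norm L (\<lambda>x. w x - \<psi> x) < \<epsilon> / 2"
    using \<epsilon> half_gt_zero by blast
  have "\<epsilon> / (4 * sqrt L) > 0" using \<epsilon> L by simp
  from test_fun_approx[OF L e \<psi>(1) this] obtain q where q: "q \<in> mode_sums L \<phi>" "continuous_on {0..L} q"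
    "\<And>x. x \<in> {0..L} \<Longrightarrow> \<bar>\<psi> x - q x\<bar> \<le> \<epsilon> / (4 * sqrt L)" by metis
  have "((deriv ^^ 0) \<psi>) differentiable (at x)" for x using \<psi>(1) unfolding test_fun_def by blast
  then have cont: "continuous_on {0..L} \<psi>"
    by (intro continuous_at_imp_continuous_on ballI) (simp add: differentiable_imp_continuous_within)
  note L2 = continuous_L2[OF cont L] continuous_L2[OF q(2) L]
  have "L2_norm L (\<lambda>x. \<psi> x - q x) \<le> sqrt L * (\<epsilon> / (4 * sqrt L))"
    by (rule bounded_measurable_L2(2)[OF L2_spaceD(1)[OF L2_space_diff[OF L2]] _ L]) (use q(3) in auto)
  also have "\<dots> < \<epsilon> / 2" using L \<epsilon> by simp
  finally have "L2_norm L (\<lambda>x. w x - q x) < \<epsilon>"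
    using L2_norm_diff_triangle[OF w2 L2] \<psi>(2) by simp
  moreover obtain M c where "\<And>x. x \<in> {0<..<L} \<Longrightarrow> q x = (\<Sum>k=1..M. c k * \<phi> k x)"
    using q(1) unfolding mode_sums_def by blast
  ultimately show "\<exists>M c. L2_norm L (\<lambda>x. w x - (\<Sum>k=1..M. c k * \<phi> k x)) < \<epsilon>"
    using L2_norm_cong_on[of L "\<lambda>x. w x - q x"] by (metis (no_types, lifting))
qed

section \<open>Smooth cutoffs and the coefficients of the second derivative\<close>

text \<open>
To show that a function is smooth it suffices to exhibit a family of functions that contains it and
is closed under differentiation.
\<close>

lemma iterated_deriv_in_family:
  assumes S: "\<And>g. g \<in> S \<Longrightarrow> \<exists>g'\<in>S. \<forall>x. (g has_real_derivative g' x) (at x)" and "g \<in> S"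
  shows "(deriv ^^ n) g \<in> S"
proof (induction n)
  case 0 then show ?case using assms by simp
next
  case (Suc n)
  obtain g' where "g' \<in> S" "\<And>x. ((deriv ^^ n) g has_real_derivative g' x) (at x)" using S[OF Suc] by blast
  moreover from this have "deriv ((deriv ^^ n) g) = g'" by (auto intro: DERIV_imp_deriv)
  ultimately show ?case by simp
qed

lemma iterated_deriv_differentiable:
  assumes S: "\<And>g. g \<in> S \<Longrightarrow> \<exists>g'\<in>S. \<forall>x. (g has_real_derivative g' x) (at x)" and "g \<in> S"
  shows "((deriv ^^ n) g) differentiable (at x)"
  using S[OF iterated_deriv_in_family[OF assms]] real_differentiable_def by blast

text \<open>
For every polynomial \<open>p\<close> the function \<open>p(1/y) exp(-1/y)\<close>, extended by \<open>0\<close> to \<open>y \<le> 0\<close>. The family is closed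
under differentiation, also at \<open>y = 0\<close>.
\<close>

definition flat :: "real poly \<Rightarrow> real \<Rightarrow> real" where
  "flat p y = (if y > 0 then poly p (1 / y) * exp (- 1 / y) else 0)"

lemma flat_nonpos: "y \<le> 0 \<Longrightarrow> flat p y = 0"
  by (simp add: flat_def)

lemma flat_tendsto_0: "(flat p \<longlongrightarrow> 0) (at_right 0)"
proof -
  have "((\<lambda>v. poly p v / exp v) \<longlongrightarrow> 0) at_top"
  proof -
    have "((\<lambda>v::real. \<Sum>i\<le>degree p. coeff p i * (v ^ i / exp v)) \<longlongrightarrow> (\<Sum>i\<le>degree p. coeff p i * 0)) at_top"
      by (intro tendsto_intros tendsto_power_div_exp_0)
    then show ?thesis by (simp add: poly_altdef sum_divide_distrib)
  qed
  then have "((\<lambda>y. poly p (inverse y) / exp (inverse y)) \<longlongrightarrow> 0) (at_right 0)"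
    by (rule filterlim_compose[OF _ filterlim_inverse_at_top_right])
  then show ?thesis
  proof (rule Lim_transform_eventually)
    have "\<forall>\<^sub>F y in at_right (0::real). 0 < y" by (simp add: eventually_at_right_less)
    then show "\<forall>\<^sub>F y in at_right 0. poly p (inverse y) / exp (inverse y) = flat p y"
      by eventually_elim (simp add: flat_def exp_minus divide_inverse)
  qed
qed

lemma flat_has_derivative:
  "(flat p has_real_derivative flat ([:0, 0, 1:] * (p - pderiv p)) y) (at y)"
proof -
  consider "y > 0" | "y < 0" | "y = 0" by linarith
  then show ?thesis
  proof cases
    case 1
    have "((\<lambda>y. poly p (1 / y) * exp (- 1 / y)) has_real_derivative
        poly (pderiv p) (1 / y) * (- 1 / y\<^sup>2) * exp (- 1 / y) + poly p (1 / y) * (exp (- 1 / y) * (1 / y\<^sup>2))) (at y)"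
    proof -
      have i: "((\<lambda>y. 1 / y) has_real_derivative - 1 / y\<^sup>2) (at y)"
        using 1 by (auto intro!: derivative_eq_intros simp: power2_eq_square)
      have j: "((\<lambda>y. - 1 / y) has_real_derivative 1 / y\<^sup>2) (at y)"
        using 1 by (auto intro!: derivative_eq_intros simp: power2_eq_square)
      show ?thesis
        using DERIV_mult[OF DERIV_chain2[OF poly_DERIV i] DERIV_chain2[OF DERIV_exp j], of p]
        by (simp add: mult_ac)
    qed
    moreover have "poly (pderiv p) (1 / y) * (- 1 / y\<^sup>2) * exp (- 1 / y) + poly p (1 / y) * (exp (- 1 / y) * (1 / y\<^sup>2))
      = flat ([:0, 0, 1:] * (p - pderiv p)) y"
      using 1 by (simp add: flat_def power2_eq_square field_simps)
    ultimately have "((\<lambda>y. poly p (1 / y) * exp (- 1 / y)) has_real_derivative flat ([:0, 0, 1:] * (p - pderiv p)) y) (at y)" by simp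
    then show ?thesis
      by (rule has_field_derivative_transform_within_open[where S = "{0<..}"]) (use 1 in \<open>auto simp: flat_def\<close>)
  next
    case 2
    have "((\<lambda>y::real. 0) has_real_derivative 0) (at y)" by simp
    then have "(flat p has_real_derivative 0) (at y)"
      by (rule has_field_derivative_transform_within_open[where S = "{..<0}"]) (use 2 in \<open>auto simp: flat_def\<close>)
    then show ?thesis using 2 by (simp add: flat_def)
  next
    case 3
    have "((\<lambda>h. (flat p (0 + h) - flat p 0) / h) \<longlongrightarrow> 0) (at 0)"
    proof (rule filterlim_split_at)
      show "((\<lambda>h. (flat p (0 + h) - flat p 0) / h) \<longlongrightarrow> 0) (at_left 0)"
      proof (rule tendsto_eventually)
        have "\<forall>\<^sub>F h in at_left (0::real). h < 0" by (simp add: eventually_at_filter)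
        then show "\<forall>\<^sub>F h in at_left 0. (flat p (0 + h) - flat p 0) / h = 0"
          by eventually_elim (simp add: flat_def)
      qed
      show "((\<lambda>h. (flat p (0 + h) - flat p 0) / h) \<longlongrightarrow> 0) (at_right 0)"
      proof (rule Lim_transform_eventually[OF flat_tendsto_0[of "pCons 0 p"]])
        have "\<forall>\<^sub>F h in at_right (0::real). 0 < h" by (simp add: eventually_at_filter)
        then show "\<forall>\<^sub>F h in at_right 0. flat (pCons 0 p) h = (flat p (0 + h) - flat p 0) / h"
          by eventually_elim (simp add: flat_def)
      qed
    qed
    then show ?thesis using 3 by (simp add: DERIV_def flat_def)
  qed
qed

text \<open>
All functions that occur as iterated derivatives of the truncated sines \<open>cut_sine\<close>.
\<close>

inductive_set cutoff_family :: "real \<Rightarrow> real \<Rightarrow> real \<Rightarrow> (real \<Rightarrow> real) set" for L j \<kappa> :: real where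
  flat: "(\<lambda>x. flat p (j * (x * (L - x)) - 1)) \<in> cutoff_family L j \<kappa>"
| const: "(\<lambda>x. c) \<in> cutoff_family L j \<kappa>"
| ident: "(\<lambda>x. x) \<in> cutoff_family L j \<kappa>"
| sin: "(\<lambda>x. sin (\<kappa> * x)) \<in> cutoff_family L j \<kappa>"
| cos: "(\<lambda>x. cos (\<kappa> * x)) \<in> cutoff_family L j \<kappa>"
| add: "f \<in> cutoff_family L j \<kappa> \<Longrightarrow> g \<in> cutoff_family L j \<kappa> \<Longrightarrow> (\<lambda>x. f x + g x) \<in> cutoff_family L j \<kappa>"
| mult: "f \<in> cutoff_family L j \<kappa> \<Longrightarrow> g \<in> cutoff_family L j \<kappa> \<Longrightarrow> (\<lambda>x. f x * g x) \<in> cutoff_family L j \<kappa>"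

lemma cutoff_derivative:
  "((\<lambda>x. flat p (j * (x * (L - x)) - 1)) has_real_derivative
     flat ([:0, 0, 1:] * (p - pderiv p)) (j * (x * (L - x)) - 1) * (j * L + (- 2 * j) * x)) (at x)"
proof -
  have "((\<lambda>x. j * (x * (L - x)) - 1) has_real_derivative j * L + (- 2 * j) * x) (at x)"
    by (rule derivative_eq_intros refl | simp add: algebra_simps)+
  from DERIV_chain2[OF flat_has_derivative this] show ?thesis .
qed

lemma cutoff_family_closed:
  assumes "f \<in> cutoff_family L j \<kappa>"
  shows "\<exists>g\<in>cutoff_family L j \<kappa>. \<forall>x. (f has_real_derivative g x) (at x)"
  using assms
proof induction
  case (flat p)
  show ?case
    by (intro bexI[of _ "\<lambda>x. flat ([:0, 0, 1:] * (p - pderiv p)) (j * (x * (L - x)) - 1) * (j * L + (- 2 * j) * x)"] allI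
        cutoff_derivative cutoff_family.intros)
next
  case (const c)
  show ?case by (intro bexI[of _ "\<lambda>x. 0"]) (auto intro: cutoff_family.intros)
next
  case ident
  show ?case by (intro bexI[of _ "\<lambda>x. 1"]) (auto intro: cutoff_family.intros)
next
  case sin
  have "((\<lambda>x. sin (\<kappa> * x)) has_real_derivative \<kappa> * cos (\<kappa> * x)) (at x)" for x
    by (auto intro!: derivative_eq_intros)
  then show ?case by (intro bexI[of _ "\<lambda>x. \<kappa> * cos (\<kappa> * x)"]) (auto intro: cutoff_family.intros)
next
  case cos
  have "((\<lambda>x. cos (\<kappa> * x)) has_real_derivative (- \<kappa>) * sin (\<kappa> * x)) (at x)" for x
    by (auto intro!: derivative_eq_intros)
  then show ?case by (intro bexI[of _ "\<lambda>x. (- \<kappa>) * sin (\<kappa> * x)"] cutoff_family.intros) auto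
next
  case (add f g)
  then obtain f' g' where "f' \<in> cutoff_family L j \<kappa>" "g' \<in> cutoff_family L j \<kappa>"
    "\<And>x. (f has_real_derivative f' x) (at x)" "\<And>x. (g has_real_derivative g' x) (at x)" by blast
  then show ?case by (intro bexI[of _ "\<lambda>x. f' x + g' x"] allI DERIV_add cutoff_family.intros)
next
  case (mult f g)
  then obtain f' g' where *: "f' \<in> cutoff_family L j \<kappa>" "g' \<in> cutoff_family L j \<kappa>"
    "\<And>x. (f has_real_derivative f' x) (at x)" "\<And>x. (g has_real_derivative g' x) (at x)" by blast
  show ?case
    by (intro bexI[of _ "\<lambda>x. f' x * g x + g' x * f x"] allI DERIV_mult * mult.hyps cutoff_family.intros)
qed

lemma test_fun_deriv:
  assumes "test_fun L \<psi>"
  shows "test_fun L (deriv \<psi>)"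
proof -
  obtain a b where ab: "0 < a" "b < L" "\<And>x. x \<notin> {a..b} \<Longrightarrow> \<psi> x = 0" using assms by (auto simp: test_fun_def)
  have "deriv \<psi> x = 0" if "x \<notin> {a..b}" for x
  proof (rule DERIV_imp_deriv)
    have "((\<lambda>x::real. 0::real) has_real_derivative 0) (at x)" by simp
    then show "(\<psi> has_real_derivative 0) (at x)"
      by (rule has_field_derivative_transform_within_open[where S = "- {a..b}"]) (use that ab in auto)
  qed
  moreover have "((deriv ^^ n) (deriv \<psi>)) differentiable (at x)" for n x
  proof -
    have "((deriv ^^ Suc n) \<psi>) differentiable (at x)" using assms unfolding test_fun_def by blast
    then show ?thesis by (simp only: funpow_Suc_right o_def)
  qed
  ultimately show ?thesis using ab unfolding test_fun_def by blast
qed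

lemma test_fun_has_derivative:
  assumes "test_fun L \<psi>"
  shows "(\<psi> has_real_derivative deriv \<psi> x) (at x)"
proof -
  have "((deriv ^^ 0) \<psi>) differentiable (at x)" using assms unfolding test_fun_def by blast
  then show ?thesis by (simp add: DERIV_deriv_iff_real_differentiable)
qed

lemma test_fun_continuous: "test_fun L \<psi> \<Longrightarrow> continuous_on S \<psi>"
  by (intro continuous_at_imp_continuous_on ballI DERIV_isCont[OF test_fun_has_derivative])

lemma test_fun_boundary: "test_fun L \<psi> \<Longrightarrow> \<psi> 0 = 0 \<and> \<psi> L = 0"
  by (auto simp: test_fun_def)

text \<open>
A test function that approximates the sine. The factor \<open>exp(-1/y)\<close> with \<open>y = (j+1) x (L-x) - 1\<close> vanishes
near the ends of the interval, where \<open>y \<le> 0\<close>, and tends to \<open>1\<close> at every interior point.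
\<close>

definition cut_sine :: "real \<Rightarrow> real \<Rightarrow> nat \<Rightarrow> real \<Rightarrow> real" where
  "cut_sine L \<kappa> j x = flat 1 (real (Suc j) * (x * (L - x)) - 1) * sin (\<kappa> * x)"

lemma cut_sine_test_fun:
  assumes L: "L > 0"
  shows "test_fun L (cut_sine L \<kappa> j)"
proof -
  define J where "J = real (Suc j)"
  have J: "J \<ge> 1" by (simp add: J_def)
  have "cut_sine L \<kappa> j \<in> cutoff_family L J \<kappa>"
    unfolding cut_sine_def[abs_def] J_def by (intro cutoff_family.intros)
  from iterated_deriv_differentiable[OF cutoff_family_closed this]
  have "((deriv ^^ n) (cut_sine L \<kappa> j)) differentiable (at x)" for n x .
  moreover define a where "a = 1 / (J * L)"
  have a: "a > 0" using J L by (simp add: a_def)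
  have "cut_sine L \<kappa> j x = 0" if out: "x \<notin> {a..L - a}" for x
  proof -
    have "x * (L - x) \<le> a * L"
    proof (cases "0 \<le> x \<and> x \<le> L")
      case True
      then consider "x \<le> a" | "L - x \<le> a" using out by (cases "a \<le> x") auto
      then show ?thesis
      proof cases
        case 1 then show ?thesis using True L a by (intro mult_mono) auto
      next
        case 2 
        have "x * (L - x) \<le> L * a" using 2 True L a by (intro mult_mono) auto
        then show ?thesis by (simp add: mult.commute)
      qed
    next
      case False
      then have "x * (L - x) \<le> 0" using L by (auto simp: mult_le_0_iff)
      then show ?thesis using a L by (smt (verit) mult_pos_pos)
    qed
    then have "J * (x * (L - x)) \<le> J * (a * L)" using J by simp
    also have "J * (a * L) = 1" using J L by (simp add: a_def)
    finally show ?thesis by (simp add: cut_sine_def flat_nonpos J_def)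
  qed
  ultimately show ?thesis unfolding test_fun_def using a by (metis diff_less_eq less_add_same_cancel1)
qed

lemma flat_1_bounds: "0 \<le> flat 1 y" "flat 1 y \<le> 1"
  by (auto simp: flat_def)

lemma flat_square: "y > 0 \<Longrightarrow> flat [:0, 0, 1:] y = exp (- 1 / y) / y\<^sup>2"
  by (simp add: flat_def power2_eq_square)

text \<open>
In terms of \<open>v = 1/y\<close> the left-hand side is \<open>(v + v\<^sup>2) exp(-v)\<close>.
\<close>

lemma flat_square_bound:
  assumes "y > - 1"
  shows "\<bar>(y + 1) * flat [:0, 0, 1:] y\<bar> \<le> 2"
proof (cases "y > 0")
  case True
  define v where "v = 1 / y"
  have v: "v > 0" using True by (simp add: v_def)
  have "1 + v + v\<^sup>2 / 2 \<le> exp v" using v by (intro exp_lower_Taylor_quadratic) auto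
  then have "v + v\<^sup>2 \<le> 2 * exp v" using v by simp
  then have "(v + v\<^sup>2) * exp (- v) \<le> 2" by (simp add: exp_minus field_simps)
  moreover have "(y + 1) * flat [:0, 0, 1:] y = (v + v\<^sup>2) * exp (- v)"
    using True by (simp add: flat_square v_def field_simps power2_eq_square)
  ultimately show ?thesis using v by simp
qed (simp add: flat_nonpos)

text \<open>
Since \<open>sin(\<kappa> L) = 0\<close>, both \<open>\<kappa> x\<close> and \<open>\<kappa> (L - x)\<close> are bounds, and the larger one of \<open>x\<close> and \<open>L - x\<close> is
at least \<open>L / 2\<close>.
\<close>

lemma sine_boundary_bound:
  fixes L \<kappa> x :: real
  assumes "L > 0" "\<kappa> > 0" "sin (\<kappa> * L) = 0" "0 < x" "x < L"
  shows "\<bar>sin (\<kappa> * x)\<bar> \<le> 2 * \<kappa> / L * (x * (L - x))"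
proof -
  have 1: "\<bar>sin (\<kappa> * x)\<bar> \<le> \<kappa> * x" using abs_sin_x_le_abs_x[of "\<kappa> * x"] assms by simp
  have "sin (\<kappa> * x) = sin (\<kappa> * L - \<kappa> * (L - x))" by (simp add: algebra_simps)
  also have "\<dots> = - (cos (\<kappa> * L) * sin (\<kappa> * (L - x)))" using assms(3) by (simp add: sin_diff)
  finally have "\<bar>sin (\<kappa> * x)\<bar> = \<bar>cos (\<kappa> * L)\<bar> * \<bar>sin (\<kappa> * (L - x))\<bar>" by (simp add: abs_mult)
  also have "\<dots> \<le> 1 * (\<kappa> * (L - x))"
    using abs_sin_x_le_abs_x[of "\<kappa> * (L - x)"] assms by (intro mult_mono) auto
  finally have 2: "\<bar>sin (\<kappa> * x)\<bar> \<le> \<kappa> * (L - x)" by simp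
  show ?thesis
  proof (cases "x \<le> L / 2")
    case True
    have "\<kappa> * x * 1 \<le> \<kappa> * x * (2 * (L - x) / L)" using assms True by (intro mult_left_mono) (auto simp: field_simps)
    then show ?thesis using 1 by (simp add: mult_ac)
  next
    case False
    have "\<kappa> * (L - x) * 1 \<le> \<kappa> * (L - x) * (2 * x / L)" using assms False by (intro mult_left_mono) (auto simp: field_simps)
    then show ?thesis using 2 by (simp add: mult_ac)
  qed
qed

lemma cut_sine_deriv:
  "deriv (cut_sine L \<kappa> j) x =
    flat [:0, 0, 1:] (real (Suc j) * (x * (L - x)) - 1) * (real (Suc j) * L + (- 2 * real (Suc j)) * x) * sin (\<kappa> * x)
    + \<kappa> * cos (\<kappa> * x) * flat 1 (real (Suc j) * (x * (L - x)) - 1)"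
proof (rule DERIV_imp_deriv)
  have s: "((\<lambda>x. sin (\<kappa> * x)) has_real_derivative \<kappa> * cos (\<kappa> * x)) (at x)"
    by (auto intro!: derivative_eq_intros)
  have "pderiv (1 :: real poly) = 0" by (simp add: pderiv_1)
  then show "(cut_sine L \<kappa> j has_real_derivative
    flat [:0, 0, 1:] (real (Suc j) * (x * (L - x)) - 1) * (real (Suc j) * L + (- 2 * real (Suc j)) * x) * sin (\<kappa> * x)
    + \<kappa> * cos (\<kappa> * x) * flat 1 (real (Suc j) * (x * (L - x)) - 1)) (at x)"
    unfolding cut_sine_def[abs_def]
    using DERIV_mult[OF cutoff_derivative[of 1 "real (Suc j)" L x] s] by simp
qed

text \<open>
The derivative of the cutoff factor grows like \<open>j + 1\<close> near the boundary, but there the sine is at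
most a multiple of \<open>x (L-x) = (y+1) / (j+1)\<close>.
\<close>

lemma cut_sine_deriv_bound:
  assumes "L > 0" "\<kappa> > 0" "sin (\<kappa> * L) = 0" "0 < x" "x < L"
  shows "\<bar>deriv (cut_sine L \<kappa> j) x\<bar> \<le> 5 * \<kappa>"
proof -
  define J where "J = real (Suc j)"
  define y where "y = J * (x * (L - x)) - 1"
  have J: "J > 0" by (simp add: J_def)
  have xx: "x * (L - x) > 0" using assms by simp
  have y: "y > -1" using xx J by (simp add: y_def)
  have f0: "flat [:0, 0, 1:] y \<ge> 0" by (simp add: flat_def)
  have "\<bar>flat [:0, 0, 1:] y * (J * L + (- 2 * J) * x) * sin (\<kappa> * x)\<bar> = flat [:0, 0, 1:] y * J * \<bar>L - 2 * x\<bar> * \<bar>sin (\<kappa> * x)\<bar>"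
  proof -
    have "J * L + (- 2 * J) * x = J * (L - 2 * x)" by (simp add: algebra_simps)
    then show ?thesis using f0 J by (simp add: abs_mult)
  qed
  also have "\<dots> \<le> flat [:0, 0, 1:] y * J * L * (2 * \<kappa> / L * (x * (L - x)))"
    using f0 J assms sine_boundary_bound[OF assms] by (intro mult_mono) (auto simp: abs_if)
  also have "\<dots> = 2 * \<kappa> * ((y + 1) * flat [:0, 0, 1:] y)" using assms by (simp add: y_def)
  also have "\<dots> \<le> 2 * \<kappa> * 2" using flat_square_bound[OF y] assms by (intro mult_left_mono) auto
  finally have 1: "\<bar>flat [:0, 0, 1:] y * (J * L + (- 2 * J) * x) * sin (\<kappa> * x)\<bar> \<le> 4 * \<kappa>" by simp
  have "\<bar>\<kappa> * cos (\<kappa> * x) * flat 1 y\<bar> \<le> \<kappa> * 1 * 1"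
    using assms flat_1_bounds[of y] unfolding abs_mult by (intro mult_mono) auto
  then show ?thesis using 1 unfolding cut_sine_deriv J_def[symmetric] y_def[symmetric] by linarith
qed

lemma cut_sine_limits:
  assumes "0 < x" "x < L"
  shows "(\<lambda>j. cut_sine L \<kappa> j x) \<longlonglongrightarrow> sin (\<kappa> * x)"
    and "(\<lambda>j. deriv (cut_sine L \<kappa> j) x) \<longlonglongrightarrow> \<kappa> * cos (\<kappa> * x)"
proof -
  define q where "q = x * (L - x)"
  have q: "q > 0" using assms by (simp add: q_def)
  define y where "y j = real (Suc j) * q - 1" for j
  have y_top: "filterlim y at_top sequentially"
    unfolding y_def using q by real_asymp
  have "((\<lambda>y. flat 1 y) \<longlongrightarrow> 1) at_top"
  proof (rule Lim_transform_eventually)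
    show "((\<lambda>y::real. exp (- 1 / y)) \<longlongrightarrow> 1) at_top" by real_asymp
    show "\<forall>\<^sub>F y in at_top. exp (- 1 / y) = flat 1 y"
      using eventually_gt_at_top[of 0] by eventually_elim (simp add: flat_def)
  qed
  from filterlim_compose[OF this y_top] have 1: "(\<lambda>j. flat 1 (y j)) \<longlonglongrightarrow> 1" .
  have "((\<lambda>y. (y + 1) * flat [:0, 0, 1:] y) \<longlongrightarrow> 0) at_top"
  proof (rule Lim_transform_eventually)
    show "((\<lambda>y::real. (y + 1) * (exp (- 1 / y) / y\<^sup>2)) \<longlongrightarrow> 0) at_top" by real_asymp
    show "\<forall>\<^sub>F y in at_top. (y + 1) * (exp (- 1 / y) / y\<^sup>2) = (y + 1) * flat [:0, 0, 1:] y"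
      using eventually_gt_at_top[of 0] by eventually_elim (simp add: flat_square)
  qed
  from filterlim_compose[OF this y_top] have 2: "(\<lambda>j. (y j + 1) * flat [:0, 0, 1:] (y j)) \<longlonglongrightarrow> 0" .
  have "(\<lambda>j. flat 1 (y j) * sin (\<kappa> * x)) \<longlonglongrightarrow> 1 * sin (\<kappa> * x)" by (intro tendsto_intros 1)
  then show "(\<lambda>j. cut_sine L \<kappa> j x) \<longlonglongrightarrow> sin (\<kappa> * x)" by (simp add: cut_sine_def y_def q_def)
  have eq: "deriv (cut_sine L \<kappa> j) x =
      ((y j + 1) * flat [:0, 0, 1:] (y j)) * ((L - 2 * x) * sin (\<kappa> * x) / q) + \<kappa> * cos (\<kappa> * x) * flat 1 (y j)" for j
  proof -
    have "real (Suc j) = (y j + 1) / q" using q by (simp add: y_def)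
    moreover have "real (Suc j) * L + (- 2 * real (Suc j)) * x = real (Suc j) * (L - 2 * x)" by (simp add: algebra_simps)
    ultimately show ?thesis unfolding cut_sine_deriv q_def[symmetric] y_def[symmetric] by simp
  qed
  have "(\<lambda>j. ((y j + 1) * flat [:0, 0, 1:] (y j)) * ((L - 2 * x) * sin (\<kappa> * x) / q) + \<kappa> * cos (\<kappa> * x) * flat 1 (y j))
      \<longlonglongrightarrow> 0 * ((L - 2 * x) * sin (\<kappa> * x) / q) + \<kappa> * cos (\<kappa> * x) * 1"
    by (intro tendsto_intros 1 2)
  then show "(\<lambda>j. deriv (cut_sine L \<kappa> j) x) \<longlonglongrightarrow> \<kappa> * cos (\<kappa> * x)" unfolding eq by simp
qed

lemma L2_inner_bounded_limit:
  assumes L: "L > 0" and w: "w \<in> L2_space L" and g: "\<And>j. continuous_on {0..L} (g j)" and h: "continuous_on {0..L} h"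
    and bd: "\<And>j x. 0 < x \<Longrightarrow> x < L \<Longrightarrow> \<bar>g j x\<bar> \<le> K" and lim: "\<And>x. 0 < x \<Longrightarrow> x < L \<Longrightarrow> (\<lambda>j. g j x) \<longlonglongrightarrow> h x"
  shows "(\<lambda>j. L2_inner L w (g j)) \<longlonglongrightarrow> L2_inner L w h"
  unfolding L2_inner_def
proof (rule integral_dominated_convergence[where w = "\<lambda>x. \<bar>w x * K\<bar>"])
  show "integrable (lebesgue_on {0<..<L}) (\<lambda>x. \<bar>w x * K\<bar>)"
    by (intro integrable_abs L2_mult_integrable w continuous_L2 L continuous_on_const)
  show "AE x in lebesgue_on {0<..<L}. (\<lambda>j. w x * g j x) \<longlonglongrightarrow> w x * h x"
    by (rule AE_I2) (auto intro!: tendsto_intros lim)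
  show "AE x in lebesgue_on {0<..<L}. norm (w x * g j x) \<le> \<bar>w x * K\<bar>" for j
  proof (rule AE_I2)
    fix x assume "x \<in> space (lebesgue_on {0<..<L})"
    then have "\<bar>g j x\<bar> \<le> \<bar>K\<bar>" using bd[of x j] by simp
    then show "norm (w x * g j x) \<le> \<bar>w x * K\<bar>" by (simp add: abs_mult mult_left_mono)
  qed
qed (intro borel_measurable_times L2_spaceD(1)[OF w] continuous_on_imp_borel_measurable g h)+

text \<open>
Integration by parts against \<open>\<kappa> cos(\<kappa> x)\<close>; the boundary terms vanish with the test function.
\<close>

lemma test_fun_sine_parts:
  assumes L: "L > 0" and \<psi>: "test_fun L \<psi>"
  shows "\<kappa>\<^sup>2 * L2_inner L \<psi> (\<lambda>x. sin (\<kappa> * x)) = L2_inner L (deriv \<psi>) (\<lambda>x. \<kappa> * cos (\<kappa> * x))"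
proof -
  define s where "s x = sin (\<kappa> * x)" for x
  define s' where "s' x = \<kappa> * cos (\<kappa> * x)" for x
  have c: "continuous_on {0..L} \<psi>" "continuous_on {0..L} (deriv \<psi>)" "continuous_on {0..L} s" "continuous_on {0..L} s'"
    using test_fun_continuous[OF \<psi>] test_fun_continuous[OF test_fun_deriv[OF \<psi>]]
    unfolding s_def s'_def by (auto intro!: continuous_intros)
  note L2 = c[THEN continuous_L2, OF L]
  have "(\<integral>x. deriv \<psi> x * s' x + \<psi> x * (- \<kappa>\<^sup>2 * s x) \<partial>lebesgue_on {0<..<L}) = \<psi> L * s' L - \<psi> 0 * s' 0"
  proof (rule lebesgue_on_integral_FTC[OF L])
    show "continuous_on {0..L} (\<lambda>x. deriv \<psi> x * s' x + \<psi> x * (- \<kappa>\<^sup>2 * s x))" using c by (intro continuous_intros)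
    fix x
    have "(s' has_real_derivative - \<kappa>\<^sup>2 * s x) (at x)"
      unfolding s'_def[abs_def] s_def by (rule derivative_eq_intros refl | simp add: power2_eq_square)+
    from DERIV_mult[OF test_fun_has_derivative[OF \<psi>] this]
    show "((\<lambda>x. \<psi> x * s' x) has_real_derivative deriv \<psi> x * s' x + \<psi> x * (- \<kappa>\<^sup>2 * s x)) (at x within {0..L})"
      by (simp add: has_field_derivative_at_within mult.commute)
  qed
  also have "\<dots> = 0" using test_fun_boundary[OF \<psi>] by simp
  also have "(\<integral>x. deriv \<psi> x * s' x + \<psi> x * (- \<kappa>\<^sup>2 * s x) \<partial>lebesgue_on {0<..<L})
      = L2_inner L (deriv \<psi>) s' + L2_inner L \<psi> (\<lambda>x. - \<kappa>\<^sup>2 * s x)"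
    unfolding L2_inner_def by (intro Bochner_Integration.integral_add L2_mult_integrable L2 L2_space_scale)
  also have "L2_inner L \<psi> (\<lambda>x. - \<kappa>\<^sup>2 * s x) = - \<kappa>\<^sup>2 * L2_inner L \<psi> s"
    using L2_inner_scale_left[of L "- \<kappa>\<^sup>2" s \<psi>] by (simp add: L2_inner_commute)
  finally show ?thesis by (simp add: s_def[abs_def] s'_def[abs_def])
qed

lemma H10_sine_parts:
  assumes L: "L > 0" and w: "w \<in> L2_space L" "dw \<in> L2_space L"
    and approx: "\<And>e. e > 0 \<Longrightarrow> \<exists>\<psi>. test_fun L \<psi> \<and> L2_norm L (\<lambda>x. w x - \<psi> x) < e \<and> L2_norm L (\<lambda>x. dw x - deriv \<psi> x) < e"
  shows "\<kappa>\<^sup>2 * L2_inner L w (\<lambda>x. sin (\<kappa> * x)) = L2_inner L dw (\<lambda>x. \<kappa> * cos (\<kappa> * x))"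
proof -
  define s where "s x = sin (\<kappa> * x)" for x
  define s' where "s' x = \<kappa> * cos (\<kappa> * x)" for x
  have L2s: "s \<in> L2_space L" "s' \<in> L2_space L"
    unfolding s_def[abs_def] s'_def[abs_def] by (intro continuous_L2 L continuous_intros)+
  define D where "D = \<kappa>\<^sup>2 * L2_inner L w s - L2_inner L dw s'"
  define K where "K = \<kappa>\<^sup>2 * L2_norm L s + L2_norm L s' + 1"
  have K: "K > 0" using L2_norm_nonneg[of L s] L2_norm_nonneg[of L s'] by (simp add: K_def add_nonneg_pos)
  have "\<bar>D\<bar> \<le> e * K" if e: "e > 0" for e
  proof -
    obtain \<psi> where \<psi>: "test_fun L \<psi>" "L2_norm L (\<lambda>x. w x - \<psi> x) < e" "L2_norm L (\<lambda>x. dw x - deriv \<psi> x) < e"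
      using approx[OF e] by blast
    have L2: "\<psi> \<in> L2_space L" "deriv \<psi> \<in> L2_space L"
      using \<psi>(1) by (auto intro!: continuous_L2 L test_fun_continuous test_fun_deriv)
    have "D = \<kappa>\<^sup>2 * L2_inner L (\<lambda>x. w x - \<psi> x) s - L2_inner L (\<lambda>x. dw x - deriv \<psi> x) s'"
      using test_fun_sine_parts[OF L \<psi>(1), of \<kappa>] L2_inner_diff_left[OF w(1) L2(1) L2s(1)] L2_inner_diff_left[OF w(2) L2(2) L2s(2)]
      by (simp add: D_def s_def[abs_def] s'_def[abs_def] right_diff_distrib)
    then have "\<bar>D\<bar> \<le> \<kappa>\<^sup>2 * \<bar>L2_inner L (\<lambda>x. w x - \<psi> x) s\<bar> + \<bar>L2_inner L (\<lambda>x. dw x - deriv \<psi> x) s'\<bar>"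
      using abs_triangle_ineq4[of "\<kappa>\<^sup>2 * L2_inner L (\<lambda>x. w x - \<psi> x) s"] by (simp add: abs_mult)
    also have "\<dots> \<le> \<kappa>\<^sup>2 * (e * L2_norm L s) + e * L2_norm L s'"
    proof (intro add_mono mult_left_mono)
      show "\<bar>L2_inner L (\<lambda>x. w x - \<psi> x) s\<bar> \<le> e * L2_norm L s"
        using L2_cauchy_schwarz[OF L2_space_diff[OF w(1) L2(1)] L2s(1)] mult_right_mono[OF less_imp_le[OF \<psi>(2)] L2_norm_nonneg[of L s]] by linarith
      show "\<bar>L2_inner L (\<lambda>x. dw x - deriv \<psi> x) s'\<bar> \<le> e * L2_norm L s'"
        using L2_cauchy_schwarz[OF L2_space_diff[OF w(2) L2(2)] L2s(2)] mult_right_mono[OF less_imp_le[OF \<psi>(3)] L2_norm_nonneg[of L s']] by linarith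
    qed simp
    also have "\<dots> \<le> e * K" using e by (simp add: K_def algebra_simps)
    finally show ?thesis .
  qed
  then have "\<bar>D\<bar> \<le> 0 + e" if "e > 0" for e
    using that K by (metis add_0 divide_pos_pos nonzero_eq_divide_eq less_irrefl)
  then have "\<bar>D\<bar> \<le> 0" by (rule field_le_epsilon)
  then show ?thesis by (simp add: D_def s_def[abs_def] s'_def[abs_def])
qed

text \<open>
Two integrations by parts. The first moves one derivative to \<open>w\<close> and is legitimate since \<open>w\<close> is an \<open>H\<^sup>1\<close>
limit of test functions. In the second the cosine must be the derivative of a test function, so the
sine is replaced by \<open>cut_sine\<close> and \<open>j\<close> tends to infinity. The weak derivatives provided by the two
spaces may differ on a null set, but both pair in the same way with the derivative of \<open>cut_sine\<close>,
which is itself a test function.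
\<close>

lemma H2_H10_sine_coefficient:
  assumes L: "L > 0" and w: "w \<in> H2_space L" "w \<in> H10_space L"
  obtains ddw where "ddw \<in> L2_space L"
    "\<And>\<kappa>. \<kappa> > 0 \<Longrightarrow> sin (\<kappa> * L) = 0 \<Longrightarrow> \<kappa>\<^sup>2 * L2_inner L w (\<lambda>x. sin (\<kappa> * x)) = - L2_inner L ddw (\<lambda>x. sin (\<kappa> * x))"
proof -
  obtain dw ddw where H2: "dw \<in> L2_space L" "ddw \<in> L2_space L" "weak_deriv L w dw" "weak_deriv L dw ddw"
    using w(1) unfolding H2_space_def by blast
  obtain dw' where H1: "dw' \<in> L2_space L" "weak_deriv L w dw'"
    "\<And>e. e > 0 \<Longrightarrow> \<exists>\<psi>. test_fun L \<psi> \<and> L2_norm L (\<lambda>x. w x - \<psi> x) < e \<and> L2_norm L (\<lambda>x. dw' x - deriv \<psi> x) < e"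
    using w(2) unfolding H10_space_def by blast
  have w2: "w \<in> L2_space L" using w(1) by (simp add: H2_space_def)
  show ?thesis
  proof (rule that[OF H2(2)])
    fix \<kappa> :: real assume \<kappa>: "\<kappa> > 0" "sin (\<kappa> * L) = 0"
    let ?\<eta> = "cut_sine L \<kappa>"
    have t: "test_fun L (?\<eta> j)" "test_fun L (deriv (?\<eta> j))" for j
      using cut_sine_test_fun[OF L] test_fun_deriv by auto
    have eq: "L2_inner L dw' (deriv (?\<eta> j)) = - L2_inner L ddw (?\<eta> j)" for j
    proof -
      have "L2_inner L dw' (deriv (?\<eta> j)) = L2_inner L dw (deriv (?\<eta> j))"
        using H1(2) H2(3) t(2)[of j] unfolding weak_deriv_def by (metis minus_equation_iff)
      then show ?thesis using H2(4) t(1)[of j] unfolding weak_deriv_def by auto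
    qed
    have l1: "(\<lambda>j. L2_inner L dw' (deriv (?\<eta> j))) \<longlonglongrightarrow> L2_inner L dw' (\<lambda>x. \<kappa> * cos (\<kappa> * x))"
      by (rule L2_inner_bounded_limit[OF L H1(1), where K = "5 * \<kappa>"])
        (auto intro!: continuous_intros test_fun_continuous[OF t(2)] cut_sine_deriv_bound[OF L \<kappa>] cut_sine_limits)
    have l2: "(\<lambda>j. L2_inner L ddw (?\<eta> j)) \<longlonglongrightarrow> L2_inner L ddw (\<lambda>x. sin (\<kappa> * x))"
    proof (rule L2_inner_bounded_limit[OF L H2(2), where K = 1])
      show "\<bar>?\<eta> j x\<bar> \<le> 1" for j x
        using mult_mono[of "\<bar>flat 1 (real (Suc j) * (x * (L - x)) - 1)\<bar>" 1 "\<bar>sin (\<kappa> * x)\<bar>" 1] flat_1_bounds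
        by (simp add: cut_sine_def abs_mult)
    qed (auto intro!: continuous_intros test_fun_continuous[OF t(1)] cut_sine_limits)
    have "L2_inner L dw' (\<lambda>x. \<kappa> * cos (\<kappa> * x)) = - L2_inner L ddw (\<lambda>x. sin (\<kappa> * x))"
      using LIMSEQ_unique[OF l1[unfolded eq] tendsto_minus[OF l2]] .
    then show "\<kappa>\<^sup>2 * L2_inner L w (\<lambda>x. sin (\<kappa> * x)) = - L2_inner L ddw (\<lambda>x. sin (\<kappa> * x))"
      using H10_sine_parts[OF L w2 H1(1) H1(3), of \<kappa>] by simp
  qed
qed

section \<open>From the modes to the error in the mean square norm\<close>

lemma L2_eq_norm_zero:
  assumes "L2_eq L v w"
  shows "L2_norm L (\<lambda>x. v x - w x) = 0"
proof -
  have "AE x in lebesgue_on {0<..<L}. (v x - w x) * (v x - w x) = 0"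
    using assms unfolding L2_eq_def by eventually_elim simp
  then have "L2_inner L (\<lambda>x. v x - w x) (\<lambda>x. v x - w x) = 0"
    unfolding L2_inner_def by (rule integral_eq_zero_AE)
  then show ?thesis by (simp add: L2_norm_def)
qed

lemma L2_sums_modes:
  assumes on: "L2_orthonormal L \<phi>" and s: "L2_sums L (\<lambda>n x. c n * \<phi> n x) s"
  shows "s \<in> L2_space L" "in_closed_span L \<phi> s" "1 \<le> k \<Longrightarrow> L2_inner L s (\<phi> k) = c k"
proof -
  show s2: "s \<in> L2_space L" using s by (simp add: L2_sums_def)
  have lim: "(\<lambda>M. L2_norm L (\<lambda>x. (\<Sum>n=1..M. c n * \<phi> n x) - s x)) \<longlonglongrightarrow> 0" using s by (simp add: L2_sums_def)
  show "in_closed_span L \<phi> s"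
    unfolding in_closed_span_def
  proof (intro allI impI)
    fix \<epsilon> :: real assume "\<epsilon> > 0"
    then obtain M where "L2_norm L (\<lambda>x. (\<Sum>n=1..M. c n * \<phi> n x) - s x) < \<epsilon>"
      using order_tendstoD(2)[OF lim] by (auto simp: eventually_sequentially)
    then show "\<exists>M c. L2_norm L (\<lambda>x. s x - (\<Sum>k=1..M. c k * \<phi> k x)) < \<epsilon>"
      by (subst (asm) L2_norm_minus_commute) blast
  qed
  assume k: "1 \<le> k"
  have \<phi>k: "\<phi> k \<in> L2_space L" using on k by (simp add: L2_orthonormal_def)
  have "(\<lambda>M. L2_norm L (\<lambda>x. (\<Sum>n=1..M. c n * \<phi> n x) - s x) * L2_norm L (\<phi> k)) \<longlonglongrightarrow> 0 * L2_norm L (\<phi> k)"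
    by (intro tendsto_intros lim)
  then have g: "(\<lambda>M. L2_norm L (\<lambda>x. (\<Sum>n=1..M. c n * \<phi> n x) - s x) * L2_norm L (\<phi> k)) \<longlonglongrightarrow> 0" by simp
  have "(\<lambda>M. L2_inner L (\<lambda>x. (\<Sum>n=1..M. c n * \<phi> n x) - s x) (\<phi> k)) \<longlonglongrightarrow> 0"
  proof (rule Lim_null_comparison[OF always_eventually g], rule allI)
    fix M
    show "norm (L2_inner L (\<lambda>x. (\<Sum>n=1..M. c n * \<phi> n x) - s x) (\<phi> k))
        \<le> L2_norm L (\<lambda>x. (\<Sum>n=1..M. c n * \<phi> n x) - s x) * L2_norm L (\<phi> k)"
      unfolding real_norm_def by (rule L2_cauchy_schwarz[OF L2_space_diff[OF orthonormal_sum_L2[OF on] s2] \<phi>k])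
  qed
  moreover have "\<forall>\<^sub>F M in sequentially. L2_inner L (\<lambda>x. (\<Sum>n=1..M. c n * \<phi> n x) - s x) (\<phi> k) = c k - L2_inner L s (\<phi> k)"
    using eventually_ge_at_top[of k]
  proof eventually_elim
    case (elim M)
    then show ?case
      unfolding L2_inner_diff_left[OF orthonormal_sum_L2[OF on] s2 \<phi>k] orthonormal_sum_coefficient[OF on k] by simp
  qed
  ultimately have "(\<lambda>M. c k - L2_inner L s (\<phi> k)) \<longlonglongrightarrow> 0"
    by (rule Lim_transform_eventually)
  from LIMSEQ_unique[OF this tendsto_const] show "L2_inner L s (\<phi> k) = c k" by simp
qed

lemma in_closed_span_cong:
  assumes on: "L2_orthonormal L \<phi>" and "L2_eq L v w" "v \<in> L2_space L" "w \<in> L2_space L" "in_closed_span L \<phi> w"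
  shows "in_closed_span L \<phi> v"
  unfolding in_closed_span_def
proof (intro allI impI)
  fix \<epsilon> :: real assume "\<epsilon> > 0"
  then obtain M c where Mc: "L2_norm L (\<lambda>x. w x - (\<Sum>k=1..M. c k * \<phi> k x)) < \<epsilon>"
    using assms(5) unfolding in_closed_span_def by blast
  have "L2_norm L (\<lambda>x. v x - (\<Sum>k=1..M. c k * \<phi> k x)) \<le> L2_norm L (\<lambda>x. v x - w x) + L2_norm L (\<lambda>x. w x - (\<Sum>k=1..M. c k * \<phi> k x))"
    by (rule L2_norm_diff_triangle[OF assms(3,4) orthonormal_sum_L2[OF on]])
  then have "L2_norm L (\<lambda>x. v x - (\<Sum>k=1..M. c k * \<phi> k x)) < \<epsilon>"
    using Mc L2_eq_norm_zero[OF assms(2)] by simp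
  then show "\<exists>M c. L2_norm L (\<lambda>x. v x - (\<Sum>k=1..M. c k * \<phi> k x)) < \<epsilon>" by blast
qed

lemma wave_solution_modes:
  assumes on: "L2_orthonormal L \<phi>" and u: "wave_solution L T lam \<phi> \<alpha> a0 a1 f u" and t: "0 \<le> t" "t \<le> T"
  shows "u t \<in> L2_space L" "in_closed_span L \<phi> (u t)"
    "1 \<le> k \<Longrightarrow> L2_inner L (u t) (\<phi> k) = mode_u \<alpha> (lam k) (L2_inner L a0 (\<phi> k))
      (L2_inner L a1 (\<phi> k) + Gamma (2 - \<alpha>) * L2_inner L f (\<phi> k)) t"
proof -
  define c where "c n = mittag_leffler \<alpha> 1 (- lam n * t powr \<alpha>) * L2_inner L a0 (\<phi> n)" for n
  define d where "d n = t * mittag_leffler \<alpha> 2 (- lam n * t powr \<alpha>) * (L2_inner L a1 (\<phi> n) + Gamma (2 - \<alpha>) * L2_inner L f (\<phi> n))" for n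
  obtain p q where pq: "L2_sums L (\<lambda>n x. c n * \<phi> n x) p" "L2_sums L (\<lambda>n x. d n * \<phi> n x) q"
    "L2_eq L (u t) (\<lambda>x. p x + q x)" "u t \<in> L2_space L"
    using u t unfolding wave_solution_def c_def d_def by force
  note p = L2_sums_modes[OF on pq(1)] and q = L2_sums_modes[OF on pq(2)]
  have pq2: "(\<lambda>x. p x + q x) \<in> L2_space L" by (intro L2_space_add p q)
  have "in_closed_span L \<phi> (\<lambda>x. p x + 1 * q x)" by (intro in_closed_span_combine on p q)
  then show "in_closed_span L \<phi> (u t)" using in_closed_span_cong[OF on pq(3,4) pq2] by simp
  show "u t \<in> L2_space L" by (rule pq)
  assume k: "1 \<le> k"
  have \<phi>k: "\<phi> k \<in> L2_space L" using on k by (simp add: L2_orthonormal_def)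
  have "L2_inner L (u t) (\<phi> k) = c k + d k"
    using L2_inner_cong[OF pq(3,4) pq2 \<phi>k] L2_inner_add_left[OF p(1) q(1) \<phi>k] p(3)[OF k] q(3)[OF k] by simp
  then show "L2_inner L (u t) (\<phi> k) = mode_u \<alpha> (lam k) (L2_inner L a0 (\<phi> k))
      (L2_inner L a1 (\<phi> k) + Gamma (2 - \<alpha>) * L2_inner L f (\<phi> k)) t"
    by (simp add: c_def d_def mode_u_def mult_ac)
qed

lemma L1_deriv_L2:
  assumes "\<And>k. k \<le> n \<Longrightarrow> W k \<in> L2_space L"
  shows "L1_deriv \<beta> t W n \<in> L2_space L"
  unfolding L1_deriv_def[abs_def] by (intro L2_space_sum L2_space_scale L2_space_diff assms) auto

lemma L1_deriv_coefficient:
  assumes W: "\<And>k. k \<le> n \<Longrightarrow> W k \<in> L2_space L" and \<psi>: "\<psi> \<in> L2_space L"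
  shows "L2_inner L (L1_deriv \<beta> t W n) \<psi> =
    (\<Sum>k=1..n. L1_coeff \<beta> t n k * (L2_inner L (W k) \<psi> - L2_inner L (W (k - 1)) \<psi>))"
proof -
  have "L2_inner L (L1_deriv \<beta> t W n) \<psi> = (\<Sum>k=1..n. L2_inner L (\<lambda>x. L1_coeff \<beta> t n k * (W k x - W (k - 1) x)) \<psi>)"
    unfolding L1_deriv_def[abs_def] by (intro L2_inner_sum_left L2_space_scale L2_space_diff W \<psi>) auto
  also have "\<dots> = (\<Sum>k=1..n. L1_coeff \<beta> t n k * (L2_inner L (W k) \<psi> - L2_inner L (W (k - 1)) \<psi>))"
  proof (intro sum.cong refl)
    fix k assume "k \<in> {1..n}"
    then have "W k \<in> L2_space L" "W (k - 1) \<in> L2_space L" by (auto intro!: W)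
    then show "L2_inner L (\<lambda>x. L1_coeff \<beta> t n k * (W k x - W (k - 1) x)) \<psi>
        = L1_coeff \<beta> t n k * (L2_inner L (W k) \<psi> - L2_inner L (W (k - 1)) \<psi>)"
      unfolding L2_inner_scale_left using L2_inner_diff_left[OF _ _ \<psi>] by simp
  qed
  finally show ?thesis .
qed

lemma combined_datum_coefficient:
  assumes "a1 \<in> L2_space L" "f \<in> L2_space L" "\<psi> \<in> L2_space L" 
  shows "(\<lambda>x. a1 x + Gamma (2 - \<alpha>) * f x) \<in> L2_space L"
    "L2_inner L (\<lambda>x. a1 x + Gamma (2 - \<alpha>) * f x) \<psi> = L2_inner L a1 \<psi> + Gamma (2 - \<alpha>) * L2_inner L f \<psi>"
  using assms by (auto intro!: L2_space_add L2_space_scale simp: L2_inner_add_left L2_space_scale L2_inner_scale_left)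

text \<open>
The right-hand side of the scheme is \<open>\<omega>\<^bsub>2-\<alpha>\<^esub>(t\<^sub>n) (a1 + \<Gamma>(2-\<alpha>) f)\<close>, because
\<open>t powr (1-\<alpha>) = \<Gamma>(2-\<alpha>) \<omega>\<^bsub>2-\<alpha>\<^esub>(t)\<close>.
\<close>

lemma uv_scheme_modes:
  assumes on: "L2_orthonormal L \<phi>" and \<alpha>: "1 < \<alpha>" "\<alpha> < 2" and dat: "a0 \<in> L2_space L" "a1 \<in> L2_space L" "f \<in> L2_space L"
    and S: "uv_scheme L lam \<phi> \<alpha> a0 a1 f t N U V" and j: "1 \<le> j"
  defines "b \<equiv> L2_inner L a1 (\<phi> j) + Gamma (2 - \<alpha>) * L2_inner L f (\<phi> j)"
    and "Uh \<equiv> \<lambda>n. L2_inner L (U n) (\<phi> j)" and "Vh \<equiv> \<lambda>n. L2_inner L (V n) (\<phi> j)"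
  shows "Uh 0 = L2_inner L a0 (\<phi> j)" "Vh 0 = 0"
    "mode_scheme (\<alpha> / 2) (lam j) t N (\<lambda>n. b * omega (2 - \<alpha>) (t n)) (\<lambda>n. 0) Uh Vh"
proof -
  have \<phi>j: "\<phi> j \<in> L2_space L" using on j by (simp add: L2_orthonormal_def)
  have L2: "U n \<in> L2_space L" "V n \<in> L2_space L" if "n \<le> N" for n using S that by (auto simp: uv_scheme_def)
  show "Uh 0 = L2_inner L a0 (\<phi> j)"
    unfolding Uh_def using S by (intro L2_inner_cong L2 dat \<phi>j) (auto simp: uv_scheme_def)
  have "Vh 0 = L2_inner L (\<lambda>x. 0) (\<phi> j)"
    unfolding Vh_def using S by (intro L2_inner_cong L2 L2_space_zero \<phi>j) (auto simp: uv_scheme_def)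
  then show "Vh 0 = 0" by (simp add: L2_inner_def)
  show "mode_scheme (\<alpha> / 2) (lam j) t N (\<lambda>n. b * omega (2 - \<alpha>) (t n)) (\<lambda>n. 0) Uh Vh"
    unfolding mode_scheme_def
  proof (intro ballI conjI)
  fix n assume n: "n \<in> {1..N}"
  have Un: "U k \<in> L2_space L" "V k \<in> L2_space L" if "k \<le> n" for k using L2[of k] that n by auto
  have "L2_eq L (V n) (L1_deriv (\<alpha> / 2) t U n)" using S n by (auto simp: uv_scheme_def)
  from L2_inner_cong[OF this Un(2)[OF order_refl] L1_deriv_L2[OF Un(1)] \<phi>j]
  show "Vh n + 0 = (\<Sum>k=1..n. L1_coeff (\<alpha> / 2) t n k * (Uh k - Uh (k - 1)))"
    unfolding Vh_def Uh_def by (simp add: L1_deriv_coefficient[OF Un(1) \<phi>j])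
  have "weak_eq L lam \<phi> (L1_deriv (\<alpha> / 2) t V n) (U n) (\<lambda>x. a1 x * omega (2 - \<alpha>) (t n) + t n powr (1 - \<alpha>) * f x)"
    using S n by (auto simp: uv_scheme_def)
  then have "L2_inner L (L1_deriv (\<alpha> / 2) t V n) (\<phi> j) + lam j * Uh n =
      L2_inner L (\<lambda>x. a1 x * omega (2 - \<alpha>) (t n) + t n powr (1 - \<alpha>) * f x) (\<phi> j)"
    using j by (simp add: weak_eq_def Uh_def)
  also have "(\<lambda>x. a1 x * omega (2 - \<alpha>) (t n) + t n powr (1 - \<alpha>) * f x) =
      (\<lambda>x. omega (2 - \<alpha>) (t n) * (a1 x + Gamma (2 - \<alpha>) * f x))"
  proof -
    have "Gamma (2 - \<alpha>) > 0" using \<alpha> by (intro Gamma_real_pos) auto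
    then show ?thesis by (auto simp: omega_def field_simps)
  qed
  also have "L2_inner L \<dots> (\<phi> j) = b * omega (2 - \<alpha>) (t n)"
    unfolding L2_inner_scale_left combined_datum_coefficient(2)[OF dat(2,3) \<phi>j] by (simp add: b_def)
  finally show "(\<Sum>k=1..n. L1_coeff (\<alpha> / 2) t n k * (Vh k - Vh (k - 1))) + lam j * Uh n = b * omega (2 - \<alpha>) (t n)"
    unfolding Vh_def by (simp add: L1_deriv_coefficient[OF Un(2) \<phi>j])
  qed
qed

lemma uz_scheme_modes:
  assumes on: "L2_orthonormal L \<phi>" and dat: "a0 \<in> L2_space L" "a1 \<in> L2_space L" "f \<in> L2_space L"
    and S: "uz_scheme L lam \<phi> \<alpha> a0 a1 f t N U Z" and j: "1 \<le> j"
  defines "b \<equiv> L2_inner L a1 (\<phi> j) + Gamma (2 - \<alpha>) * L2_inner L f (\<phi> j)"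
    and "Uh \<equiv> \<lambda>n. L2_inner L (U n) (\<phi> j)" and "Zh \<equiv> \<lambda>n. L2_inner L (Z n) (\<phi> j)"
  shows "Uh 0 = L2_inner L a0 (\<phi> j)" "Zh 0 = 0"
    "mode_scheme (\<alpha> / 2) (lam j) t N (\<lambda>n. 0) (\<lambda>n. b * omega (2 - \<alpha> / 2) (t n)) Uh Zh"
proof -
  have \<phi>j: "\<phi> j \<in> L2_space L" using on j by (simp add: L2_orthonormal_def)
  have L2: "U n \<in> L2_space L" "Z n \<in> L2_space L" if "n \<le> N" for n using S that by (auto simp: uz_scheme_def)
  show "Uh 0 = L2_inner L a0 (\<phi> j)"
    unfolding Uh_def using S by (intro L2_inner_cong L2 dat \<phi>j) (auto simp: uz_scheme_def)
  have z: "L2_inner L (\<lambda>x. 0) (\<phi> j) = 0" by (simp add: L2_inner_def)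
  have "Zh 0 = L2_inner L (\<lambda>x. 0) (\<phi> j)"
    unfolding Zh_def using S by (intro L2_inner_cong L2 L2_space_zero \<phi>j) (auto simp: uz_scheme_def)
  then show "Zh 0 = 0" using z by simp
  show "mode_scheme (\<alpha> / 2) (lam j) t N (\<lambda>n. 0) (\<lambda>n. b * omega (2 - \<alpha> / 2) (t n)) Uh Zh"
    unfolding mode_scheme_def
  proof (intro ballI conjI)
  fix n assume n: "n \<in> {1..N}"
  have Un: "U k \<in> L2_space L" "Z k \<in> L2_space L" if "k \<le> n" for k using L2[of k] that n by auto
  define w where "w x = omega (2 - \<alpha> / 2) (t n) * (a1 x + Gamma (2 - \<alpha>) * f x)" for x
  have w: "w \<in> L2_space L" unfolding w_def[abs_def] by (intro L2_space_scale combined_datum_coefficient(1)[OF dat(2,3) \<phi>j])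
  have "L2_eq L (Z n) (\<lambda>x. L1_deriv (\<alpha> / 2) t U n x - w x)"
    using S n by (auto simp: uz_scheme_def w_def mult.commute)
  moreover have LU: "L1_deriv (\<alpha> / 2) t U n \<in> L2_space L" by (rule L1_deriv_L2) (rule Un(1))
  ultimately have "Zh n = L2_inner L (L1_deriv (\<alpha> / 2) t U n) (\<phi> j) - L2_inner L w (\<phi> j)"
    unfolding Zh_def L2_inner_diff_left[OF LU w \<phi>j, symmetric]
    by (intro L2_inner_cong Un(2) order_refl L2_space_diff LU w \<phi>j)
  also have "L2_inner L w (\<phi> j) = b * omega (2 - \<alpha> / 2) (t n)"
    unfolding w_def[abs_def] L2_inner_scale_left combined_datum_coefficient(2)[OF dat(2,3) \<phi>j] by (simp add: b_def)
  finally show "Zh n + b * omega (2 - \<alpha> / 2) (t n) = (\<Sum>k=1..n. L1_coeff (\<alpha> / 2) t n k * (Uh k - Uh (k - 1)))"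
    unfolding Uh_def by (simp add: L1_deriv_coefficient[OF Un(1) \<phi>j])
  have "weak_eq L lam \<phi> (L1_deriv (\<alpha> / 2) t Z n) (U n) (\<lambda>x. 0)" using S n by (auto simp: uz_scheme_def)
  then have "L2_inner L (L1_deriv (\<alpha> / 2) t Z n) (\<phi> j) + lam j * Uh n = 0"
    using j z by (simp add: weak_eq_def Uh_def)
  then show "(\<Sum>k=1..n. L1_coeff (\<alpha> / 2) t n k * (Zh k - Zh (k - 1))) + lam j * Uh n = 0"
    unfolding Zh_def by (simp add: L1_deriv_coefficient[OF Un(2) \<phi>j])
  qed
qed

lemma H2_H10_mode_coefficients:
  assumes L: "L > 0" and e: "dirichlet_eigenpairs L lam \<phi>" and w: "w \<in> H2_space L" "w \<in> H10_space L"
  obtains ddw where "ddw \<in> L2_space L" "\<And>k. 1 \<le> k \<Longrightarrow> lam k * L2_inner L w (\<phi> k) = - L2_inner L ddw (\<phi> k)"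
proof -
  obtain ddw where d: "ddw \<in> L2_space L"
    "\<And>\<kappa>. \<kappa> > 0 \<Longrightarrow> sin (\<kappa> * L) = 0 \<Longrightarrow> \<kappa>\<^sup>2 * L2_inner L w (\<lambda>x. sin (\<kappa> * x)) = - L2_inner L ddw (\<lambda>x. sin (\<kappa> * x))"
    using H2_H10_sine_coefficient[OF L w] by metis
  have "lam k * L2_inner L w (\<phi> k) = - L2_inner L ddw (\<phi> k)" if k: "1 \<le> k" for k
  proof -
    note s = dirichlet_eigenpairs_sine[OF L e k]
    obtain c where c: "\<And>x. x \<in> {0..L} \<Longrightarrow> \<phi> k x = c * sin (sqrt (lam k) * x)" using s(2) by blast
    have "(pi / L)\<^sup>2 > 0" using L by simp
    then have pos: "lam k > 0" using s(1) by linarith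
    have eq: "L2_inner L v (\<phi> k) = c * L2_inner L v (\<lambda>x. sin (sqrt (lam k) * x))" for v
    proof -
      have "L2_inner L v (\<phi> k) = L2_inner L (\<lambda>x. c * sin (sqrt (lam k) * x)) v"
        unfolding L2_inner_commute[of L v] by (rule L2_inner_cong_on) (use c in auto)
      then show ?thesis by (simp add: L2_inner_scale_left L2_inner_commute)
    qed
    have "lam k * L2_inner L w (\<lambda>x. sin (sqrt (lam k) * x)) = - L2_inner L ddw (\<lambda>x. sin (sqrt (lam k) * x))"
      using d(2)[of "sqrt (lam k)"] s(3) pos by simp
    then show ?thesis unfolding eq by (metis mult.left_commute mult_minus_right)
  qed
  then show ?thesis using that d(1) by blast
qed

text \<open>
\<open>K\<^sup>2\<close> is twice the sum of the squared norms of the second derivative of \<open>a0\<close> and of \<open>a1 + \<Gamma>(2-\<alpha>) f\<close>,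
which bounds the sum over the modes of \<open>(\<lambda> \<bar>a\<bar> + \<bar>b\<bar>)\<^sup>2\<close>.
\<close>

theorem L2_error_from_mode_errors:
  assumes L: "L > 0" and e: "dirichlet_eigenpairs L lam \<phi>"
    and a0: "a0 \<in> H2_space L" "a0 \<in> H10_space L" and dat: "a1 \<in> L2_space L" "f \<in> L2_space L"
    and u: "wave_solution L T lam \<phi> \<alpha> a0 a1 f u"
  shows "\<exists>K\<ge>0. \<forall>t C W. 0 \<le> t \<longrightarrow> t \<le> T \<longrightarrow> C \<ge> 0 \<longrightarrow> W \<in> H10_space L \<longrightarrow>
     (\<forall>k\<ge>1. \<bar>mode_u \<alpha> (lam k) (L2_inner L a0 (\<phi> k)) (L2_inner L a1 (\<phi> k) + Gamma (2 - \<alpha>) * L2_inner L f (\<phi> k)) t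
        - L2_inner L W (\<phi> k)\<bar>
       \<le> C * (lam k * \<bar>L2_inner L a0 (\<phi> k)\<bar> + \<bar>L2_inner L a1 (\<phi> k) + Gamma (2 - \<alpha>) * L2_inner L f (\<phi> k)\<bar>)) \<longrightarrow>
     L2_norm L (\<lambda>x. u t x - W x) \<le> C * K"
proof -
  note on = dirichlet_eigenpairs_orthonormal[OF L e]
  obtain ddw where ddw: "ddw \<in> L2_space L" "\<And>k. 1 \<le> k \<Longrightarrow> lam k * L2_inner L a0 (\<phi> k) = - L2_inner L ddw (\<phi> k)"
    using H2_H10_mode_coefficients[OF L e a0] by metis
  define b where "b x = a1 x + Gamma (2 - \<alpha>) * f x" for x
  have b: "b \<in> L2_space L" unfolding b_def[abs_def] by (intro L2_space_add L2_space_scale dat)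
  define K where "K = sqrt (2 * (L2_norm L ddw)\<^sup>2 + 2 * (L2_norm L b)\<^sup>2)"
  show ?thesis
  proof (intro exI[of _ K] conjI allI impI)
    show "K \<ge> 0" by (simp add: K_def)
    fix t C W assume t: "0 \<le> t" "t \<le> T" and C: "C \<ge> 0" and W: "W \<in> H10_space L"
      and bd': "\<forall>k\<ge>1. \<bar>mode_u \<alpha> (lam k) (L2_inner L a0 (\<phi> k)) (L2_inner L a1 (\<phi> k) + Gamma (2 - \<alpha>) * L2_inner L f (\<phi> k)) t
        - L2_inner L W (\<phi> k)\<bar>
       \<le> C * (lam k * \<bar>L2_inner L a0 (\<phi> k)\<bar> + \<bar>L2_inner L a1 (\<phi> k) + Gamma (2 - \<alpha>) * L2_inner L f (\<phi> k)\<bar>)"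
    note bd = bd'[rule_format]
    have W2: "W \<in> L2_space L" using W by (simp add: H10_space_def)
    note um = wave_solution_modes[OF on u t]
    show "L2_norm L (\<lambda>x. u t x - W x) \<le> C * K"
    proof (rule L2_norm_le_coefficients[OF on])
      show "(\<lambda>x. u t x - W x) \<in> L2_space L" by (intro L2_space_diff um W2)
      have "in_closed_span L \<phi> (\<lambda>x. u t x + (- 1) * W x)"
        by (intro in_closed_span_combine on um W2 H10_in_closed_span[OF L e W])
      then show "in_closed_span L \<phi> (\<lambda>x. u t x - W x)" by simp
      show "C * K \<ge> 0" using C by (simp add: K_def)
      fix M
      have term_bound: "(L2_inner L (\<lambda>x. u t x - W x) (\<phi> k))\<^sup>2 \<le> C\<^sup>2 * (2 * (L2_inner L ddw (\<phi> k))\<^sup>2 + 2 * (L2_inner L b (\<phi> k))\<^sup>2)"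
        if "k \<in> {1..M}" for k
      proof -
        have k: "1 \<le> k" using that by simp
        have \<phi>k: "\<phi> k \<in> L2_space L" using on k by (simp add: L2_orthonormal_def)
        have lam: "lam k \<ge> 0" using dirichlet_eigenpairs_sine(1)[OF L e k] by (rule order_trans[rotated]) simp
        have bk: "L2_inner L b (\<phi> k) = L2_inner L a1 (\<phi> k) + Gamma (2 - \<alpha>) * L2_inner L f (\<phi> k)"
          unfolding b_def[abs_def] by (rule combined_datum_coefficient(2)[OF dat \<phi>k])
        have la: "lam k * \<bar>L2_inner L a0 (\<phi> k)\<bar> = \<bar>L2_inner L ddw (\<phi> k)\<bar>"
        proof -
          have "lam k * \<bar>L2_inner L a0 (\<phi> k)\<bar> = \<bar>lam k * L2_inner L a0 (\<phi> k)\<bar>" using lam by (simp add: abs_mult)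
          then show ?thesis using ddw(2)[OF k] by simp
        qed
        define x y where "x = \<bar>L2_inner L ddw (\<phi> k)\<bar>" and "y = \<bar>L2_inner L b (\<phi> k)\<bar>"
        have "\<bar>L2_inner L (\<lambda>x. u t x - W x) (\<phi> k)\<bar> \<le> C * (x + y)"
          using bd[OF k] unfolding L2_inner_diff_left[OF um(1) W2 \<phi>k] um(3)[OF k] la bk x_def y_def .
        then have "\<bar>L2_inner L (\<lambda>x. u t x - W x) (\<phi> k)\<bar>\<^sup>2 \<le> (C * (x + y))\<^sup>2" by (rule power_mono) simp
        also have "\<dots> = C\<^sup>2 * (x + y)\<^sup>2" by (simp add: power_mult_distrib)
        also have "\<dots> \<le> C\<^sup>2 * (2 * x\<^sup>2 + 2 * y\<^sup>2)"
          using sum_squares_bound[of x y] by (intro mult_left_mono) (auto simp: power2_sum)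
        finally show ?thesis by (simp add: x_def y_def)
      qed
      have "(\<Sum>k=1..M. (L2_inner L (\<lambda>x. u t x - W x) (\<phi> k))\<^sup>2)
          \<le> (\<Sum>k=1..M. C\<^sup>2 * (2 * (L2_inner L ddw (\<phi> k))\<^sup>2 + 2 * (L2_inner L b (\<phi> k))\<^sup>2))"
        by (rule sum_mono) (rule term_bound)
      also have "\<dots> = C\<^sup>2 * (2 * (\<Sum>k=1..M. (L2_inner L ddw (\<phi> k))\<^sup>2) + 2 * (\<Sum>k=1..M. (L2_inner L b (\<phi> k))\<^sup>2))"
        by (simp only: sum_distrib_left sum.distrib distrib_left)
      also have "\<dots> \<le> C\<^sup>2 * (2 * (L2_norm L ddw)\<^sup>2 + 2 * (L2_norm L b)\<^sup>2)"
        using L2_bessel_inequality[OF on ddw(1), of M] L2_bessel_inequality[OF on b, of M] by (intro mult_left_mono add_mono) auto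
      also have "\<dots> = (C * K)\<^sup>2" by (simp add: K_def power_mult_distrib)
      finally show "(\<Sum>k=1..M. (L2_inner L (\<lambda>x. u t x - W x) (\<phi> k))\<^sup>2) \<le> (C * K)\<^sup>2" .
    qed
  qed
qed

theorem proposition3:
  fixes L T \<alpha> :: real
    and lam :: "nat \<Rightarrow> real" and \<phi> :: "nat \<Rightarrow> real \<Rightarrow> real"
    and a0 a1 f :: "real \<Rightarrow> real" and u :: "real \<Rightarrow> real \<Rightarrow> real"
  assumes "L > 0" and "T > 0" and "1 < \<alpha>" and "\<alpha> < 2"
    and "dirichlet_eigenpairs L lam \<phi>"
    and "a0 \<in> H2_space L \<inter> H10_space L" and "a1 \<in> L2_space L" and "f \<in> L2_space L"
    and "wave_solution L T lam \<phi> \<alpha> a0 a1 f u"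
  shows "(\<forall>r. r = (4 - \<alpha>) / (2 - \<alpha>) \<longrightarrow>
            (\<exists>C. \<forall>N\<ge>1. \<forall>U V. uv_scheme L lam \<phi> \<alpha> a0 a1 f (mesh T r N) N U V \<longrightarrow>
               (MAX n\<in>{1..N}. L2_norm L (\<lambda>x. u (mesh T r N n) x - U n x))
                 \<le> C * real N powr (- (2 - \<alpha> / 2)))) \<and>
         (\<forall>r. r = max ((4 - \<alpha>) / \<alpha>) 2 \<longrightarrow>
            (\<exists>C. \<forall>N\<ge>1. \<forall>U Z. uz_scheme L lam \<phi> \<alpha> a0 a1 f (mesh T r N) N U Z \<longrightarrow>
               (MAX n\<in>{1..N}. L2_norm L (\<lambda>x. u (mesh T r N n) x - U n x))
                 \<le> C * real N powr (- (2 - \<alpha> / 2))))"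
proof -
  note L = assms(1) and T = assms(2) and \<alpha> = assms(3,4) and e = assms(5) and dat = assms(7,8) and u = assms(9)
  have a0: "a0 \<in> H2_space L" "a0 \<in> H10_space L" and a02: "a0 \<in> L2_space L"
    using assms(6) by (auto simp: H2_space_def)
  note on = dirichlet_eigenpairs_orthonormal[OF L e]
  define lam0 where "lam0 = (pi / L)\<^sup>2"
  have lam0: "lam0 > 0" using L by (simp add: lam0_def)
  have lam: "lam0 \<le> lam k" if "1 \<le> k" for k using dirichlet_eigenpairs_sine(1)[OF L e that] by (simp add: lam0_def)
  define ah where "ah k = L2_inner L a0 (\<phi> k)" for k
  define bh where "bh k = L2_inner L a1 (\<phi> k) + Gamma (2 - \<alpha>) * L2_inner L f (\<phi> k)" for k
  obtain K where K: "K \<ge> 0" "\<forall>t C W. 0 \<le> t \<longrightarrow> t \<le> T \<longrightarrow> C \<ge> 0 \<longrightarrow> W \<in> H10_space L \<longrightarrow>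
     (\<forall>k\<ge>1. \<bar>mode_u \<alpha> (lam k) (ah k) (bh k) t - L2_inner L W (\<phi> k)\<bar> \<le> C * (lam k * \<bar>ah k\<bar> + \<bar>bh k\<bar>)) \<longrightarrow>
     L2_norm L (\<lambda>x. u t x - W x) \<le> C * K"
    using L2_error_from_mode_errors[OF L e a0 dat u] unfolding ah_def[symmetric] bh_def[symmetric]
    by (elim exE conjE) (rule that)
  have transfer: "\<exists>C. \<forall>N\<ge>1. \<forall>U V. S N U V \<longrightarrow>
      (MAX n\<in>{1..N}. L2_norm L (\<lambda>x. u (mesh T r N n) x - U n x)) \<le> C * real N powr (- (2 - \<alpha> / 2))"
    if r: "r \<ge> 1" and acc: "\<exists>C>0. mode_scheme_accurate \<alpha> T r lam0 F G C"
      and S: "\<And>N U V n. S N U V \<Longrightarrow> n \<in> {1..N} \<Longrightarrow> U n \<in> H10_space L"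
        "\<And>N U V k. S N U V \<Longrightarrow> 1 \<le> k \<Longrightarrow> L2_inner L (U 0) (\<phi> k) = ah k \<and> L2_inner L (V 0) (\<phi> k) = 0 \<and>
          mode_scheme (\<alpha> / 2) (lam k) (mesh T r N) N (\<lambda>n. F (bh k) (mesh T r N n)) (\<lambda>n. G (bh k) (mesh T r N n))
            (\<lambda>n. L2_inner L (U n) (\<phi> k)) (\<lambda>n. L2_inner L (V n) (\<phi> k))"
    for r F G and S :: "nat \<Rightarrow> (nat \<Rightarrow> real \<Rightarrow> real) \<Rightarrow> (nat \<Rightarrow> real \<Rightarrow> real) \<Rightarrow> bool"
  proof -
    obtain C where C: "C > 0" "mode_scheme_accurate \<alpha> T r lam0 F G C" using acc by blast
    show ?thesis
    proof (intro exI[of _ "C * K"] allI impI)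
      fix N U V assume N: "1 \<le> N" and SN: "S N U V"
      show "(MAX n\<in>{1..N}. L2_norm L (\<lambda>x. u (mesh T r N n) x - U n x)) \<le> C * K * real N powr (- (2 - \<alpha> / 2))"
      proof (rule Max.boundedI)
        show "finite ((\<lambda>n. L2_norm L (\<lambda>x. u (mesh T r N n) x - U n x)) ` {1..N})" by simp
        show "(\<lambda>n. L2_norm L (\<lambda>x. u (mesh T r N n) x - U n x)) ` {1..N} \<noteq> {}" using N by auto
        fix y assume "y \<in> (\<lambda>n. L2_norm L (\<lambda>x. u (mesh T r N n) x - U n x)) ` {1..N}"
        then obtain n where n: "n \<in> {1..N}" "y = L2_norm L (\<lambda>x. u (mesh T r N n) x - U n x)" by blast
        have modes: "\<bar>mode_u \<alpha> (lam k) (ah k) (bh k) (mesh T r N n) - L2_inner L (U n) (\<phi> k)\<bar>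
            \<le> C * (lam k * \<bar>ah k\<bar> + \<bar>bh k\<bar>) * real N powr (- (2 - \<alpha> / 2))" if k: "1 \<le> k" for k
          using C(2)[unfolded mode_scheme_accurate_def, rule_format, where V = "\<lambda>n. L2_inner L (V n) (\<phi> k)"
              and U = "\<lambda>n. L2_inner L (U n) (\<phi> k)", OF lam[OF k] _ _ _ n(1)] S(2)[OF SN k] by blast
        have "0 < mesh T r N n" "mesh T r N n \<le> T" using mesh_pos[OF T r N, of n] mesh_le[OF T r N, of n] n by auto
        then have "y \<le> (C * real N powr (- (2 - \<alpha> / 2))) * K"
          unfolding n(2) using C(1) modes by (intro K(2)[rule_format] S(1)[OF SN n(1)]) (auto simp: mult_ac)
        then show "y \<le> (C * K) * real N powr (- (2 - \<alpha> / 2))" by (simp add: mult_ac)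
      qed
    qed
  qed
  show ?thesis
  proof (intro conjI allI impI)
    fix r assume r: "r = (4 - \<alpha>) / (2 - \<alpha>)"
    have "r \<ge> 1" using \<alpha> by (simp add: r field_simps)
    then show "\<exists>C. \<forall>N\<ge>1. \<forall>U V. uv_scheme L lam \<phi> \<alpha> a0 a1 f (mesh T r N) N U V \<longrightarrow>
               (MAX n\<in>{1..N}. L2_norm L (\<lambda>x. u (mesh T r N n) x - U n x))
                 \<le> C * real N powr (- (2 - \<alpha> / 2))"
    proof (rule transfer[OF _ uv_mode_error[OF \<alpha> T lam0 r]])
      show "U n \<in> H10_space L" if "uv_scheme L lam \<phi> \<alpha> a0 a1 f (mesh T r N) N U V" "n \<in> {1..N}" for N U V n
        using that by (auto simp: uv_scheme_def)
    qed (use uv_scheme_modes[OF on \<alpha> a02 dat] in \<open>auto simp: ah_def bh_def\<close>)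
  next
    fix r assume r: "r = max ((4 - \<alpha>) / \<alpha>) 2"
    have "r \<ge> 1" by (simp add: r)
    then show "\<exists>C. \<forall>N\<ge>1. \<forall>U Z. uz_scheme L lam \<phi> \<alpha> a0 a1 f (mesh T r N) N U Z \<longrightarrow>
               (MAX n\<in>{1..N}. L2_norm L (\<lambda>x. u (mesh T r N n) x - U n x))
                 \<le> C * real N powr (- (2 - \<alpha> / 2))"
    proof (rule transfer[OF _ uz_mode_error[OF \<alpha> T lam0 r]])
      show "U n \<in> H10_space L" if "uz_scheme L lam \<phi> \<alpha> a0 a1 f (mesh T r N) N U Z" "n \<in> {1..N}" for N U Z n
        using that by (auto simp: uz_scheme_def)
    qed (use uz_scheme_modes[OF on a02 dat] in \<open>auto simp: ah_def bh_def\<close>)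
  qed
qed

end
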